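(* Let $\mathcal F$ be a saturated fusion system on a finite $p$-group $S$, and write $N\le A(\mathcal F)_{(p)}$ for the $\mathbb Z_{(p)}$-submodule generated by $\beta_P$ for non-$\mathcal F$-centric $P\le S$. Then $N$ is an ideal in the Burnside ring $A(\mathcal F)_{(p)}$, and there is a ring isomorphism $A(\mathcal F)_{(p)}/N\cong A^{cent}(\mathcal F)_{(p)}$ with the Burnside ring of Diaz–Libman. The basis element $\xi_S$ is invertible in $A^{cent}(\mathcal F)_{(p)}$, and the isomorphism is given by $$\overline{\beta_P}\mapsto\frac{\xi_P}{\xi_S}$$ for $\mathcal F$-centric $P\le S$.
   Context: Here $p$ is a prime and $p$-groups are finite. A fusion system $\mathcal F$ on a $p$-group $S$ is a category whose objects are the subgroups of $S$, whose morphism sets $\mathcal F(P,Q)=\mathrm{Hom}_{\mathcal F}(P,Q)$ consist of injective group homomorphisms $P\to Q$ (composed as homomorphisms) and contain all homomorphisms $P\to Q$ induced by conjugation by elements of $S$, and such that for each $\varphi\in\mathcal F(P,Q)$ the isomorphism $\varphi\colon P\to\varphi P$ and its inverse are morphisms of $\mathcal F$. Write $\mathrm{Aut}_{\mathcal F}(P)=\mathcal F(P,P)$. Subgroups $P,Q$ are $\mathcal F$-conjugate ($P\sim_{\mathcal F}Q$) if they are isomorphic in $\mathcal F$; $[P]_{\mathcal F}$ is the set of $\mathcal F$-conjugates of $P$. $P$ is fully $\mathcal F$-normalized (resp. fully $\mathcal F$-centralized) if $|N_SP|\ge|N_SQ|$ (resp. $|C_SP|\ge|C_SQ|$) for all $Q\in[P]_{\mathcal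 F}$. $\mathcal F$ is saturated if for all $P\le S$: (1) if $P$ is fully $\mathcal F$-normalized, then $P$ is fully $\mathcal F$-centralized and $\mathrm{Aut}_S(P)$ is a Sylow $p$-subgroup of $\mathrm{Aut}_{\mathcal F}(P)$; (2) every $\varphi\in\mathcal F(P,S)$ with $\varphi(P)$ fully $\mathcal F$-centralized extends to a morphism in $\mathcal F(N_\varphi,S)$, where $N_\varphi=\{x\in N_S(P)\mid \exists y\in S:\varphi\circ c_x=c_y\circ\varphi\}$. $P\le S$ is $\mathcal F$-centric if $C_S(P')\le P'$ for all $P'\sim_{\mathcal F}P$. $A(S)$ is the Burnside ring of $S$, $\Phi_Q\colon A(S)\to\mathbb Z$ the ring homomorphism counting $Q$-fixed points, $(p)$ denotes tensoring with $\mathbb Z_{(p)}$. $X\in A(S)_{(p)}$ is $\mathcal F$-stable if for all $P\le S$ and $\varphi\in\mathcal F(P,S)$ the restrictions of $X$ to $A(P)_{(p)}$ along $\varphi$ and along the inclusion agree; equivalently, $\Phi_P(X)=\Phi_Q(X)$ whenever $P\sim_{\mathcal F}Q$. $A(\mathcal F)_{(p)}$ is the subring of $\mathcal F$-stable elements of $A(S)_{(p)}$. For $P\le S$, $\beta_P\in A(\mathcal F)_{(p)}$ is the (existing, unique) element with $\Phi_Q(\beta_P)=\frac1{|[Q]_{\mathcal F}|}\sum_{Q'\in[Q]_{\mathcal F}}\Phi_{Q'}([S/P])$ for all $Q\le S$; the $\beta_P$, $P$ up to $\mathcal F$-conjugation, form a $\mathbb Z_{(p)}$-basis of $A(\mathcal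 F)_{(p)}$. $\overline{\beta_P}$ is the class of $\beta_P$ in $A(\mathcal F)_{(p)}/N$. The Diaz–Libman Burnside ring $A^{cent}(\mathcal F)$ is constructed from an orbit category over the $\mathcal F$-centric subgroups of $S$ (objects the $\mathcal F$-centric subgroups, morphisms $P\to Q$ the classes $\mathrm{Inn}(Q)\backslash\mathcal F(P,Q)$), as the Grothendieck ring of its finite formal coproducts with $\xi_P$ the class of the object $P$. For the present purposes it is determined up to isomorphism by the following known properties: it is a commutative ring (not assumed unital) that is free as an abelian group on elements $\xi_P$ indexed by the $\mathcal F$-conjugacy classes of $\mathcal F$-centric subgroups $P\le S$, and there is an injective ring homomorphism with finite cokernel $$\Phi^{cent}\colon A^{cent}(\mathcal F)\to\prod_{[Q]_{\mathcal F},\,Q\ \mathcal F\text{-centric}}\mathbb Z,\qquad \Phi^{cent}_Q(\xi_P)=\frac{|Z(Q)|\cdot|\mathcal F(Q,P)|}{|P|}.$$ *)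

theory Defs
  imports
    Complex_Main
    "HOL-Algebra.Group_Action"
    "HOL-Algebra.Left_Coset"
    "HOL-Algebra.Module"
    "HOL-Algebra.QuotRing"
    "HOL-Computational_Algebra.Primes"
begin

section \<open>Saturated fusion systems\<close>

definition conj_map :: "('a, 'm) monoid_scheme \<Rightarrow> 'a set \<Rightarrow> 'a \<Rightarrow> 'a \<Rightarrow> 'a" where
  "conj_map S P x = (\<lambda>u\<in>P. x \<otimes>\<^bsub>S\<^esub> u \<otimes>\<^bsub>S\<^esub> inv\<^bsub>S\<^esub> x)"

text \<open>
  A fusion system is given by its morphism sets: \<open>F P Q\<close> is the set of morphisms from \<open>P\<close>
  to \<open>Q\<close>. Morphisms are extensional functions on their source, so that equality of morphisms is
  equality of functions and \<open>card (F P Q)\<close> is the number of morphisms. Only the values of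
  \<open>F\<close> at subgroups are meaningful.
\<close>

locale fusion_system = group S for S (structure) +
  fixes p :: nat and F :: "'a set \<Rightarrow> 'a set \<Rightarrow> ('a \<Rightarrow> 'a) set"
  assumes prime_p: "Factorial_Ring.prime p"
    and finite_S: "finite (carrier S)"
    and p_group: "\<exists>n. order S = p ^ n"
    and mor_inj_hom: "\<lbrakk>subgroup P S; subgroup Q S; \<phi> \<in> F P Q\<rbrakk> \<Longrightarrow>
        \<phi> \<in> extensional P \<and> \<phi> \<in> hom (S\<lparr>carrier := P\<rparr>) (S\<lparr>carrier := Q\<rparr>) \<and> inj_on \<phi> P"
    and mor_compose: "\<lbrakk>subgroup P S; subgroup Q S; subgroup R S; \<phi> \<in> F P Q; \<psi> \<in> F Q R\<rbrakk> \<Longrightarrow>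
        compose P \<psi> \<phi> \<in> F P R"
    and mor_conj: "\<lbrakk>subgroup P S; subgroup Q S; x \<in> carrier S; conj_map S P x ` P \<subseteq> Q\<rbrakk> \<Longrightarrow>
        conj_map S P x \<in> F P Q"
    and mor_image: "\<lbrakk>subgroup P S; subgroup Q S; \<phi> \<in> F P Q\<rbrakk> \<Longrightarrow> \<phi> \<in> F P (\<phi> ` P)"
    and mor_inverse: "\<lbrakk>subgroup P S; subgroup Q S; \<phi> \<in> F P Q\<rbrakk> \<Longrightarrow>
        restrict (inv_into P \<phi>) (\<phi> ` P) \<in> F (\<phi> ` P) P"

definition F_conj ::
  "('a, 'm) monoid_scheme \<Rightarrow> ('a set \<Rightarrow> 'a set \<Rightarrow> ('a \<Rightarrow> 'a) set) \<Rightarrow> 'a set \<Rightarrow> 'a set \<Rightarrow> bool" where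
  "F_conj S F P Q \<longleftrightarrow> subgroup P S \<and> subgroup Q S \<and>
     (\<exists>\<phi>\<in>F P Q. \<exists>\<psi>\<in>F Q P. compose P \<psi> \<phi> = (\<lambda>x\<in>P. x) \<and> compose Q \<phi> \<psi> = (\<lambda>x\<in>Q. x))"

definition F_class ::
  "('a, 'm) monoid_scheme \<Rightarrow> ('a set \<Rightarrow> 'a set \<Rightarrow> ('a \<Rightarrow> 'a) set) \<Rightarrow> 'a set \<Rightarrow> 'a set set" where
  "F_class S F P = {Q. F_conj S F P Q}"

definition centralizer :: "('a, 'm) monoid_scheme \<Rightarrow> 'a set \<Rightarrow> 'a set" where
  "centralizer S P = {x \<in> carrier S. \<forall>y\<in>P. x \<otimes>\<^bsub>S\<^esub> y = y \<otimes>\<^bsub>S\<^esub> x}"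

definition fully_normalized ::
  "('a, 'm) monoid_scheme \<Rightarrow> ('a set \<Rightarrow> 'a set \<Rightarrow> ('a \<Rightarrow> 'a) set) \<Rightarrow> 'a set \<Rightarrow> bool" where
  "fully_normalized S F P \<longleftrightarrow> (\<forall>Q\<in>F_class S F P. card (normalizer S Q) \<le> card (normalizer S P))"

definition fully_centralized ::
  "('a, 'm) monoid_scheme \<Rightarrow> ('a set \<Rightarrow> 'a set \<Rightarrow> ('a \<Rightarrow> 'a) set) \<Rightarrow> 'a set \<Rightarrow> bool" where
  "fully_centralized S F P \<longleftrightarrow> (\<forall>Q\<in>F_class S F P. card (centralizer S Q) \<le> card (centralizer S P))"

definition sylow_subgroup :: "nat \<Rightarrow> 'g set \<Rightarrow> ('g, 'm) monoid_scheme \<Rightarrow> bool" where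
  "sylow_subgroup p H G \<longleftrightarrow> subgroup H G \<and> card H = p ^ multiplicity p (order G)"

definition Aut_F :: "('a set \<Rightarrow> 'a set \<Rightarrow> ('a \<Rightarrow> 'a) set) \<Rightarrow> 'a set \<Rightarrow> ('a \<Rightarrow> 'a) monoid" where
  "Aut_F F P = BijGroup P\<lparr>carrier := F P P\<rparr>"

definition Aut_S :: "('a, 'm) monoid_scheme \<Rightarrow> 'a set \<Rightarrow> ('a \<Rightarrow> 'a) set" where
  "Aut_S S P = conj_map S P ` normalizer S P"

text \<open>\<open>ext_domain S P \<phi>\<close> is the group $N_\varphi$ of the extension axiom.\<close>

definition ext_domain :: "('a, 'm) monoid_scheme \<Rightarrow> 'a set \<Rightarrow> ('a \<Rightarrow> 'a) \<Rightarrow> 'a set" where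
  "ext_domain S P \<phi> = {x \<in> normalizer S P. \<exists>y\<in>carrier S. \<forall>u\<in>P.
     \<phi> (x \<otimes>\<^bsub>S\<^esub> u \<otimes>\<^bsub>S\<^esub> inv\<^bsub>S\<^esub> x) = y \<otimes>\<^bsub>S\<^esub> \<phi> u \<otimes>\<^bsub>S\<^esub> inv\<^bsub>S\<^esub> y}"

locale saturated_fusion_system = fusion_system +
  assumes sylow_axiom: "\<lbrakk>subgroup P S; fully_normalized S F P\<rbrakk> \<Longrightarrow>
        fully_centralized S F P \<and> sylow_subgroup p (Aut_S S P) (Aut_F F P)"
    and extension_axiom:
      "\<lbrakk>subgroup P S; \<phi> \<in> F P (carrier S); fully_centralized S F (\<phi> ` P)\<rbrakk> \<Longrightarrow>
        \<exists>\<psi>\<in>F (ext_domain S P \<phi>) (carrier S). \<forall>u\<in>P. \<psi> u = \<phi> u"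

definition F_centric ::
  "('a, 'm) monoid_scheme \<Rightarrow> ('a set \<Rightarrow> 'a set \<Rightarrow> ('a \<Rightarrow> 'a) set) \<Rightarrow> 'a set \<Rightarrow> bool" where
  "F_centric S F P \<longleftrightarrow> subgroup P S \<and> (\<forall>Q\<in>F_class S F P. centralizer S Q \<subseteq> Q)"

definition centric_classes ::
  "('a, 'm) monoid_scheme \<Rightarrow> ('a set \<Rightarrow> 'a set \<Rightarrow> ('a \<Rightarrow> 'a) set) \<Rightarrow> 'a set set set" where
  "centric_classes S F = {F_class S F P |P. F_centric S F P}"


section \<open>The Burnside ring of a finite group\<close>

text \<open>A $G$-set is a pair of its underlying set and its action (a homomorphism into \<open>BijGroup\<close>).\<close>

type_synonym ('g, 'x) gset = "'x set \<times> ('g \<Rightarrow> 'x \<Rightarrow> 'x)"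

definition fin_gset :: "('g, 'm) monoid_scheme \<Rightarrow> ('g, 'x) gset \<Rightarrow> bool" where
  "fin_gset G X \<longleftrightarrow> finite (fst X) \<and> group_action G (fst X) (snd X)"

definition gset_iso :: "('g, 'm) monoid_scheme \<Rightarrow> ('g, 'x) gset \<Rightarrow> ('g, 'y) gset \<Rightarrow> bool" where
  "gset_iso G X Y \<longleftrightarrow> (\<exists>f. bij_betw f (fst X) (fst Y) \<and>
     (\<forall>g\<in>carrier G. \<forall>x\<in>fst X. f (snd X g x) = snd Y g (f x)))"

definition gset_sum :: "('g, 'x) gset \<Rightarrow> ('g, 'y) gset \<Rightarrow> ('g, 'x + 'y) gset" where
  "gset_sum X Y = (Sum_Type.Plus (fst X) (fst Y),
     \<lambda>g. restrict (map_sum (snd X g) (snd Y g)) (Sum_Type.Plus (fst X) (fst Y)))"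

definition gset_prod :: "('g, 'x) gset \<Rightarrow> ('g, 'y) gset \<Rightarrow> ('g, 'x \<times> 'y) gset" where
  "gset_prod X Y = (fst X \<times> fst Y, \<lambda>g. restrict (map_prod (snd X g) (snd Y g)) (fst X \<times> fst Y))"

definition gset_empty :: "('g, 'x) gset" where
  "gset_empty = ({}, \<lambda>g. restrict id {})"

definition gset_point :: "('g, unit) gset" where
  "gset_point = ({()}, \<lambda>g. restrict id {()})"

definition coset_gset :: "('g, 'm) monoid_scheme \<Rightarrow> 'g set \<Rightarrow> ('g, 'g set) gset" where
  "coset_gset G P = (lcosets\<^bsub>G\<^esub> P, \<lambda>g. \<lambda>C\<in>lcosets\<^bsub>G\<^esub> P. g <#\<^bsub>G\<^esub> C)"

definition gset_res :: "('h \<Rightarrow> 'g) \<Rightarrow> ('g, 'x) gset \<Rightarrow> ('h, 'x) gset" where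
  "gset_res \<phi> X = (fst X, \<lambda>h. snd X (\<phi> h))"

definition fixed_points :: "'g set \<Rightarrow> ('g, 'x) gset \<Rightarrow> 'x set" where
  "fixed_points Q X = {x \<in> fst X. \<forall>q\<in>Q. snd X q x = x}"

text \<open>
  The Burnside ring is the Grothendieck ring of isomorphism classes of finite $G$-sets.
  Since every finite $G$-set is isomorphic to one with underlying set in \<open>nat\<close>, an element is
  represented as a set of pairs of such $G$-sets: \<open>burnside_class G X Y\<close> is the formal
  difference $[X] - [Y]$, that is, the set of all $(X', Y')$ with $X + Y' + Z \cong X' + Y + Z$ for
  some $Z$. Here $X$, $Y$ may live on arbitrary types.
\<close>

type_synonym 'g burnside = "(('g, nat) gset \<times> ('g, nat) gset) set"

definition burnside_class ::
  "('g, 'm) monoid_scheme \<Rightarrow> ('g, 'x) gset \<Rightarrow> ('g, 'y) gset \<Rightarrow> 'g burnside" where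
  "burnside_class G X Y = {(X', Y'). fin_gset G X' \<and> fin_gset G Y' \<and>
     (\<exists>Z :: ('g, nat) gset. fin_gset G Z \<and>
        gset_iso G (gset_sum (gset_sum X Y') Z) (gset_sum (gset_sum X' Y) Z))}"

definition burnside_ring :: "('g, 'm) monoid_scheme \<Rightarrow> 'g burnside ring" where
  "burnside_ring G =
    \<lparr>carrier = {burnside_class G X Y |(X :: ('g, nat) gset) (Y :: ('g, nat) gset).
                  fin_gset G X \<and> fin_gset G Y},
     monoid.mult = (\<lambda>a b. \<Union>(X, Y)\<in>a. \<Union>(X', Y')\<in>b.
       burnside_class G (gset_sum (gset_prod X X') (gset_prod Y Y'))
                        (gset_sum (gset_prod X Y') (gset_prod Y X'))),
     one = burnside_class G gset_point (gset_empty :: ('g, nat) gset),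
     zero = burnside_class G (gset_empty :: ('g, nat) gset) (gset_empty :: ('g, nat) gset),
     add = (\<lambda>a b. \<Union>(X, Y)\<in>a. \<Union>(X', Y')\<in>b.
       burnside_class G (gset_sum X X') (gset_sum Y Y'))\<rparr>"

definition burnside_transitive :: "('g, 'm) monoid_scheme \<Rightarrow> 'g set \<Rightarrow> 'g burnside" where
  "burnside_transitive G P = burnside_class G (coset_gset G P) (gset_empty :: ('g, nat) gset)"

text \<open>Restriction to the Burnside ring of \<open>H\<close> along a homomorphism \<open>\<phi>\<close> from \<open>H\<close>.\<close>

definition burnside_res :: "('h, 'm) monoid_scheme \<Rightarrow> ('h \<Rightarrow> 'g) \<Rightarrow> 'g burnside \<Rightarrow> 'h burnside" where
  "burnside_res H \<phi> a = (\<Union>(X, Y)\<in>a. burnside_class H (gset_res \<phi> X) (gset_res \<phi> Y))"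

text \<open>The ring homomorphism $\Phi_Q$; the value does not depend on the chosen representative.\<close>

definition burnside_mark :: "'g set \<Rightarrow> 'g burnside \<Rightarrow> int" where
  "burnside_mark Q a =
     (THE n. \<exists>(X, Y)\<in>a. n = int (card (fixed_points Q X)) - int (card (fixed_points Q Y)))"


section \<open>Localization at \<open>p\<close>\<close>

definition Zloc :: "nat \<Rightarrow> rat ring" where
  "Zloc p = \<lparr>carrier = {r. \<not> int p dvd snd (quotient_of r)}, monoid.mult = (*), one = 1, zero = 0, add = (+)\<rparr>"

text \<open>
  The tensor product with $\mathbb{Z}_{(p)}$ is realized by fractions $a/n$ with $n$ an integer prime
  to $p$. Nothing here requires \<open>R\<close> to have a multiplicative identity; if it has none, then only the
  field \<open>one\<close> of the result is meaningless.
\<close>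

definition loc_class :: "nat \<Rightarrow> ('c, 'm) ring_scheme \<Rightarrow> 'c \<Rightarrow> int \<Rightarrow> ('c \<times> int) set" where
  "loc_class p R a n = {(b, m). b \<in> carrier R \<and> \<not> int p dvd m \<and>
     (\<exists>k::int. \<not> int p dvd k \<and> [(k * m)] \<cdot>\<^bsub>R\<^esub> a = [(k * n)] \<cdot>\<^bsub>R\<^esub> b)}"

definition p_localization ::
  "nat \<Rightarrow> ('c, 'm) ring_scheme \<Rightarrow> (rat, ('c \<times> int) set) module" where
  "p_localization p R =
    \<lparr>carrier = {loc_class p R a n |a n. a \<in> carrier R \<and> \<not> int p dvd n},
     monoid.mult = (\<lambda>x y. \<Union>(a, n)\<in>x. \<Union>(b, m)\<in>y. loc_class p R (a \<otimes>\<^bsub>R\<^esub> b) (n * m)),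
     one = loc_class p R \<one>\<^bsub>R\<^esub> 1,
     zero = loc_class p R \<zero>\<^bsub>R\<^esub> 1,
     add = (\<lambda>x y. \<Union>(a, n)\<in>x. \<Union>(b, m)\<in>y.
       loc_class p R ([m] \<cdot>\<^bsub>R\<^esub> a \<oplus>\<^bsub>R\<^esub> [n] \<cdot>\<^bsub>R\<^esub> b) (n * m)),
     smult = (\<lambda>r x. \<Union>(a, n)\<in>x.
       loc_class p R ([fst (quotient_of r)] \<cdot>\<^bsub>R\<^esub> a) (snd (quotient_of r) * n))\<rparr>"

definition loc_map ::
  "nat \<Rightarrow> ('d, 'm) ring_scheme \<Rightarrow> ('c \<Rightarrow> 'd) \<Rightarrow> ('c \<times> int) set \<Rightarrow> ('d \<times> int) set" where
  "loc_map p R' f x = (\<Union>(a, n)\<in>x. loc_class p R' (f a) n)"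

definition loc_mark :: "'g set \<Rightarrow> ('g burnside \<times> int) set \<Rightarrow> rat" where
  "loc_mark Q x = (THE r. \<exists>(a, n)\<in>x. r = of_int (burnside_mark Q a) / of_int n)"

definition Zloc_span :: "nat \<Rightarrow> (rat, 'c) module \<Rightarrow> 'c set \<Rightarrow> 'c set" where
  "Zloc_span p M B = \<Inter>{H. submodule H (Zloc p) M \<and> B \<subseteq> H}"


section \<open>The Burnside ring of a fusion system\<close>

definition F_stable ::
  "nat \<Rightarrow> ('a, 'm) monoid_scheme \<Rightarrow> ('a set \<Rightarrow> 'a set \<Rightarrow> ('a \<Rightarrow> 'a) set) \<Rightarrow>
   ('a burnside \<times> int) set \<Rightarrow> bool" where
  "F_stable p S F X \<longleftrightarrow> (\<forall>P. subgroup P S \<longrightarrow> (\<forall>\<phi>\<in>F P (carrier S).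
     loc_map p (burnside_ring (S\<lparr>carrier := P\<rparr>)) (burnside_res (S\<lparr>carrier := P\<rparr>) \<phi>) X =
     loc_map p (burnside_ring (S\<lparr>carrier := P\<rparr>)) (burnside_res (S\<lparr>carrier := P\<rparr>) (\<lambda>x\<in>P. x)) X))"

definition fusion_burnside_ring ::
  "nat \<Rightarrow> ('a, 'm) monoid_scheme \<Rightarrow> ('a set \<Rightarrow> 'a set \<Rightarrow> ('a \<Rightarrow> 'a) set) \<Rightarrow>
   (rat, ('a burnside \<times> int) set) module" where
  "fusion_burnside_ring p S F = (p_localization p (burnside_ring S))
     \<lparr>carrier := {X \<in> carrier (p_localization p (burnside_ring S)). F_stable p S F X}\<rparr>"

text \<open>\<open>is_beta p S F P b\<close> is the property that characterizes \<open>b\<close> as the basis element $\beta_P$.\<close>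

definition is_beta ::
  "nat \<Rightarrow> ('a, 'm) monoid_scheme \<Rightarrow> ('a set \<Rightarrow> 'a set \<Rightarrow> ('a \<Rightarrow> 'a) set) \<Rightarrow> 'a set \<Rightarrow>
   ('a burnside \<times> int) set \<Rightarrow> bool" where
  "is_beta p S F P b \<longleftrightarrow> b \<in> carrier (fusion_burnside_ring p S F) \<and>
     (\<forall>Q. subgroup Q S \<longrightarrow> loc_mark Q b =
        1 / of_nat (card (F_class S F Q)) *
        (\<Sum>Q'\<in>F_class S F Q. of_int (burnside_mark Q' (burnside_transitive S P))))"

definition noncentric_submodule ::
  "nat \<Rightarrow> ('a, 'm) monoid_scheme \<Rightarrow> ('a set \<Rightarrow> 'a set \<Rightarrow> ('a \<Rightarrow> 'a) set) \<Rightarrow>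
   ('a set \<Rightarrow> ('a burnside \<times> int) set) \<Rightarrow> ('a burnside \<times> int) set set" where
  "noncentric_submodule p S F \<beta> = Zloc_span p (fusion_burnside_ring p S F)
     {\<beta> P |P. subgroup P S \<and> \<not> F_centric S F P}"


section \<open>The Diaz--Libman Burnside ring\<close>

text \<open>A commutative ring that need not be unital: the field \<open>one\<close> of the record is ignored.\<close>

locale comm_rng = abelian_group A for A (structure) +
  assumes rng_closed: "\<lbrakk>x \<in> carrier A; y \<in> carrier A\<rbrakk> \<Longrightarrow> x \<otimes> y \<in> carrier A"
    and rng_assoc: "\<lbrakk>x \<in> carrier A; y \<in> carrier A; z \<in> carrier A\<rbrakk> \<Longrightarrow> (x \<otimes> y) \<otimes> z = x \<otimes> (y \<otimes> z)"
    and rng_comm: "\<lbrakk>x \<in> carrier A; y \<in> carrier A\<rbrakk> \<Longrightarrow> x \<otimes> y = y \<otimes> x"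
    and rng_distr: "\<lbrakk>x \<in> carrier A; y \<in> carrier A; z \<in> carrier A\<rbrakk> \<Longrightarrow>
        (x \<oplus> y) \<otimes> z = x \<otimes> z \<oplus> y \<otimes> z"

definition int_product_ring :: "'i set \<Rightarrow> ('i \<Rightarrow> int) ring" where
  "int_product_ring I =
    \<lparr>carrier = I \<rightarrow>\<^sub>E UNIV,
     monoid.mult = (\<lambda>f g. \<lambda>i\<in>I. f i * g i), one = (\<lambda>i\<in>I. 1),
     zero = (\<lambda>i\<in>I. 0), add = (\<lambda>f g. \<lambda>i\<in>I. f i + g i)\<rparr>"

text \<open>
  The Diaz--Libman ring of \<open>F\<close> is determined up to isomorphism by the following properties, where
  \<open>\<xi> (F_class S F P)\<close> is the basis element $\xi_P$.
\<close>

locale diaz_libman_ring = comm_rng A for A (structure) +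
  fixes S :: "('a, 'm) monoid_scheme"
    and F :: "'a set \<Rightarrow> 'a set \<Rightarrow> ('a \<Rightarrow> 'a) set"
    and \<xi> :: "'a set set \<Rightarrow> 'b"
  assumes xi_closed: "C \<in> centric_classes S F \<Longrightarrow> \<xi> C \<in> carrier A"
    and xi_basis: "a \<in> carrier A \<Longrightarrow>
        \<exists>!c. c \<in> centric_classes S F \<rightarrow>\<^sub>E (UNIV :: int set) \<and>
             a = (\<Oplus>C\<in>centric_classes S F. [c C] \<cdot> \<xi> C)"
    and mark_hom: "\<exists>\<Phi>.
        \<Phi> \<in> hom A (int_product_ring (centric_classes S F)) \<and>
        \<Phi> \<in> hom (add_monoid A) (add_monoid (int_product_ring (centric_classes S F))) \<and>
        inj_on \<Phi> (carrier A) \<and>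
        finite (a_rcosets\<^bsub>int_product_ring (centric_classes S F)\<^esub> (\<Phi> ` carrier A)) \<and>
        (\<forall>P Q. F_centric S F P \<longrightarrow> F_centric S F Q \<longrightarrow>
           (of_int (\<Phi> (\<xi> (F_class S F P)) (F_class S F Q)) :: rat) =
             of_nat (card (centralizer S Q \<inter> Q) * card (F Q P)) / of_nat (card P))"

end

theory Submission
  imports Defs "HOL-Number_Theory.Residues"
begin

text \<open>
  Both rings are compared through their marks. For subgroups \<open>P\<close> and \<open>Q\<close> let \<open>n(Q,P)\<close> be the number
  of \<open>F\<close>-conjugates of \<open>Q\<close> that lie in \<open>P\<close>. Counting pairs of a conjugate \<open>Q'\<close> and an element \<open>g\<close>
  that conjugates it into \<open>P\<close> gives \<open>\<Phi>_Q(\<beta>_P) = |S| n(Q,P) / (|P| |[Q]|)\<close>, and counting morphisms by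
  their images gives \<open>|F(Q,P)| = |Aut_F(Q)| n(Q,P)\<close>. Since \<open>|[Q]| = n(Q,S)\<close>, for centric \<open>P\<close> and \<open>Q\<close>
  the mark of \<open>\<beta>_P\<close> at \<open>Q\<close> times that of \<open>\<xi>_S\<close> is the mark of \<open>\<xi>_P\<close> (\<open>beta_mark_times_top\<close>). So an
  isomorphism that preserves the marks at the centric subgroups has to send \<open>\<beta>_P\<close> to \<open>\<xi>_P / \<xi>_S\<close>,
  and it remains to see that \<open>\<xi>_S\<close> is invertible and that the two rings have the same centric marks.

  The arithmetic behind this is one fact (\<open>card_class\<close>): if \<open>Q\<close> is fully normalized, then
  \<open>|[Q]| = m |S : N_S(Q)|\<close> with \<open>m\<close> an integer prime to \<open>p\<close>. That \<open>m\<close> is an integer holds because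
  \<open>[Q]\<close> is a union of \<open>S\<close>-conjugacy classes and \<open>N_S(Q)\<close> is largest among the normalizers. That \<open>m\<close>
  is prime to \<open>p\<close> is read off from \<open>\<beta>_Q\<close>: its mark at \<open>Q\<close> is \<open>|S| / (|Q| |[Q]|) = |N_S(Q) : Q| / m\<close>,
  its marks at larger subgroups vanish, and for an element of the localized Burnside ring of \<open>S\<close> this
  forces the mark at \<open>Q\<close> to be divisible by \<open>|N_S(Q) : Q|\<close>.

  First, if \<open>Q\<close> is centric and fully normalized, then by the Sylow axiom \<open>|Aut_F(Q)|\<close> is
  \<open>|N_S(Q)| / |Z(Q)|\<close> times a number prime to \<open>p\<close>, so that the mark
  \<open>|Z(Q)| |Aut_F(Q)| |[Q]| / |S|\<close> of \<open>\<xi>_S\<close> is prime to \<open>p\<close> (\<open>mark_top_unit\<close>). The image of the mark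
  homomorphism has finite index, and an element of such a ring whose coordinates are units at \<open>p\<close>
  is invertible after localization (\<open>val_inverse_ex\<close>).

  Second, a stable element whose marks vanish above a fully normalized \<open>Q\<close> has at \<open>Q\<close> a \<open>p\<close>-integral
  multiple of the mark of \<open>\<beta>_Q\<close>. Descending elimination then writes every stable element in
  terms of the \<open>\<beta>_Q\<close> with \<open>Q\<close> in the down-closure of its support (\<open>stable_in_span\<close>). Overgroups of
  centric subgroups are centric, so that the span \<open>N\<close> of the \<open>\<beta>_P\<close> with \<open>P\<close> not centric consists of
  the stable elements whose marks vanish at all centric subgroups (\<open>noncentric_submodule_eq\<close>); in
  particular it is the kernel of a ring homomorphism and thus an ideal.
\<close>


section \<open>Rings embedded in rings of functions\<close>

text \<open>
  Sums and products in the Burnside ring and in a localization are defined by representatives. The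
  ring axioms need not be checked on representatives once an additive and multiplicative family of
  values separates the elements: they are inherited from functions. An identity is left out of the
  locale, because the Diaz--Libman ring acquires one only after localization.
\<close>

locale function_embedding =
  fixes R :: "('b, 'm) ring_scheme" (structure)
    and I :: "'i set"
    and v :: "'i \<Rightarrow> 'b \<Rightarrow> 'k :: comm_ring_1"
  assumes add_closed: "\<lbrakk>x \<in> carrier R; y \<in> carrier R\<rbrakk> \<Longrightarrow> x \<oplus> y \<in> carrier R"
    and mult_closed: "\<lbrakk>x \<in> carrier R; y \<in> carrier R\<rbrakk> \<Longrightarrow> x \<otimes> y \<in> carrier R"
    and zero_in: "\<zero> \<in> carrier R"
    and neg_ex: "x \<in> carrier R \<Longrightarrow> \<exists>y\<in>carrier R. \<forall>i\<in>I. v i y = - v i x"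
    and v_add: "\<lbrakk>x \<in> carrier R; y \<in> carrier R; i \<in> I\<rbrakk> \<Longrightarrow> v i (x \<oplus> y) = v i x + v i y"
    and v_mult: "\<lbrakk>x \<in> carrier R; y \<in> carrier R; i \<in> I\<rbrakk> \<Longrightarrow> v i (x \<otimes> y) = v i x * v i y"
    and v_zero: "i \<in> I \<Longrightarrow> v i \<zero> = 0"
    and v_eqI: "\<lbrakk>x \<in> carrier R; y \<in> carrier R; \<And>i. i \<in> I \<Longrightarrow> v i x = v i y\<rbrakk> \<Longrightarrow> x = y"
begin

lemma embedded_abelian_group: "abelian_group R"
proof (rule abelian_groupI)
  fix x assume x: "x \<in> carrier R"
  then obtain y where y: "y \<in> carrier R" "\<forall>i\<in>I. v i y = - v i x"
    using neg_ex by blast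
  then have "y \<oplus> x = \<zero>"
    using x by (intro v_eqI) (auto simp: add_closed zero_in v_add v_zero)
  then show "\<exists>y\<in>carrier R. y \<oplus> x = \<zero>"
    using y by blast
qed (auto intro!: v_eqI simp: add_closed zero_in v_add v_zero algebra_simps)

lemma embedded_cring:
  assumes one: "\<one> \<in> carrier R" "\<And>i. i \<in> I \<Longrightarrow> v i \<one> = 1"
  shows "cring R"
proof (rule cringI[OF embedded_abelian_group])
  show "Group.comm_monoid R"
    by (rule comm_monoidI) (auto intro!: v_eqI simp: mult_closed one v_mult)
qed (auto intro!: v_eqI simp: add_closed mult_closed v_add v_mult algebra_simps)

sublocale abelian_group R
  by (rule embedded_abelian_group)

lemma v_neg:
  assumes "x \<in> carrier R" "i \<in> I"
  shows "v i (\<ominus> x) = - v i x"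
proof -
  have "v i (\<ominus> x \<oplus> x) = 0"
    using assms by (simp only: l_neg v_zero)
  then show ?thesis
    using assms by (simp add: v_add eq_neg_iff_add_eq_0)
qed

lemma v_nat_multiple:
  assumes "x \<in> carrier R" "i \<in> I"
  shows "v i ([(n::nat)] \<cdot> x) = of_nat n * v i x"
proof (induction n)
  case 0
  then show ?case using assms by (simp add: v_zero)
next
  case (Suc n)
  then show ?case using assms by (simp add: v_add algebra_simps)
qed

lemma v_int_multiple:
  assumes "x \<in> carrier R" "i \<in> I"
  shows "v i ([(k::int)] \<cdot> x) = of_int k * v i x"
proof (cases "k \<ge> 0")
  case True
  then show ?thesis using assms by (simp add: add_pow_int_ge v_nat_multiple)
next
  case False
  then show ?thesis using assms by (simp add: add_pow_int_lt v_nat_multiple v_neg)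
qed

lemma v_finsum:
  assumes "finite C" "\<And>c. c \<in> C \<Longrightarrow> f c \<in> carrier R" "i \<in> I"
  shows "v i (\<Oplus>c\<in>C. f c) = (\<Sum>c\<in>C. v i (f c))"
  using assms(1,2)
proof (induction C rule: finite_induct)
  case empty
  then show ?case using assms(3) by (simp add: v_zero)
next
  case (insert c C)
  then show ?case using assms(3) by (simp add: Pi_def v_add)
qed

end


section \<open>Localization of an embedded ring\<close>

definition loc_value :: "('c \<Rightarrow> int) \<Rightarrow> ('c \<times> int) set \<Rightarrow> rat" where
  "loc_value f x = (THE r. \<exists>(a, n)\<in>x. r = of_int (f a) / of_int n)"

lemma loc_mark_eq_loc_value: "loc_mark Q = loc_value (burnside_mark Q)"
  by (simp add: loc_mark_def loc_value_def fun_eq_iff)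

text \<open>
  These are the elements of \<open>\<int>\<close> localized at \<open>p\<close>. Fractions that are not in lowest terms are admitted,
  so that no reduction is needed to see closure under the operations.
\<close>

definition p_integral :: "nat \<Rightarrow> rat set" where
  "p_integral p = {of_int a / of_int n |a n. \<not> int p dvd n}"

lemma p_integralI: "\<not> int p dvd n \<Longrightarrow> of_int a / of_int n \<in> p_integral p"
  by (auto simp: p_integral_def)

lemma p_integralE:
  assumes "r \<in> p_integral p"
  obtains a n where "r = of_int a / of_int n" "\<not> int p dvd n"
  using assms by (auto simp: p_integral_def)

lemma p_integral_iff:
  assumes "Factorial_Ring.prime p"
  shows "r \<in> p_integral p \<longleftrightarrow> \<not> int p dvd snd (quotient_of r)"
proof
  assume "r \<in> p_integral p"
  then obtain a n where an: "r = of_int a / of_int n" "\<not> int p dvd n"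
    by (rule p_integralE)
  obtain b d where bd: "quotient_of r = (b, d)" by force
  then have r: "r = of_int b / of_int d" and d: "d > 0" and cop: "coprime b d"
    by (auto intro: quotient_of_div quotient_of_denom_pos quotient_of_coprime)
  have "n \<noteq> 0" using an(2) by auto
  then have "of_int (b * n) = (of_int (a * d) :: rat)"
    using r an(1) d by (simp add: field_simps)
  then have "b * n = a * d" by (simp only: of_int_eq_iff)
  then have "d dvd n"
    using cop by (metis coprime_commute coprime_dvd_mult_right_iff dvd_triv_right)
  then show "\<not> int p dvd snd (quotient_of r)"
    using an(2) bd by auto
next
  assume "\<not> int p dvd snd (quotient_of r)"
  moreover have "r = of_int (fst (quotient_of r)) / of_int (snd (quotient_of r))"
    using quotient_of_div[of r] by simp
  ultimately show "r \<in> p_integral p" by (metis p_integralI)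
qed

lemma Zloc_carrier:
  "Factorial_Ring.prime p \<Longrightarrow> carrier (Zloc p) = p_integral p"
  by (auto simp: Zloc_def p_integral_iff)

context
  fixes p :: nat
  assumes p: "Factorial_Ring.prime p"
begin

lemma not_dvd_mult: "\<not> int p dvd m \<Longrightarrow> \<not> int p dvd n \<Longrightarrow> \<not> int p dvd m * n"
  using p by (simp add: prime_dvd_mult_iff)

lemma p_integral_of_int [simp]: "of_int a \<in> p_integral p"
  using p_integralI[of p 1 a] prime_gt_1_nat[OF p] by auto

lemma p_integral_mult: "r \<in> p_integral p \<Longrightarrow> s \<in> p_integral p \<Longrightarrow> r * s \<in> p_integral p"
proof (elim p_integralE)
  fix a n b m
  assume *: "r = of_int a / of_int n" "\<not> int p dvd n" "s = of_int b / of_int m" "\<not> int p dvd m"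
  then have "r * s = of_int (a * b) / of_int (n * m)" by simp
  then show ?thesis using * by (metis p_integralI not_dvd_mult)
qed

lemma p_integral_uminus: "r \<in> p_integral p \<Longrightarrow> - r \<in> p_integral p"
  using p_integral_mult[of "-1" r] p_integral_of_int[of "-1"] by simp

end

locale embedded_localization = function_embedding B I \<mu>
  for B :: "('b, 'm) ring_scheme" (structure) and I :: "'i set" and \<mu> :: "'i \<Rightarrow> 'b \<Rightarrow> int" +
  fixes p :: nat
  assumes prime_p: "Factorial_Ring.prime p"
begin

abbreviation "L \<equiv> p_localization p B"

abbreviation val :: "'i \<Rightarrow> ('b \<times> int) set \<Rightarrow> rat" where
  "val i \<equiv> loc_value (\<mu> i)"

lemma p_not_dvd_1: "\<not> int p dvd 1"
  using prime_gt_1_nat[OF prime_p] by auto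

text \<open>
  A relation \<open>k m a = k n b\<close> with \<open>k\<close> prime to \<open>p\<close> is a relation between integers after taking
  values, and there \<open>k\<close> cancels. So equality of fractions is equality of their values.
\<close>

lemma in_loc_class_iff:
  assumes a: "a \<in> carrier B" and n: "\<not> int p dvd n"
  shows "(b, m) \<in> loc_class p B a n \<longleftrightarrow> b \<in> carrier B \<and> \<not> int p dvd m \<and>
    (\<forall>i\<in>I. (of_int (\<mu> i b) / of_int m :: rat) = of_int (\<mu> i a) / of_int n)"
proof -
  have n0: "n \<noteq> 0" using n by auto
  have frac: "(of_int (\<mu> i b) / of_int m :: rat) = of_int (\<mu> i a) / of_int n \<longleftrightarrow> m * \<mu> i a = n * \<mu> i b"
    if "\<not> int p dvd m" for i
  proof -
    have "m \<noteq> 0" using that by auto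
    then have "(of_int (\<mu> i b) / of_int m :: rat) = of_int (\<mu> i a) / of_int n \<longleftrightarrow>
        (of_int (m * \<mu> i a) :: rat) = of_int (n * \<mu> i b)"
      using n0 by (auto simp: field_simps)
    then show ?thesis by (simp only: of_int_eq_iff)
  qed
  have mult: "[(k * m)] \<cdot> a = [(k * n)] \<cdot> b \<longleftrightarrow> (\<forall>i\<in>I. m * \<mu> i a = n * \<mu> i b)"
    if b: "b \<in> carrier B" and k: "\<not> int p dvd k" for k
  proof -
    have "k \<noteq> 0" using k by auto
    have "[(k * m)] \<cdot> a = [(k * n)] \<cdot> b \<longleftrightarrow> (\<forall>i\<in>I. \<mu> i ([(k * m)] \<cdot> a) = \<mu> i ([(k * n)] \<cdot> b))"
      using a b v_eqI[of "[(k * m)] \<cdot> a" "[(k * n)] \<cdot> b"] by auto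
    also have "\<dots> \<longleftrightarrow> (\<forall>i\<in>I. m * \<mu> i a = n * \<mu> i b)"
      using a b \<open>k \<noteq> 0\<close> by (simp add: v_int_multiple mult.assoc)
    finally show ?thesis .
  qed
  show ?thesis
    unfolding loc_class_def using frac mult p_not_dvd_1 by auto
qed

lemma loc_class_self:
  "\<lbrakk>a \<in> carrier B; \<not> int p dvd n\<rbrakk> \<Longrightarrow> (a, n) \<in> loc_class p B a n"
  by (simp add: in_loc_class_iff)

lemma loc_class_eq_iff:
  assumes "a \<in> carrier B" "\<not> int p dvd n" "b \<in> carrier B" "\<not> int p dvd m"
  shows "loc_class p B a n = loc_class p B b m \<longleftrightarrow>
    (\<forall>i\<in>I. (of_int (\<mu> i a) / of_int n :: rat) = of_int (\<mu> i b) / of_int m)"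
proof
  assume "loc_class p B a n = loc_class p B b m"
  then have "(a, n) \<in> loc_class p B b m"
    using assms loc_class_self by blast
  then show "\<forall>i\<in>I. (of_int (\<mu> i a) / of_int n :: rat) = of_int (\<mu> i b) / of_int m"
    using assms by (simp add: in_loc_class_iff)
next
  assume "\<forall>i\<in>I. (of_int (\<mu> i a) / of_int n :: rat) = of_int (\<mu> i b) / of_int m"
  then show "loc_class p B a n = loc_class p B b m"
    using assms by (auto simp: in_loc_class_iff)
qed

lemma val_loc_class:
  assumes "a \<in> carrier B" "\<not> int p dvd n" "i \<in> I"
  shows "val i (loc_class p B a n) = of_int (\<mu> i a) / of_int n"
  unfolding loc_value_def
  by (rule the_equality)
    (use assms loc_class_self[OF assms(1,2)] in \<open>auto simp: in_loc_class_iff\<close>)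

lemma loc_class_closed: "\<lbrakk>a \<in> carrier B; \<not> int p dvd n\<rbrakk> \<Longrightarrow> loc_class p B a n \<in> carrier L"
  by (auto simp: p_localization_def)

lemma loc_carrierE:
  assumes "x \<in> carrier L"
  obtains a n where "a \<in> carrier B" "\<not> int p dvd n" "x = loc_class p B a n"
  using assms by (auto simp: p_localization_def)

text \<open>
  The operations of the localization are unions over all representatives of their arguments.
  All sets in such a union agree, as soon as their values do.
\<close>

lemma UN_loc_class:
  assumes a: "a \<in> carrier B" "\<not> int p dvd n"
    and f: "\<And>a n. \<lbrakk>a \<in> carrier B; \<not> int p dvd n\<rbrakk> \<Longrightarrow> f a n \<in> carrier B \<and> \<not> int p dvd g a n"
    and eq: "\<And>a n b m i. \<lbrakk>a \<in> carrier B; \<not> int p dvd n; b \<in> carrier B; \<not> int p dvd m; i \<in> I;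
        \<And>i. i \<in> I \<Longrightarrow> (of_int (\<mu> i a) / of_int n :: rat) = of_int (\<mu> i b) / of_int m\<rbrakk> \<Longrightarrow>
        (of_int (\<mu> i (f a n)) / of_int (g a n) :: rat) = of_int (\<mu> i (f b m)) / of_int (g b m)"
  shows "(\<Union>(a, n)\<in>loc_class p B a n. loc_class p B (f a n) (g a n)) = loc_class p B (f a n) (g a n)"
proof -
  have "loc_class p B (f b m) (g b m) = loc_class p B (f a n) (g a n)"
    if "(b, m) \<in> loc_class p B a n" for b m
  proof -
    have b: "b \<in> carrier B" "\<not> int p dvd m"
      and bm: "\<And>i. i \<in> I \<Longrightarrow> (of_int (\<mu> i b) / of_int m :: rat) = of_int (\<mu> i a) / of_int n"
      using that a by (auto simp: in_loc_class_iff)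
    show ?thesis
      using f[OF a] f[OF b] eq[OF b a _ bm] by (subst loc_class_eq_iff) auto
  qed
  then show ?thesis
    using loc_class_self[OF a] by fast
qed

lemma loc_mult:
  assumes "a \<in> carrier B" "\<not> int p dvd n" "b \<in> carrier B" "\<not> int p dvd m"
  shows "loc_class p B a n \<otimes>\<^bsub>L\<^esub> loc_class p B b m = loc_class p B (a \<otimes> b) (n * m)"
proof -
  have split: "(of_int (\<mu> i (a \<otimes> b)) / of_int (n * m) :: rat) =
      of_int (\<mu> i a) / of_int n * (of_int (\<mu> i b) / of_int m)"
    if "a \<in> carrier B" "b \<in> carrier B" "i \<in> I" for a n b m i
    using that by (simp add: v_mult)
  have inner: "(\<Union>(b, m)\<in>loc_class p B b m. loc_class p B (a' \<otimes> b) (n' * m)) =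
      loc_class p B (a' \<otimes> b) (n' * m)" if "a' \<in> carrier B" "\<not> int p dvd n'" for a' n'
  proof (rule UN_loc_class[where f = "\<lambda>b m. a' \<otimes> b" and g = "\<lambda>b m. n' * m"])
    fix b1 m1 b2 m2 i
    assume *: "b1 \<in> carrier B" "b2 \<in> carrier B" "i \<in> I"
      "\<And>i. i \<in> I \<Longrightarrow> (of_int (\<mu> i b1) / of_int m1 :: rat) = of_int (\<mu> i b2) / of_int m2"
    then show "(of_int (\<mu> i (a' \<otimes> b1)) / of_int (n' * m1) :: rat) =
        of_int (\<mu> i (a' \<otimes> b2)) / of_int (n' * m2)"
      using that by (simp only: split *(4))
  qed (use assms that mult_closed not_dvd_mult[OF prime_p] in auto)
  have "loc_class p B a n \<otimes>\<^bsub>L\<^esub> loc_class p B b m =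
      (\<Union>(a, n)\<in>loc_class p B a n. loc_class p B (a \<otimes> b) (n * m))"
    using assms inner by (simp add: p_localization_def, intro SUP_cong refl)
      (clarsimp simp: in_loc_class_iff)
  also have "\<dots> = loc_class p B (a \<otimes> b) (n * m)"
  proof (rule UN_loc_class[where f = "\<lambda>a n. a \<otimes> b" and g = "\<lambda>a n. n * m"])
    fix a1 n1 a2 n2 i
    assume *: "a1 \<in> carrier B" "a2 \<in> carrier B" "i \<in> I"
      "\<And>i. i \<in> I \<Longrightarrow> (of_int (\<mu> i a1) / of_int n1 :: rat) = of_int (\<mu> i a2) / of_int n2"
    then show "(of_int (\<mu> i (a1 \<otimes> b)) / of_int (n1 * m) :: rat) =
        of_int (\<mu> i (a2 \<otimes> b)) / of_int (n2 * m)"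
      using assms by (simp only: split *(4))
  qed (use assms mult_closed not_dvd_mult[OF prime_p] in auto)
  finally show ?thesis .
qed

lemma loc_add:
  assumes "a \<in> carrier B" "\<not> int p dvd n" "b \<in> carrier B" "\<not> int p dvd m"
  shows "loc_class p B a n \<oplus>\<^bsub>L\<^esub> loc_class p B b m =
    loc_class p B ([m] \<cdot> a \<oplus> [n] \<cdot> b) (n * m)"
proof -
  have split: "(of_int (\<mu> i ([m] \<cdot> a \<oplus> [n] \<cdot> b)) / of_int (n * m) :: rat) =
      of_int (\<mu> i a) / of_int n + of_int (\<mu> i b) / of_int m"
    if "a \<in> carrier B" "\<not> int p dvd n" "b \<in> carrier B" "\<not> int p dvd m" "i \<in> I" for a n b m i
  proof -
    have "n \<noteq> 0" "m \<noteq> 0" using that by auto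
    then show ?thesis using that by (simp add: v_add v_int_multiple field_simps)
  qed
  have inner: "(\<Union>(b, m)\<in>loc_class p B b m. loc_class p B ([m] \<cdot> a' \<oplus> [n'] \<cdot> b) (n' * m)) =
      loc_class p B ([m] \<cdot> a' \<oplus> [n'] \<cdot> b) (n' * m)" if "a' \<in> carrier B" "\<not> int p dvd n'" for a' n'
  proof (rule UN_loc_class[where f = "\<lambda>b m. [m] \<cdot> a' \<oplus> [n'] \<cdot> b" and g = "\<lambda>b m. n' * m"])
    fix b1 m1 b2 m2 i
    assume *: "b1 \<in> carrier B" "\<not> int p dvd m1" "b2 \<in> carrier B" "\<not> int p dvd m2" "i \<in> I"
      "\<And>i. i \<in> I \<Longrightarrow> (of_int (\<mu> i b1) / of_int m1 :: rat) = of_int (\<mu> i b2) / of_int m2"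
    then show "(of_int (\<mu> i ([m1] \<cdot> a' \<oplus> [n'] \<cdot> b1)) / of_int (n' * m1) :: rat) =
        of_int (\<mu> i ([m2] \<cdot> a' \<oplus> [n'] \<cdot> b2)) / of_int (n' * m2)"
      using that by (simp only: split *(6) not_False_eq_True)
  qed (use assms that not_dvd_mult[OF prime_p] in auto)
  have "loc_class p B a n \<oplus>\<^bsub>L\<^esub> loc_class p B b m =
      (\<Union>(a, n)\<in>loc_class p B a n. loc_class p B ([m] \<cdot> a \<oplus> [n] \<cdot> b) (n * m))"
    using assms inner by (simp add: p_localization_def, intro SUP_cong refl)
      (clarsimp simp: in_loc_class_iff)
  also have "\<dots> = loc_class p B ([m] \<cdot> a \<oplus> [n] \<cdot> b) (n * m)"
  proof (rule UN_loc_class[where f = "\<lambda>a n. [m] \<cdot> a \<oplus> [n] \<cdot> b" and g = "\<lambda>a n. n * m"])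
    fix a1 n1 a2 n2 i
    assume *: "a1 \<in> carrier B" "\<not> int p dvd n1" "a2 \<in> carrier B" "\<not> int p dvd n2" "i \<in> I"
      "\<And>i. i \<in> I \<Longrightarrow> (of_int (\<mu> i a1) / of_int n1 :: rat) = of_int (\<mu> i a2) / of_int n2"
    then show "(of_int (\<mu> i ([m] \<cdot> a1 \<oplus> [n1] \<cdot> b)) / of_int (n1 * m) :: rat) =
        of_int (\<mu> i ([m] \<cdot> a2 \<oplus> [n2] \<cdot> b)) / of_int (n2 * m)"
      using assms by (simp only: split *(6) not_False_eq_True)
  qed (use assms not_dvd_mult[OF prime_p] in auto)
  finally show ?thesis .
qed

lemma loc_smult:
  assumes "a \<in> carrier B" "\<not> int p dvd n" "r \<in> p_integral p"
  shows "r \<odot>\<^bsub>L\<^esub> loc_class p B a n =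
    loc_class p B ([fst (quotient_of r)] \<cdot> a) (snd (quotient_of r) * n)"
proof -
  let ?b = "fst (quotient_of r)" and ?d = "snd (quotient_of r)"
  have d: "\<not> int p dvd ?d" using assms(3) p_integral_iff[OF prime_p] by blast
  have split: "(of_int (\<mu> i ([?b] \<cdot> a)) / of_int (?d * n) :: rat) =
      of_int ?b / of_int ?d * (of_int (\<mu> i a) / of_int n)"
    if "a \<in> carrier B" "i \<in> I" for a n i
    using that by (simp add: v_int_multiple)
  have "r \<odot>\<^bsub>L\<^esub> loc_class p B a n = (\<Union>(a, n)\<in>loc_class p B a n. loc_class p B ([?b] \<cdot> a) (?d * n))"
    by (simp add: p_localization_def)
  also have "\<dots> = loc_class p B ([?b] \<cdot> a) (?d * n)"
  proof (rule UN_loc_class[where f = "\<lambda>a n. [?b] \<cdot> a" and g = "\<lambda>a n. ?d * n"])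
    fix a1 n1 a2 n2 i
    assume *: "a1 \<in> carrier B" "a2 \<in> carrier B" "i \<in> I"
      "\<And>i. i \<in> I \<Longrightarrow> (of_int (\<mu> i a1) / of_int n1 :: rat) = of_int (\<mu> i a2) / of_int n2"
    then show "(of_int (\<mu> i ([?b] \<cdot> a1)) / of_int (?d * n1) :: rat) =
        of_int (\<mu> i ([?b] \<cdot> a2)) / of_int (?d * n2)"
      by (simp only: split *(4))
  qed (use assms d not_dvd_mult[OF prime_p] in auto)
  finally show ?thesis .
qed

lemma loc_zero: "\<zero>\<^bsub>L\<^esub> = loc_class p B \<zero> 1"
  by (simp add: p_localization_def)

lemma loc_smult_closed:
  "\<lbrakk>r \<in> p_integral p; x \<in> carrier L\<rbrakk> \<Longrightarrow> r \<odot>\<^bsub>L\<^esub> x \<in> carrier L"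
  using p_integral_iff[OF prime_p, of r] not_dvd_mult[OF prime_p, of "snd (quotient_of r)"]
  by (elim loc_carrierE) (auto simp: loc_smult intro!: loc_class_closed)

lemma val_smult:
  assumes "r \<in> p_integral p" "x \<in> carrier L" "i \<in> I"
  shows "val i (r \<odot>\<^bsub>L\<^esub> x) = r * val i x"
  using assms(2)
proof (rule loc_carrierE)
  fix a n assume x: "a \<in> carrier B" "\<not> int p dvd n" "x = loc_class p B a n"
  let ?b = "fst (quotient_of r)" and ?d = "snd (quotient_of r)"
  have d: "\<not> int p dvd ?d" using assms(1) p_integral_iff[OF prime_p] by blast
  then have "val i (r \<odot>\<^bsub>L\<^esub> x) = of_int (\<mu> i ([?b] \<cdot> a)) / of_int (?d * n)"
    using x assms(1,3) not_dvd_mult[OF prime_p d x(2)] by (simp add: loc_smult val_loc_class)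
  also have "\<dots> = of_int ?b / of_int ?d * (of_int (\<mu> i a) / of_int n)"
    using x assms by (simp add: v_int_multiple)
  also have "of_int ?b / of_int ?d = r"
    using quotient_of_div[of r ?b ?d] by simp
  finally show ?thesis
    using x assms by (simp add: val_loc_class)
qed

lemma loc_eqI:
  assumes "x \<in> carrier L" "y \<in> carrier L" "\<And>i. i \<in> I \<Longrightarrow> val i x = val i y"
  shows "x = y"
  using assms(1,2)
proof (elim loc_carrierE)
  fix a n b m
  assume *: "a \<in> carrier B" "\<not> int p dvd n" "x = loc_class p B a n"
    "b \<in> carrier B" "\<not> int p dvd m" "y = loc_class p B b m"
  then show "x = y"
    using assms(3) by (simp add: loc_class_eq_iff val_loc_class)
qed

lemma localization_embedding: "function_embedding L I val"
proof
  fix x y assume "x \<in> carrier L" "y \<in> carrier L"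
  then obtain a n b m
    where *: "a \<in> carrier B" "\<not> int p dvd n" "x = loc_class p B a n"
      "b \<in> carrier B" "\<not> int p dvd m" "y = loc_class p B b m"
    by (elim loc_carrierE) blast
  then have nm: "\<not> int p dvd n * m" and n0: "n \<noteq> 0" "m \<noteq> 0"
    using not_dvd_mult[OF prime_p] by auto
  show "x \<oplus>\<^bsub>L\<^esub> y \<in> carrier L" "x \<otimes>\<^bsub>L\<^esub> y \<in> carrier L"
    using * nm by (auto simp: loc_add loc_mult mult_closed intro!: loc_class_closed)
  fix i assume i: "i \<in> I"
  show "val i (x \<oplus>\<^bsub>L\<^esub> y) = val i x + val i y"
    using * nm n0 i by (simp add: loc_add val_loc_class v_add v_int_multiple field_simps)
  show "val i (x \<otimes>\<^bsub>L\<^esub> y) = val i x * val i y"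
    using * nm n0 i by (simp add: loc_mult val_loc_class v_mult mult_closed)
next
  fix x assume x: "x \<in> carrier L"
  have m1: "-1 \<in> p_integral p"
    using p_integral_of_int[OF prime_p, of "-1"] by simp
  show "\<exists>y\<in>carrier L. \<forall>i\<in>I. val i y = - val i x"
    by (rule bexI[of _ "(-1) \<odot>\<^bsub>L\<^esub> x"]) (simp_all add: m1 x val_smult loc_smult_closed)
next
  show "\<zero>\<^bsub>L\<^esub> \<in> carrier L"
    using p_not_dvd_1 zero_in by (simp add: loc_zero loc_class_closed)
  fix i assume "i \<in> I"
  then show "val i \<zero>\<^bsub>L\<^esub> = 0"
    using p_not_dvd_1 zero_in by (simp add: loc_zero val_loc_class v_zero)
qed (rule loc_eqI)

lemma loc_one:
  assumes "\<one> \<in> carrier B" "\<And>i. i \<in> I \<Longrightarrow> \<mu> i \<one> = 1"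
  shows "\<one>\<^bsub>L\<^esub> \<in> carrier L" "\<And>i. i \<in> I \<Longrightarrow> val i \<one>\<^bsub>L\<^esub> = 1"
proof -
  have "\<one>\<^bsub>L\<^esub> = loc_class p B \<one> 1" by (simp add: p_localization_def)
  then show "\<one>\<^bsub>L\<^esub> \<in> carrier L" "\<And>i. i \<in> I \<Longrightarrow> val i \<one>\<^bsub>L\<^esub> = 1"
    using assms p_not_dvd_1 by (simp_all add: loc_class_closed val_loc_class)
qed

end


section \<open>Finite G-sets and their marks\<close>

definition subgset :: "('g, 'x) gset \<Rightarrow> 'x set \<Rightarrow> ('g, 'x) gset" where
  "subgset X A = (A, \<lambda>g. restrict (snd X g) A)"

text \<open>
  The mark at \<open>Q\<close> counts the points whose stabilizer contains \<open>Q\<close>. The points whose stabilizer equals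
  \<open>Q\<close> are the ones that tell orbits apart, and on them \<open>N_G(Q)/Q\<close> acts freely.
\<close>

definition exact_points :: "('g, 'm) monoid_scheme \<Rightarrow> 'g set \<Rightarrow> ('g, 'x) gset \<Rightarrow> 'x set" where
  "exact_points G Q X = {x \<in> fst X. stabilizer G (snd X) x = Q}"

lemma (in group) group_actionI:
  assumes ext: "\<And>g. g \<in> carrier G \<Longrightarrow> \<phi> g \<in> extensional E"
    and closed: "\<And>g x. \<lbrakk>g \<in> carrier G; x \<in> E\<rbrakk> \<Longrightarrow> \<phi> g x \<in> E"
    and one: "\<And>x. x \<in> E \<Longrightarrow> \<phi> \<one> x = x"
    and mult: "\<And>g h x. \<lbrakk>g \<in> carrier G; h \<in> carrier G; x \<in> E\<rbrakk> \<Longrightarrow> \<phi> (g \<otimes> h) x = \<phi> g (\<phi> h x)"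
  shows "group_action G E \<phi>"
proof -
  have Bij: "\<phi> g \<in> Bij E" if g: "g \<in> carrier G" for g
  proof -
    have "\<phi> (inv g) (\<phi> g x) = x" "\<phi> g (\<phi> (inv g) x) = x" if "x \<in> E" for x
      using mult[of "inv g" g x] mult[of g "inv g" x] one[OF that] g that by simp_all
    then have "bij_betw (\<phi> g) E E"
      using closed g by (intro bij_betwI[where g = "\<phi> (inv g)"]) auto
    then show ?thesis using ext[OF g] by (simp add: Bij_def)
  qed
  have "\<phi> (g \<otimes> h) = compose E (\<phi> g) (\<phi> h)" if "g \<in> carrier G" "h \<in> carrier G" for g h
    using that ext mult by (intro extensionalityI[of _ E]) (auto simp: compose_eq)
  then have "\<phi> \<in> hom G (BijGroup E)"
    using Bij by (auto simp: hom_def BijGroup_def)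
  then show ?thesis
    by (simp add: group_action_def group_hom_def group_hom_axioms_def is_group group_BijGroup)
qed

lemma (in group) fin_gsetI:
  assumes "finite (fst X)"
    "\<And>g. g \<in> carrier G \<Longrightarrow> snd X g \<in> extensional (fst X)"
    "\<And>g x. \<lbrakk>g \<in> carrier G; x \<in> fst X\<rbrakk> \<Longrightarrow> snd X g x \<in> fst X"
    "\<And>x. x \<in> fst X \<Longrightarrow> snd X \<one> x = x"
    "\<And>g h x. \<lbrakk>g \<in> carrier G; h \<in> carrier G; x \<in> fst X\<rbrakk> \<Longrightarrow>
      snd X (g \<otimes> h) x = snd X g (snd X h x)"
  shows "fin_gset G X"
  using assms by (simp add: fin_gset_def group_actionI)

context group
begin

context
  fixes X :: "('a, 'x) gset"
  assumes X: "fin_gset G X"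
begin

lemma gset_finite: "finite (fst X)"
  using X by (simp add: fin_gset_def)

lemma gset_action: "group_action G (fst X) (snd X)"
  using X by (simp add: fin_gset_def)

lemma gset_closed: "\<lbrakk>g \<in> carrier G; x \<in> fst X\<rbrakk> \<Longrightarrow> snd X g x \<in> fst X"
  using group_action.element_image[OF gset_action] by blast

lemma gset_ext: "g \<in> carrier G \<Longrightarrow> snd X g \<in> extensional (fst X)"
  using group_action.bij_prop0[OF gset_action] by (simp add: Bij_def)

lemma gset_one: "x \<in> fst X \<Longrightarrow> snd X \<one> x = x"
  using group_action.id_eq_one[OF gset_action] by (metis restrict_apply')

lemma gset_mult: "\<lbrakk>g \<in> carrier G; h \<in> carrier G; x \<in> fst X\<rbrakk> \<Longrightarrow>
    snd X (g \<otimes> h) x = snd X g (snd X h x)"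
  using group_action.composition_rule[OF gset_action] by blast

lemma gset_inv: "\<lbrakk>g \<in> carrier G; x \<in> fst X\<rbrakk> \<Longrightarrow> snd X (inv g) (snd X g x) = x"
  using gset_mult[of "inv g" g x] gset_one by simp

lemma gset_inv': "\<lbrakk>g \<in> carrier G; x \<in> fst X\<rbrakk> \<Longrightarrow> snd X g (snd X (inv g) x) = x"
  using gset_mult[of g "inv g" x] gset_one by simp

lemma gset_eq_iff:
  assumes "g \<in> carrier G" "h \<in> carrier G" "x \<in> fst X"
  shows "snd X g x = snd X h x \<longleftrightarrow> inv g \<otimes> h \<in> stabilizer G (snd X) x"
proof -
  have "snd X g x = snd X h x \<longleftrightarrow> snd X (inv g) (snd X h x) = x"
    using assms gset_inv gset_inv' gset_closed by metis
  then show ?thesis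
    using assms by (simp add: stabilizer_def gset_mult)
qed

lemma stabilizer_subgroup: "x \<in> fst X \<Longrightarrow> subgroup (stabilizer G (snd X) x) G"
  using group_action.stabilizer_subgroup[OF gset_action] by blast

lemma fin_gset_subgset:
  assumes "A \<subseteq> fst X" "\<And>g x. \<lbrakk>g \<in> carrier G; x \<in> A\<rbrakk> \<Longrightarrow> snd X g x \<in> A"
  shows "fin_gset G (subgset X A)"
  using assms finite_subset[OF assms(1) gset_finite]
  by (intro fin_gsetI) (auto simp: subgset_def gset_one gset_mult subsetD)

lemma fin_gset_restrict_subgroup:
  assumes "subgroup H G"
  shows "fin_gset (G\<lparr>carrier := H\<rparr>) X"
  using gset_finite group_action.induced_action[OF gset_action assms]
  by (simp add: fin_gset_def)

lemma fin_gset_res: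
  assumes "group H" "\<phi> \<in> hom H G"
  shows "fin_gset H (gset_res \<phi> X)"
proof -
  interpret H: group H by fact
  have "\<phi> \<one>\<^bsub>H\<^esub> = \<one>"
    using assms hom_one is_group by blast
  then show ?thesis
    using assms(2) gset_finite
    by (intro H.fin_gsetI)
      (auto simp: gset_res_def hom_in_carrier gset_closed gset_ext gset_one gset_mult hom_mult)
qed

end

lemma fixed_points_subset: "fixed_points Q X \<subseteq> fst X"
  by (auto simp: fixed_points_def)

lemma fixed_points_subgset:
  "A \<subseteq> fst X \<Longrightarrow> fixed_points Q (subgset X A) = fixed_points Q X \<inter> A"
  by (auto simp: fixed_points_def subgset_def)

lemma fixed_points_res: "fixed_points Q (gset_res \<phi> X) = fixed_points (\<phi> ` Q) X"
  by (auto simp: fixed_points_def gset_res_def)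

lemma fin_gset_sum:
  assumes "fin_gset G X" "fin_gset G Y"
  shows "fin_gset G (gset_sum X Y)"
  using gset_finite[OF assms(1)] gset_finite[OF assms(2)]
  by (intro fin_gsetI)
    (auto simp: gset_sum_def gset_closed[OF assms(1)] gset_closed[OF assms(2)]
      gset_one[OF assms(1)] gset_one[OF assms(2)] gset_mult[OF assms(1)] gset_mult[OF assms(2)])

lemma fin_gset_prod:
  assumes "fin_gset G X" "fin_gset G Y"
  shows "fin_gset G (gset_prod X Y)"
  using gset_finite[OF assms(1)] gset_finite[OF assms(2)]
  by (intro fin_gsetI)
    (auto simp: gset_prod_def gset_closed[OF assms(1)] gset_closed[OF assms(2)]
      gset_one[OF assms(1)] gset_one[OF assms(2)] gset_mult[OF assms(1)] gset_mult[OF assms(2)])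

lemma fin_gset_empty: "fin_gset G gset_empty"
  by (intro fin_gsetI) (auto simp: gset_empty_def)

lemma fin_gset_point: "fin_gset G gset_point"
  by (intro fin_gsetI) (auto simp: gset_point_def)

lemma fin_gset_transport:
  assumes X: "fin_gset G X" and f: "bij_betw f (fst X) B"
  defines "Y \<equiv> (B, \<lambda>g. \<lambda>b\<in>B. f (snd X g (inv_into (fst X) f b)))"
  shows "fin_gset G Y" "gset_iso G X Y"
proof -
  have inv: "inv_into (fst X) f b \<in> fst X" "f (inv_into (fst X) f b) = b" if "b \<in> B" for b
    using f that by (auto simp: bij_betw_def inv_into_into f_inv_into_f)
  have inv': "f x \<in> B" "inv_into (fst X) f (f x) = x" if "x \<in> fst X" for x
    using f that by (auto simp: bij_betw_def)
  have "finite B" using f gset_finite[OF X] bij_betw_finite by blast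
  then show "fin_gset G Y"
    using inv inv' gset_closed[OF X]
    by (intro fin_gsetI) (auto simp: Y_def gset_one[OF X] gset_mult[OF X])
  show "gset_iso G X Y"
    unfolding gset_iso_def
    by (rule exI[of _ f]) (use f inv' in \<open>auto simp: Y_def\<close>)
qed

text \<open>
  Representatives of Burnside classes live on \<open>nat\<close>; this moves sums, products and coset spaces there.
\<close>

lemma nat_gset_ex:
  assumes "fin_gset G X"
  shows "\<exists>Y :: ('a, nat) gset. fin_gset G Y \<and> gset_iso G X Y"
proof -
  obtain f where "bij_betw f (fst X) {0..<card (fst X)}"
    using gset_finite[OF assms] ex_bij_betw_finite_nat by blast
  then show ?thesis using fin_gset_transport[OF assms] by blast
qed


subsection \<open>Marks\<close>

lemma finite_fixed_points: "fin_gset G X \<Longrightarrow> finite (fixed_points Q X)"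
  using fixed_points_subset gset_finite finite_subset by metis

lemma card_fixed_points_sum:
  assumes "fin_gset G X" "fin_gset G Y"
  shows "card (fixed_points Q (gset_sum X Y)) = card (fixed_points Q X) + card (fixed_points Q Y)"
proof -
  have "fixed_points Q (gset_sum X Y) = fixed_points Q X <+> fixed_points Q Y"
    by (auto simp: fixed_points_def gset_sum_def)
  then show ?thesis
    using assms by (simp add: card_Plus finite_fixed_points)
qed

lemma card_fixed_points_prod:
  "card (fixed_points Q (gset_prod X Y)) = card (fixed_points Q X) * card (fixed_points Q Y)"
proof -
  have "fixed_points Q (gset_prod X Y) = fixed_points Q X \<times> fixed_points Q Y"
    by (auto simp: fixed_points_def gset_prod_def)
  then show ?thesis by (simp only: card_cartesian_product)
qed

lemma fixed_points_empty: "fixed_points Q gset_empty = {}"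
  by (simp add: fixed_points_def gset_empty_def)

lemma fixed_points_point: "fixed_points Q gset_point = {()}"
  by (auto simp: fixed_points_def gset_point_def)

lemma card_fixed_points_iso:
  assumes "gset_iso G X Y" "Q \<subseteq> carrier G" "fin_gset G X"
  shows "card (fixed_points Q X) = card (fixed_points Q Y)"
proof -
  obtain f where f: "bij_betw f (fst X) (fst Y)"
    and eq: "\<And>g x. \<lbrakk>g \<in> carrier G; x \<in> fst X\<rbrakk> \<Longrightarrow> f (snd X g x) = snd Y g (f x)"
    using assms(1) by (auto simp: gset_iso_def)
  have "bij_betw f (fixed_points Q X) (fixed_points Q Y)"
  proof (rule bij_betw_subset[OF f fixed_points_subset])
    have fix_iff: "f x \<in> fixed_points Q Y \<longleftrightarrow> x \<in> fixed_points Q X" if "x \<in> fst X" for x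
    proof -
      have "f x \<in> fst Y" using f that by (auto simp: bij_betw_def)
      moreover have "snd Y q (f x) = f x \<longleftrightarrow> snd X q x = x" if q: "q \<in> Q" for q
      proof -
        have q': "q \<in> carrier G" using q assms(2) by auto
        have "f (snd X q x) = f x \<longleftrightarrow> snd X q x = x"
          using f \<open>x \<in> fst X\<close> gset_closed[OF assms(3) q']
          by (intro inj_on_eq_iff[of f "fst X"]) (auto simp: bij_betw_def)
        then show ?thesis using eq[OF q' \<open>x \<in> fst X\<close>] by simp
      qed
      ultimately show ?thesis using that by (simp add: fixed_points_def)
    qed
    have "fixed_points Q Y \<subseteq> f ` fst X"
      using f fixed_points_subset by (metis bij_betw_imp_surj_on)
    then show "f ` fixed_points Q X = fixed_points Q Y"
      using fix_iff fixed_points_subset[of Q X] by blast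
  qed
  then show ?thesis by (rule bij_betw_same_card)
qed

end

locale finite_group = group G for G (structure) +
  assumes finite_carrier: "finite (carrier G)"
begin

lemma finite_subgroups: "finite {R. subgroup R G \<and> P R}"
  by (rule finite_subset[of _ "Pow (carrier G)"]) (auto simp: finite_carrier dest: subgroup.subset)

lemma finite_subgroup: "subgroup R G \<Longrightarrow> finite R"
  using subgroup.subset finite_carrier finite_subset by metis

lemma card_fixed_points_eq_sum_exact:
  assumes X: "fin_gset G X" and Q: "subgroup Q G"
  shows "card (fixed_points Q X) = (\<Sum>R | subgroup R G \<and> Q \<subseteq> R. card (exact_points G R X))"
proof -
  have "fixed_points Q X = (\<Union>R\<in>{R. subgroup R G \<and> Q \<subseteq> R}. exact_points G R X)"
    using stabilizer_subgroup[OF X] subgroup.subset[OF Q]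
    by (auto simp: fixed_points_def exact_points_def stabilizer_def)
  moreover have "finite (exact_points G R X)" for R
    using gset_finite[OF X] by (auto simp: exact_points_def)
  moreover have "exact_points G R X \<inter> exact_points G R' X = {}" if "R \<noteq> R'" for R R'
    using that by (auto simp: exact_points_def)
  ultimately show ?thesis
    by (simp add: card_UN_disjoint finite_subgroups)
qed

text \<open>
  This is Moebius inversion on the subgroup lattice, in the form of an induction downwards from the
  whole group. The set \<open>U\<close> is upward closed, so that the induction can also be run only above a given
  subgroup.
\<close>

lemma card_exact_points_eq:
  assumes X: "fin_gset G X" and Y: "fin_gset G Y"
    and up: "\<And>R R'. \<lbrakk>R \<in> U; subgroup R' G; R \<subseteq> R'\<rbrakk> \<Longrightarrow> R' \<in> U"
    and marks: "\<And>R. \<lbrakk>R \<in> U; subgroup R G\<rbrakk> \<Longrightarrow> card (fixed_points R X) = card (fixed_points R Y)"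
    and R: "subgroup R G" "R \<in> U"
  shows "card (exact_points G R X) = card (exact_points G R Y)"
  using R
proof (induction "card (carrier G) - card R" arbitrary: R rule: less_induct)
  case less
  let ?T = "{R'. subgroup R' G \<and> R \<subseteq> R'}"
  have IH: "card (exact_points G R' X) = card (exact_points G R' Y)" if "R' \<in> ?T - {R}" for R'
  proof (rule less.hyps)
    have "R \<subset> R'" "R' \<subseteq> carrier G" using that subgroup.subset by auto
    then have "card R < card R'" "card R' \<le> card (carrier G)"
      using finite_carrier by (auto intro: psubset_card_mono card_mono finite_subset)
    then show "card (carrier G) - card R' < card (carrier G) - card R" by simp
    show "subgroup R' G" "R' \<in> U" using that less.prems up by auto
  qed
  have "card (fixed_points R X) = card (fixed_points R Y)"
    using marks less.prems by blast
  then have "sum (\<lambda>R'. card (exact_points G R' X)) ?T = sum (\<lambda>R'. card (exact_points G R' Y)) ?T"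
    using less.prems by (simp add: card_fixed_points_eq_sum_exact X Y)
  moreover have "R \<in> ?T" "finite ?T" using less.prems finite_subgroups by auto
  ultimately show ?case
    using IH by (simp add: sum.remove[of ?T R])
qed


subsection \<open>Burnside's theorem\<close>

text \<open>
  Both orbits are copies of the coset space of the common stabilizer.
\<close>

lemma orbit_gset_bij:
  assumes X: "fin_gset G X" and Y: "fin_gset G Y" and x: "x \<in> fst X" and y: "y \<in> fst Y"
    and stab: "stabilizer G (snd X) x = stabilizer G (snd Y) y"
  obtains f where "bij_betw f (orbit G (snd X) x) (orbit G (snd Y) y)"
    "\<And>g z. \<lbrakk>g \<in> carrier G; z \<in> orbit G (snd X) x\<rbrakk> \<Longrightarrow> f (snd X g z) = snd Y g (f z)"
proof -
  have eq: "snd X g x = snd X h x \<longleftrightarrow> snd Y g y = snd Y h y"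
    if "g \<in> carrier G" "h \<in> carrier G" for g h
    using that x y stab by (simp add: gset_eq_iff[OF X] gset_eq_iff[OF Y])
  define f where "f z = snd Y (SOME g. g \<in> carrier G \<and> snd X g x = z) y" for z
  have f: "f (snd X g x) = snd Y g y" if "g \<in> carrier G" for g
  proof -
    have "\<exists>h. h \<in> carrier G \<and> snd X h x = snd X g x" using that by blast
    then have "(SOME h. h \<in> carrier G \<and> snd X h x = snd X g x) \<in> carrier G \<and>
        snd X (SOME h. h \<in> carrier G \<and> snd X h x = snd X g x) x = snd X g x"
      by (rule someI_ex)
    then show ?thesis unfolding f_def using eq that by blast
  qed
  show ?thesis
  proof (rule that[of f])
    show "bij_betw f (orbit G (snd X) x) (orbit G (snd Y) y)"
    proof (rule bij_betw_imageI)
      show "inj_on f (orbit G (snd X) x)" by (auto simp: inj_on_def orbit_def f eq)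
      show "f ` orbit G (snd X) x = orbit G (snd Y) y"
        unfolding orbit_def using f by (force simp: image_iff)
    qed
    fix g z assume "g \<in> carrier G" "z \<in> orbit G (snd X) x"
    then show "f (snd X g z) = snd Y g (f z)"
      using x y by (auto simp: orbit_def f gset_mult[OF X, symmetric] gset_mult[OF Y, symmetric])
  qed
qed

lemma orbit_invariant:
  assumes X: "fin_gset G X" and x: "x \<in> fst X" and g: "g \<in> carrier G" and z: "z \<in> fst X"
  shows "snd X g z \<in> orbit G (snd X) x \<longleftrightarrow> z \<in> orbit G (snd X) x"
proof
  assume "z \<in> orbit G (snd X) x"
  then obtain h where "h \<in> carrier G" "z = snd X h x" by (auto simp: orbit_def)
  then have "snd X g z = snd X (g \<otimes> h) x" "g \<otimes> h \<in> carrier G"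
    using g x gset_mult[OF X g] by simp_all
  then show "snd X g z \<in> orbit G (snd X) x" by (auto simp: orbit_def)
next
  assume "snd X g z \<in> orbit G (snd X) x"
  then obtain h where h: "h \<in> carrier G" "snd X g z = snd X h x" by (auto simp: orbit_def)
  then have "z = snd X (inv g \<otimes> h) x"
    using g x z gset_inv[OF X g z] gset_mult[OF X, of "inv g" h x] by simp
  then show "z \<in> orbit G (snd X) x" using g h by (auto simp: orbit_def)
qed

text \<open>
  Orbits are split off one at a time. If \<open>x\<close> is a point of \<open>X\<close> with stabilizer \<open>R\<close>, then \<open>Y\<close> has as
  many points with stabilizer \<open>R\<close> as \<open>X\<close>, hence at least one; the two orbits are isomorphic, and their
  complements again have equal marks.
\<close>

theorem gset_iso_if_marks_eq:
  fixes X :: "('a, 'x) gset" and Y :: "('a, 'y) gset"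
  assumes "fin_gset G X" "fin_gset G Y"
    and "\<And>Q. subgroup Q G \<Longrightarrow> card (fixed_points Q X) = card (fixed_points Q Y)"
  shows "gset_iso G X Y"
  using assms
proof (induction "card (fst X)" arbitrary: X Y rule: less_induct)
  case less
  note X = less.prems(1) and Y = less.prems(2) and marks = less.prems(3)
  show ?case
  proof (cases "fst X = {}")
    case True
    have "fixed_points {\<one>} Y = fst Y"
      using gset_one[OF Y] by (auto simp: fixed_points_def)
    then have "card (fst Y) = 0"
      using marks[of "{\<one>}"] True triv_subgroup by (simp add: fixed_points_def)
    then have "fst Y = {}" using gset_finite[OF Y] by simp
    then show ?thesis using True by (auto simp: gset_iso_def bij_betw_def)
  next
    case False
    then obtain x where x: "x \<in> fst X" by blast
    define R where "R = stabilizer G (snd X) x"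
    have R: "subgroup R G" using stabilizer_subgroup[OF X x] by (simp add: R_def)
    have "card (exact_points G R X) = card (exact_points G R Y)"
      by (rule card_exact_points_eq[OF X Y, of UNIV]) (use marks R in auto)
    moreover have "x \<in> exact_points G R X" using x by (simp add: exact_points_def R_def)
    moreover have "finite (exact_points G R X)"
      using gset_finite[OF X] by (auto simp: exact_points_def)
    ultimately have "exact_points G R Y \<noteq> {}" by (metis card.empty card_0_eq empty_iff)
    then obtain y where y: "y \<in> fst Y" "stabilizer G (snd Y) y = R"
      by (auto simp: exact_points_def)
    let ?A = "orbit G (snd X) x" and ?B = "orbit G (snd Y) y"
    obtain f where f: "bij_betw f ?A ?B"
      and f_eq: "\<And>g z. \<lbrakk>g \<in> carrier G; z \<in> ?A\<rbrakk> \<Longrightarrow> f (snd X g z) = snd Y g (f z)"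
      using orbit_gset_bij[OF X Y x y(1)] y(2) R_def by metis
    have A: "?A \<subseteq> fst X" and B: "?B \<subseteq> fst Y"
      using gset_closed[OF X _ x] gset_closed[OF Y _ y(1)] by (auto simp: orbit_def)
    have subA: "fin_gset G (subgset X ?A)"
      using A orbit_invariant[OF X x] by (intro fin_gset_subgset[OF X]) auto
    have "gset_iso G (subgset X ?A) (subgset Y ?B)"
      unfolding gset_iso_def
      by (rule exI[of _ f]) (use f f_eq bij_betwE[OF f] in \<open>simp add: subgset_def\<close>)
    then have marksAB: "card (fixed_points Q X \<inter> ?A) = card (fixed_points Q Y \<inter> ?B)"
      if "subgroup Q G" for Q
      using card_fixed_points_iso[OF _ subgroup.subset[OF that] subA] A B
      by (metis fixed_points_subgset)
    let ?X' = "subgset X (fst X - ?A)" and ?Y' = "subgset Y (fst Y - ?B)"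
    have X': "fin_gset G ?X'"
      using gset_closed[OF X] orbit_invariant[OF X x] by (intro fin_gset_subgset[OF X]) auto
    have Y': "fin_gset G ?Y'"
      using gset_closed[OF Y] orbit_invariant[OF Y y(1)] by (intro fin_gset_subgset[OF Y]) auto
    have "gset_iso G ?X' ?Y'"
    proof (rule less.hyps[OF _ X' Y'])
      have "x \<in> ?A" using group_action.orbit_refl[OF gset_action[OF X] x] .
      then have "fst X - ?A \<subset> fst X" using x by auto
      then show "card (fst ?X') < card (fst X)"
        using gset_finite[OF X] by (simp add: subgset_def psubset_card_mono)
      fix Q assume Q: "subgroup Q G"
      have "card (fixed_points Q X) =
          card (fixed_points Q X \<inter> ?A) + card (fixed_points Q X \<inter> (fst X - ?A))"
        using finite_fixed_points[OF X, of Q] fixed_points_subset[of Q X]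
        by (subst card_Un_disjoint[symmetric]) (auto intro!: arg_cong[of _ _ card])
      moreover have "card (fixed_points Q Y) =
          card (fixed_points Q Y \<inter> ?B) + card (fixed_points Q Y \<inter> (fst Y - ?B))"
        using finite_fixed_points[OF Y, of Q] fixed_points_subset[of Q Y]
        by (subst card_Un_disjoint[symmetric]) (auto intro!: arg_cong[of _ _ card])
      ultimately have "card (fixed_points Q X \<inter> (fst X - ?A)) = card (fixed_points Q Y \<inter> (fst Y - ?B))"
        using marks[OF Q] marksAB[OF Q] by linarith
      then show "card (fixed_points Q ?X') = card (fixed_points Q ?Y')"
        by (simp add: fixed_points_subgset)
    qed
    then obtain h where h: "bij_betw h (fst X - ?A) (fst Y - ?B)"
      and h_eq': "\<forall>g\<in>carrier G. \<forall>z\<in>fst X - ?A. h (restrict (snd X g) (fst X - ?A) z) =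
        restrict (snd Y g) (fst Y - ?B) (h z)"
      unfolding gset_iso_def subgset_def fst_conv snd_conv by blast
    have h_eq: "h (snd X g z) = snd Y g (h z)" if "g \<in> carrier G" "z \<in> fst X - ?A" for g z
      using h_eq' that bij_betwE[OF h] by (metis restrict_apply')
    define k where "k z = (if z \<in> ?A then f z else h z)" for z
    have "bij_betw k (?A \<union> (fst X - ?A)) (?B \<union> (fst Y - ?B))"
    proof (rule bij_betw_combine)
      show "bij_betw k ?A ?B" using f by (simp add: k_def cong: bij_betw_cong)
      show "bij_betw k (fst X - ?A) (fst Y - ?B)"
        using h by (subst bij_betw_cong[of _ k h]) (auto simp: k_def)
    qed auto
    moreover have "?A \<union> (fst X - ?A) = fst X" "?B \<union> (fst Y - ?B) = fst Y" using A B by auto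
    moreover have "k (snd X g z) = snd Y g (k z)" if "g \<in> carrier G" "z \<in> fst X" for g z
      using that f_eq h_eq orbit_invariant[OF X x] by (simp add: k_def)
    ultimately show ?thesis unfolding gset_iso_def by metis
  qed
qed

end


section \<open>The Burnside ring, embedded by marks\<close>

definition virtual_mark :: "'g set \<Rightarrow> ('g, 'x) gset \<Rightarrow> ('g, 'y) gset \<Rightarrow> int" where
  "virtual_mark Q X Y = int (card (fixed_points Q X)) - int (card (fixed_points Q Y))"

context finite_group
begin

text \<open>
  The summand \<open>Z\<close> in the definition of a formal difference cancels: marks are additive, and equal marks
  make the two sides isomorphic already for empty \<open>Z\<close>. So a formal difference is known by its marks.
\<close>

lemma in_burnside_class_iff:
  assumes X: "fin_gset G X" and Y: "fin_gset G Y"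
  shows "(X', Y') \<in> burnside_class G X Y \<longleftrightarrow> fin_gset G X' \<and> fin_gset G Y' \<and>
    (\<forall>Q. subgroup Q G \<longrightarrow> virtual_mark Q X' Y' = virtual_mark Q X Y)"
proof (cases "fin_gset G X' \<and> fin_gset G Y'")
  case True
  then have X': "fin_gset G X'" and Y': "fin_gset G Y'" by auto
  have sums: "fin_gset G (gset_sum (gset_sum X Y') Z)" "fin_gset G (gset_sum (gset_sum X' Y) Z)"
    "card (fixed_points Q (gset_sum (gset_sum X Y') Z)) =
      card (fixed_points Q X) + card (fixed_points Q Y') + card (fixed_points Q Z)"
    "card (fixed_points Q (gset_sum (gset_sum X' Y) Z)) =
      card (fixed_points Q X') + card (fixed_points Q Y) + card (fixed_points Q Z)"
    if "fin_gset G Z" for Z :: "('a, nat) gset" and Q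
    using X Y X' Y' that by (simp_all add: fin_gset_sum card_fixed_points_sum)
  have "(\<exists>Z :: ('a, nat) gset. fin_gset G Z \<and>
        gset_iso G (gset_sum (gset_sum X Y') Z) (gset_sum (gset_sum X' Y) Z)) \<longleftrightarrow>
      (\<forall>Q. subgroup Q G \<longrightarrow> virtual_mark Q X' Y' = virtual_mark Q X Y)" (is "?l \<longleftrightarrow> ?r")
  proof
    assume ?l
    then obtain Z :: "('a, nat) gset" where Z: "fin_gset G Z"
      and iso: "gset_iso G (gset_sum (gset_sum X Y') Z) (gset_sum (gset_sum X' Y) Z)" by blast
    show ?r
    proof (intro allI impI)
      fix Q assume "subgroup Q G"
      then have "card (fixed_points Q X) + card (fixed_points Q Y') + card (fixed_points Q Z) =
          card (fixed_points Q X') + card (fixed_points Q Y) + card (fixed_points Q Z)"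
        using card_fixed_points_iso[OF iso subgroup.subset sums(1)[OF Z]] sums(3,4)[OF Z] by simp
      then show "virtual_mark Q X' Y' = virtual_mark Q X Y"
        by (simp add: virtual_mark_def)
    qed
  next
    assume r: ?r
    let ?Z = "gset_empty :: ('a, nat) gset"
    have "gset_iso G (gset_sum (gset_sum X Y') ?Z) (gset_sum (gset_sum X' Y) ?Z)"
    proof (rule gset_iso_if_marks_eq[OF sums(1,2)[OF fin_gset_empty]])
      fix Q assume "subgroup Q G"
      then show "card (fixed_points Q (gset_sum (gset_sum X Y') ?Z)) =
          card (fixed_points Q (gset_sum (gset_sum X' Y) ?Z))"
        using r unfolding sums(3,4)[OF fin_gset_empty] by (fastforce simp: virtual_mark_def)
    qed
    then show ?l using fin_gset_empty by blast
  qed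
  then show ?thesis using True by (simp add: burnside_class_def)
qed (auto simp: burnside_class_def)

lemma burnside_class_cong:
  assumes "fin_gset G X" "fin_gset G Y" "fin_gset G X'" "fin_gset G Y'"
    and "\<And>Q. subgroup Q G \<Longrightarrow> virtual_mark Q X Y = virtual_mark Q X' Y'"
  shows "burnside_class G X Y = burnside_class G X' Y'"
  using assms by (auto simp: in_burnside_class_iff)

lemma burnside_class_self:
  fixes X Y :: "('a, nat) gset"
  shows "\<lbrakk>fin_gset G X; fin_gset G Y\<rbrakk> \<Longrightarrow> (X, Y) \<in> burnside_class G X Y"
  by (simp add: in_burnside_class_iff)

lemma burnside_class_nat:
  assumes "fin_gset G X" "fin_gset G Y"
  obtains X' Y' :: "('a, nat) gset" where "fin_gset G X'" "fin_gset G Y'"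
    "burnside_class G X Y = burnside_class G X' Y'" "(X', Y') \<in> burnside_class G X Y"
proof -
  obtain X' Y' :: "('a, nat) gset" where *: "fin_gset G X'" "gset_iso G X X'"
    "fin_gset G Y'" "gset_iso G Y Y'"
    using nat_gset_ex assms by metis
  have eq: "burnside_class G X Y = burnside_class G X' Y'"
    by (rule burnside_class_cong)
      (use assms * in \<open>auto simp: virtual_mark_def card_fixed_points_iso dest: subgroup.subset\<close>)
  show ?thesis
    using that[OF *(1,3) eq] eq burnside_class_self[OF *(1,3)] by simp
qed

lemma burnside_class_closed:
  assumes "fin_gset G X" "fin_gset G Y"
  shows "burnside_class G X Y \<in> carrier (burnside_ring G)"
proof -
  obtain X' Y' :: "('a, nat) gset" where "fin_gset G X'" "fin_gset G Y'"
    "burnside_class G X Y = burnside_class G X' Y'"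
    using burnside_class_nat[OF assms] by metis
  then show ?thesis unfolding burnside_ring_def partial_object.simps by blast
qed

lemma burnside_carrierE:
  assumes "a \<in> carrier (burnside_ring G)"
  obtains X Y :: "('a, nat) gset" where "fin_gset G X" "fin_gset G Y" "a = burnside_class G X Y"
  using assms by (auto simp: burnside_ring_def)

lemma burnside_mark_class:
  assumes "fin_gset G X" "fin_gset G Y" "subgroup Q G"
  shows "burnside_mark Q (burnside_class G X Y) = virtual_mark Q X Y"
proof -
  obtain X' Y' :: "('a, nat) gset" where XY': "(X', Y') \<in> burnside_class G X Y"
    using burnside_class_nat[OF assms(1,2)] by metis
  have mark: "int (card (fixed_points Q U)) - int (card (fixed_points Q V)) = virtual_mark Q X Y"
    if "(U, V) \<in> burnside_class G X Y" for U V
    using that assms unfolding in_burnside_class_iff[OF assms(1,2)] virtual_mark_def by blast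
  show ?thesis
    unfolding burnside_mark_def
  proof (rule the_equality)
    show "\<exists>(U, V)\<in>burnside_class G X Y.
        virtual_mark Q X Y = int (card (fixed_points Q U)) - int (card (fixed_points Q V))"
      using mark[OF XY'] by (intro bexI[OF _ XY']) simp
  next
    fix n
    assume "\<exists>(U, V)\<in>burnside_class G X Y.
        n = int (card (fixed_points Q U)) - int (card (fixed_points Q V))"
    then obtain U V where "(U, V) \<in> burnside_class G X Y"
      "n = int (card (fixed_points Q U)) - int (card (fixed_points Q V))" by blast
    then show "n = virtual_mark Q X Y" using mark by simp
  qed
qed

text \<open>
  The operations of the Burnside ring are unions over all representatives of their arguments. All sets
  in such a union agree, since representatives of one class have the same marks.
\<close>

lemma UN_burnside_class:
  fixes X Y :: "('a, nat) gset"
  assumes XY: "fin_gset G X" "fin_gset G Y"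
    and eq: "\<And>X' Y'. \<lbrakk>fin_gset G X'; fin_gset G Y';
        \<And>Q. subgroup Q G \<Longrightarrow> virtual_mark Q X' Y' = virtual_mark Q X Y\<rbrakk> \<Longrightarrow> f X' Y' = f X Y"
  shows "(\<Union>(X, Y)\<in>burnside_class G X Y. f X Y) = f X Y"
proof -
  have "f X' Y' = f X Y" if "(X', Y') \<in> burnside_class G X Y" for X' Y'
  proof (rule eq)
    show "fin_gset G X'" "fin_gset G Y'"
      "\<And>Q. subgroup Q G \<Longrightarrow> virtual_mark Q X' Y' = virtual_mark Q X Y"
      using that unfolding in_burnside_class_iff[OF XY] by blast+
  qed
  then show ?thesis using burnside_class_self[OF XY] by fast
qed

lemma virtual_mark_sum:
  assumes "fin_gset G X" "fin_gset G Y" "fin_gset G X'" "fin_gset G Y'"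
  shows "virtual_mark Q (gset_sum X X') (gset_sum Y Y') = virtual_mark Q X Y + virtual_mark Q X' Y'"
  using assms by (simp add: virtual_mark_def card_fixed_points_sum)

lemma virtual_mark_prod:
  assumes "fin_gset G X" "fin_gset G Y" "fin_gset G X'" "fin_gset G Y'"
  shows "virtual_mark Q (gset_sum (gset_prod X X') (gset_prod Y Y'))
      (gset_sum (gset_prod X Y') (gset_prod Y X')) = virtual_mark Q X Y * virtual_mark Q X' Y'"
  using assms
  by (simp add: virtual_mark_def card_fixed_points_sum fin_gset_prod card_fixed_points_prod algebra_simps)

lemma UN2_burnside_class:
  fixes X Y X' Y' :: "('a, nat) gset"
  assumes fin: "fin_gset G X" "fin_gset G Y" "fin_gset G X'" "fin_gset G Y'"
    and f: "\<And>U V U' V'. \<lbrakk>fin_gset G U; fin_gset G V; fin_gset G U'; fin_gset G V';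
        \<And>Q. subgroup Q G \<Longrightarrow> virtual_mark Q U V = virtual_mark Q X Y;
        \<And>Q. subgroup Q G \<Longrightarrow> virtual_mark Q U' V' = virtual_mark Q X' Y'\<rbrakk> \<Longrightarrow>
      f U V U' V' = f X Y X' Y'"
  shows "(\<Union>(U, V)\<in>burnside_class G X Y. \<Union>(U', V')\<in>burnside_class G X' Y'. f U V U' V') =
    f X Y X' Y'"
proof -
  have inner: "(\<Union>(U', V')\<in>burnside_class G X' Y'. f U V U' V') = f X Y X' Y'"
    if "fin_gset G U" "fin_gset G V"
      "\<And>Q. subgroup Q G \<Longrightarrow> virtual_mark Q U V = virtual_mark Q X Y" for U V
  proof -
    have "(\<Union>(U', V')\<in>burnside_class G X' Y'. f U V U' V') = f U V X' Y'"
      by (rule UN_burnside_class[OF fin(3,4)]) (metis f fin(3,4) that)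
    also have "\<dots> = f X Y X' Y'" by (rule f) (use fin that in auto)
    finally show ?thesis .
  qed
  have "(\<Union>(U, V)\<in>burnside_class G X Y. \<Union>(U', V')\<in>burnside_class G X' Y'. f U V U' V') =
      (\<Union>(U', V')\<in>burnside_class G X' Y'. f X Y U' V')"
    by (rule UN_burnside_class[OF fin(1,2)]) (simp add: inner fin)
  then show ?thesis by (simp add: inner fin)
qed

lemma burnside_add:
  fixes X Y X' Y' :: "('a, nat) gset"
  assumes "fin_gset G X" "fin_gset G Y" "fin_gset G X'" "fin_gset G Y'"
  shows "burnside_class G X Y \<oplus>\<^bsub>burnside_ring G\<^esub> burnside_class G X' Y' =
    burnside_class G (gset_sum X X') (gset_sum Y Y')"
  unfolding burnside_ring_def ring.simps
  by (rule UN2_burnside_class[OF assms])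
    (rule burnside_class_cong; simp add: assms fin_gset_sum virtual_mark_sum)

lemma burnside_mult:
  fixes X Y X' Y' :: "('a, nat) gset"
  assumes "fin_gset G X" "fin_gset G Y" "fin_gset G X'" "fin_gset G Y'"
  shows "burnside_class G X Y \<otimes>\<^bsub>burnside_ring G\<^esub> burnside_class G X' Y' =
    burnside_class G (gset_sum (gset_prod X X') (gset_prod Y Y'))
      (gset_sum (gset_prod X Y') (gset_prod Y X'))"
  unfolding burnside_ring_def monoid.simps
  by (rule UN2_burnside_class[OF assms])
    (rule burnside_class_cong; simp add: assms fin_gset_sum fin_gset_prod virtual_mark_prod)

lemma burnside_embedding:
  "function_embedding (burnside_ring G) {Q. subgroup Q G} burnside_mark"
proof
  fix a b assume "a \<in> carrier (burnside_ring G)" "b \<in> carrier (burnside_ring G)"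
  then obtain X Y X' Y' :: "('a, nat) gset"
    where *: "fin_gset G X" "fin_gset G Y" "a = burnside_class G X Y"
      "fin_gset G X'" "fin_gset G Y'" "b = burnside_class G X' Y'"
    by (elim burnside_carrierE) blast
  show "a \<oplus>\<^bsub>burnside_ring G\<^esub> b \<in> carrier (burnside_ring G)"
    "a \<otimes>\<^bsub>burnside_ring G\<^esub> b \<in> carrier (burnside_ring G)"
    using * by (simp_all add: burnside_add burnside_mult burnside_class_closed fin_gset_sum fin_gset_prod)
  fix Q assume "Q \<in> {Q. subgroup Q G}"
  then show "burnside_mark Q (a \<oplus>\<^bsub>burnside_ring G\<^esub> b) = burnside_mark Q a + burnside_mark Q b"
    "burnside_mark Q (a \<otimes>\<^bsub>burnside_ring G\<^esub> b) = burnside_mark Q a * burnside_mark Q b"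
    using * virtual_mark_sum[of X Y X' Y'] virtual_mark_prod[of X Y X' Y']
    by (simp_all only: burnside_add burnside_mult burnside_mark_class fin_gset_sum
        fin_gset_prod mem_Collect_eq)
next
  fix a b assume ab: "a \<in> carrier (burnside_ring G)" "b \<in> carrier (burnside_ring G)"
    and eq: "\<And>Q. Q \<in> {Q. subgroup Q G} \<Longrightarrow> burnside_mark Q a = burnside_mark Q b"
  obtain X Y X' Y' :: "('a, nat) gset"
    where *: "fin_gset G X" "fin_gset G Y" "a = burnside_class G X Y"
      "fin_gset G X'" "fin_gset G Y'" "b = burnside_class G X' Y'"
    using ab by (elim burnside_carrierE) blast
  show "a = b"
    unfolding *(3,6) using * eq by (intro burnside_class_cong) (auto simp: burnside_mark_class)
next
  fix a assume "a \<in> carrier (burnside_ring G)"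
  then obtain X Y :: "('a, nat) gset"
    where *: "fin_gset G X" "fin_gset G Y" "a = burnside_class G X Y"
    by (elim burnside_carrierE) blast
  show "\<exists>b\<in>carrier (burnside_ring G). \<forall>Q\<in>{Q. subgroup Q G}. burnside_mark Q b = - burnside_mark Q a"
    by (rule bexI[of _ "burnside_class G Y X"])
      (use * in \<open>simp_all add: burnside_mark_class burnside_class_closed virtual_mark_def\<close>)
next
  have zero: "\<zero>\<^bsub>burnside_ring G\<^esub> = burnside_class G (gset_empty :: ('a, nat) gset) (gset_empty :: ('a, nat) gset)"
    by (simp add: burnside_ring_def)
  show "\<zero>\<^bsub>burnside_ring G\<^esub> \<in> carrier (burnside_ring G)"
    by (simp add: zero burnside_class_closed fin_gset_empty)
  fix Q assume "Q \<in> {Q. subgroup Q G}"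
  then show "burnside_mark Q \<zero>\<^bsub>burnside_ring G\<^esub> = 0"
    by (simp add: zero burnside_mark_class fin_gset_empty virtual_mark_def)
qed

lemma burnside_one_closed: "\<one>\<^bsub>burnside_ring G\<^esub> \<in> carrier (burnside_ring G)"
  and burnside_mark_one: "subgroup Q G \<Longrightarrow> burnside_mark Q \<one>\<^bsub>burnside_ring G\<^esub> = 1"
proof -
  have "\<one>\<^bsub>burnside_ring G\<^esub> = burnside_class G gset_point (gset_empty :: ('a, nat) gset)"
    by (simp add: burnside_ring_def)
  then show "\<one>\<^bsub>burnside_ring G\<^esub> \<in> carrier (burnside_ring G)"
    "subgroup Q G \<Longrightarrow> burnside_mark Q \<one>\<^bsub>burnside_ring G\<^esub> = 1"
    by (simp_all add: burnside_class_closed burnside_mark_class fin_gset_empty fin_gset_point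
        virtual_mark_def fixed_points_empty fixed_points_point)
qed

lemma burnside_localization:
  "Factorial_Ring.prime p \<Longrightarrow>
    embedded_localization (burnside_ring G) {Q. subgroup Q G} burnside_mark p"
  by (simp add: embedded_localization_def embedded_localization_axioms_def burnside_embedding)

lemma subgroup_image_hom:
  assumes "group H" "\<phi> \<in> hom H G" "subgroup Q H"
  shows "subgroup (\<phi> ` Q) G"
  using assms is_group
  by (auto intro: group_hom.subgroup_img_is_subgroup simp: group_hom_def group_hom_axioms_def)

lemma burnside_res_props:
  assumes H: "finite_group H" and \<phi>: "\<phi> \<in> hom H G" and a: "a \<in> carrier (burnside_ring G)"
  shows "burnside_res H \<phi> a \<in> carrier (burnside_ring H)"
    and "subgroup Q H \<Longrightarrow> burnside_mark Q (burnside_res H \<phi> a) = burnside_mark (\<phi> ` Q) a"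
proof -
  interpret H: finite_group H by fact
  obtain X Y :: "('a, nat) gset"
    where XY: "fin_gset G X" "fin_gset G Y" and a_eq: "a = burnside_class G X Y"
    using a by (elim burnside_carrierE)
  have fin: "fin_gset H (gset_res \<phi> Z)" if "fin_gset G Z" for Z :: "('a, nat) gset"
    using that \<phi> fin_gset_res H.is_group by blast
  have sub: "subgroup (\<phi> ` Q) G" if "subgroup Q H" for Q
    by (rule subgroup_image_hom[OF H.is_group \<phi> that])
  have mark: "virtual_mark Q (gset_res \<phi> Z) (gset_res \<phi> W) = virtual_mark (\<phi> ` Q) Z W"
    for Q and Z W :: "('a, nat) gset"
    by (simp add: virtual_mark_def fixed_points_res)
  have res: "burnside_res H \<phi> a = burnside_class H (gset_res \<phi> X) (gset_res \<phi> Y)"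
    unfolding burnside_res_def a_eq
    by (rule UN_burnside_class[OF XY]) (rule H.burnside_class_cong; simp add: fin XY mark sub)
  show "burnside_res H \<phi> a \<in> carrier (burnside_ring H)"
    unfolding res by (simp add: H.burnside_class_closed fin XY)
  show "subgroup Q H \<Longrightarrow> burnside_mark Q (burnside_res H \<phi> a) = burnside_mark (\<phi> ` Q) a"
    unfolding res by (simp add: H.burnside_mark_class fin XY mark a_eq burnside_mark_class sub)
qed

text \<open>
  A point of a restricted set is fixed by \<open>Q\<close> if and only if it is fixed by \<open>\<phi>(Q)\<close>; on marks,
  restriction along \<open>\<phi>\<close> is composition with \<open>\<phi>\<close>.
\<close>

lemma loc_map_burnside_res:
  assumes p: "Factorial_Ring.prime p" and H: "finite_group H" and \<phi>: "\<phi> \<in> hom H G"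
    and x: "x \<in> carrier (p_localization p (burnside_ring G))"
  defines "y \<equiv> loc_map p (burnside_ring H) (burnside_res H \<phi>) x"
  shows "y \<in> carrier (p_localization p (burnside_ring H))"
    and "subgroup Q H \<Longrightarrow> loc_mark Q y = loc_mark (\<phi> ` Q) x"
proof -
  interpret H: finite_group H by fact
  interpret LG: embedded_localization "burnside_ring G" "{Q. subgroup Q G}" burnside_mark p
    by (rule burnside_localization[OF p])
  interpret LH: embedded_localization "burnside_ring H" "{Q. subgroup Q H}" burnside_mark p
    by (rule H.burnside_localization[OF p])
  note res = burnside_res_props[OF H \<phi>]
  note sub = subgroup_image_hom[OF H.is_group \<phi>]
  obtain a n where an: "a \<in> carrier (burnside_ring G)" "\<not> int p dvd n"
    and x_eq: "x = loc_class p (burnside_ring G) a n"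
    using x by (rule LG.loc_carrierE)
  have "loc_class p (burnside_ring H) (burnside_res H \<phi> b) m =
      loc_class p (burnside_ring H) (burnside_res H \<phi> a) n" if "(b, m) \<in> x" for b m
    using that an by (simp add: x_eq LG.in_loc_class_iff LH.loc_class_eq_iff res sub)
  then have y: "y = loc_class p (burnside_ring H) (burnside_res H \<phi> a) n"
    unfolding y_def loc_map_def using LG.loc_class_self[OF an] x_eq by fast
  show "y \<in> carrier (p_localization p (burnside_ring H))"
    by (simp add: y LH.loc_class_closed res an)
  show "subgroup Q H \<Longrightarrow> loc_mark Q y = loc_mark (\<phi> ` Q) x"
    using an by (simp add: loc_mark_eq_loc_value y x_eq LG.val_loc_class LH.val_loc_class res sub)
qed


subsection \<open>Divisibility of marks by the order of the Weyl group\<close>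

lemma in_conjugate_iff: "z \<in> g <# Q #> inv g \<longleftrightarrow> (\<exists>q\<in>Q. z = g \<otimes> q \<otimes> inv g)"
  by (auto simp: l_coset_def r_coset_def)

lemma normalizer_iff:
  "Q \<subseteq> carrier G \<Longrightarrow> g \<in> normalizer G Q \<longleftrightarrow> g \<in> carrier G \<and> g <# Q #> inv g = Q"
  by (auto simp: normalizer_def stabilizer_def)

lemma subgroup_subset_normalizer:
  assumes "subgroup Q G"
  shows "Q \<subseteq> normalizer G Q"
proof
  fix g assume g: "g \<in> Q"
  interpret Q: subgroup Q G by fact
  have "g <# Q #> inv g = Q"
  proof (intro Set.set_eqI)
    fix z
    have "z = g \<otimes> (inv g \<otimes> z \<otimes> g) \<otimes> inv g" if "z \<in> Q"
      using that g by (simp add: m_assoc inv_solve_right) (simp add: m_assoc[symmetric])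
    moreover have "inv g \<otimes> z \<otimes> g \<in> Q" if "z \<in> Q" using that g by simp
    ultimately show "z \<in> g <# Q #> inv g \<longleftrightarrow> z \<in> Q"
      using g by (auto simp: in_conjugate_iff)
  qed
  then show "g \<in> normalizer G Q" using g normalizer_iff[OF Q.subset] by simp
qed

lemma stabilizer_translate:
  assumes X: "fin_gset G X" and g: "g \<in> carrier G" and x: "x \<in> fst X"
  shows "stabilizer G (snd X) (snd X g x) = g <# stabilizer G (snd X) x #> inv g"
proof (intro Set.set_eqI)
  fix h
  have *: "snd X h (snd X g x) = snd X g x \<longleftrightarrow> snd X (inv g \<otimes> h \<otimes> g) x = x" if h: "h \<in> carrier G"
  proof -
    have "snd X (inv g \<otimes> h \<otimes> g) x = snd X (inv g) (snd X h (snd X g x))"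
      using g h x gset_closed[OF X] by (simp add: gset_mult[OF X])
    then show ?thesis
      using g h x gset_closed[OF X] gset_inv[OF X] gset_inv'[OF X] by metis
  qed
  have conj1: "h = g \<otimes> (inv g \<otimes> h \<otimes> g) \<otimes> inv g" if "h \<in> carrier G"
    using that g by (simp add: m_assoc) (simp add: m_assoc[symmetric])
  have conj2: "inv g \<otimes> (g \<otimes> k \<otimes> inv g) \<otimes> g = k" if "k \<in> carrier G" for k
    using that g by (simp add: m_assoc) (simp add: m_assoc[symmetric])
  show "h \<in> stabilizer G (snd X) (snd X g x) \<longleftrightarrow> h \<in> g <# stabilizer G (snd X) x #> inv g"
  proof (intro iffI)
    assume "h \<in> stabilizer G (snd X) (snd X g x)"
    then have h: "h \<in> carrier G" "snd X (inv g \<otimes> h \<otimes> g) x = x"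
      using * by (auto simp: stabilizer_def)
    then have "inv g \<otimes> h \<otimes> g \<in> stabilizer G (snd X) x" using g by (simp add: stabilizer_def)
    then show "h \<in> g <# stabilizer G (snd X) x #> inv g"
      unfolding in_conjugate_iff using conj1[OF h(1)] by blast
  next
    assume "h \<in> g <# stabilizer G (snd X) x #> inv g"
    then obtain k where "k \<in> carrier G" "snd X k x = x" "h = g \<otimes> k \<otimes> inv g"
      by (auto simp: in_conjugate_iff stabilizer_def)
    then show "h \<in> stabilizer G (snd X) (snd X g x)"
      using g * conj2 by (simp add: stabilizer_def)
  qed
qed

lemma dvd_card_if_dvd_orbits:
  assumes "group_action H E \<phi>" "finite E" "\<And>x. x \<in> E \<Longrightarrow> d dvd card (orbit H \<phi> x) * k"
  shows "d dvd card E * k"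
proof -
  have "card E * k = (\<Sum>B\<in>orbits H E \<phi>. \<Sum>x\<in>B. k)"
    using group_action.disjoint_sum[OF assms(1,2), of "\<lambda>_. k"] by simp
  moreover have "d dvd (\<Sum>x\<in>B. k)" if "B \<in> orbits H E \<phi>" for B
    using that assms(3) by (auto simp: orbits_def)
  ultimately show ?thesis by (simp add: dvd_sum)
qed

text \<open>
  Translation by \<open>N_G(Q)\<close> preserves the points with stabilizer exactly \<open>Q\<close>, and there every orbit has
  \<open>|N_G(Q) : Q|\<close> elements. The factor \<open>card Q\<close> avoids the division.
\<close>

lemma card_normalizer_dvd_exact_points:
  assumes X: "fin_gset G X" and Q: "subgroup Q G"
  shows "card (normalizer G Q) dvd card (exact_points G Q X) * card Q"
proof -
  let ?N = "normalizer G Q"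
  let ?E = "exact_points G Q X"
  let ?H = "G\<lparr>carrier := ?N\<rparr>"
  have N: "subgroup ?N G" using normalizer_imp_subgroup[OF subgroup.subset[OF Q]] .
  have NX: "fin_gset ?H X" by (rule fin_gset_restrict_subgroup[OF X N])
  interpret H: group ?H by (rule subgroup_imp_group[OF N])
  have E: "?E \<subseteq> fst X" by (auto simp: exact_points_def)
  have inv: "snd X g x \<in> ?E" if "g \<in> ?N" "x \<in> ?E" for g x
    using that N gset_closed[OF X] normalizer_iff[OF subgroup.subset[OF Q]]
    by (auto simp: exact_points_def stabilizer_translate[OF X])
  have sub: "fin_gset ?H (subgset X ?E)"
    using E inv by (intro H.fin_gset_subgset[OF NX]) auto
  note act = H.gset_action[OF sub]
  have stab: "stabilizer ?H (snd (subgset X ?E)) x = Q" if "x \<in> ?E" for x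
    using that subgroup_subset_normalizer[OF Q] subgroup.subset[OF N]
    by (auto simp: stabilizer_def exact_points_def subgset_def)
  have "card (orbit ?H (snd (subgset X ?E)) x) * card Q = card ?N" if "x \<in> ?E" for x
    using group_action.orbit_stabilizer_theorem[OF act, of x] that stab[OF that]
    by (simp add: order_def subgset_def)
  then show ?thesis
    using H.gset_finite[OF sub] by (intro dvd_card_if_dvd_orbits[OF act[unfolded subgset_def fst_conv]])
      (auto simp: subgset_def)
qed

text \<open>
  If the marks of \<open>X - Y\<close> vanish above \<open>Q\<close>, then \<open>X\<close> and \<open>Y\<close> have equally many points with stabilizer
  \<open>R\<close> for every \<open>R\<close> above \<open>Q\<close>. Only the points with stabilizer exactly \<open>Q\<close> contribute to the mark at \<open>Q\<close>.
\<close>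

lemma normalizer_dvd_burnside_mark:
  assumes a: "a \<in> carrier (burnside_ring G)" and Q: "subgroup Q G"
    and zero: "\<And>R. \<lbrakk>subgroup R G; Q \<subset> R\<rbrakk> \<Longrightarrow> burnside_mark R a = 0"
  shows "int (card (normalizer G Q)) dvd burnside_mark Q a * int (card Q)"
proof -
  obtain X Y :: "('a, nat) gset"
    where X: "fin_gset G X" and Y: "fin_gset G Y" and a_eq: "a = burnside_class G X Y"
    using a by (elim burnside_carrierE)
  let ?T = "{R. subgroup R G \<and> Q \<subseteq> R}"
  let ?n = "\<lambda>R. int (card (exact_points G R X)) - int (card (exact_points G R Y))"
  have "card (exact_points G R X) = card (exact_points G R Y)" if "subgroup R G" "Q \<subset> R" for R
    by (rule card_exact_points_eq[OF X Y, of "{R. Q \<subset> R}"])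
      (use that zero X Y in \<open>auto simp: a_eq burnside_mark_class virtual_mark_def\<close>)
  then have "?n R = 0" if "R \<in> ?T - {Q}" for R
    using that by auto
  moreover have "burnside_mark Q a = sum ?n ?T"
    using Q by (simp add: a_eq burnside_mark_class X Y virtual_mark_def
        card_fixed_points_eq_sum_exact sum_subtractf)
  moreover have "Q \<in> ?T" "finite ?T" using Q finite_subgroups by auto
  ultimately have "burnside_mark Q a = ?n Q" by (simp add: sum.remove[of ?T Q])
  then have "burnside_mark Q a * int (card Q) =
      int (card (exact_points G Q X) * card Q) - int (card (exact_points G Q Y) * card Q)"
    by (simp only: left_diff_distrib of_nat_mult)
  then show ?thesis
    using card_normalizer_dvd_exact_points[OF X Q] card_normalizer_dvd_exact_points[OF Y Q]
    by (metis dvd_diff int_dvd_int_iff)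
qed


subsection \<open>Marks of transitive sets\<close>

lemma lcoset_eq_iff:
  assumes "subgroup P G" "a \<in> carrier G" "b \<in> carrier G"
  shows "a <# P = b <# P \<longleftrightarrow> inv a \<otimes> b \<in> P"
proof
  assume "a <# P = b <# P"
  then have "b \<in> a <# P" using lcos_self assms by blast
  then show "inv a \<otimes> b \<in> P"
    using subgroup.lcos_module_imp[OF assms(1) is_group assms(2)] by blast
next
  assume "inv a \<otimes> b \<in> P"
  then have "b \<in> a <# P"
    using subgroup.lcos_module_rev[OF assms(1) is_group assms(2,3)] by blast
  then show "a <# P = b <# P"
    using l_repr_independence assms by blast
qed

lemma fin_gset_coset:
  assumes P: "subgroup P G"
  shows "fin_gset G (coset_gset G P)"
proof -
  have cosetE: "\<exists>a\<in>carrier G. C = a <# P" if "C \<in> lcosets P" for C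
    using that by (auto simp: LCOSETS_def)
  have translate: "k <# (b <# P) = (k \<otimes> b) <# P" if "k \<in> carrier G" "b \<in> carrier G" for k b
    using that lcos_m_assoc[OF subgroup.subset[OF P]] by simp
  have in_cosets: "b <# P \<in> lcosets P" if "b \<in> carrier G" for b
    using that by (auto simp: LCOSETS_def)
  have closed: "g <# C \<in> lcosets P" if "g \<in> carrier G" "C \<in> lcosets P" for g C
    using that cosetE[of C] translate in_cosets by auto
  have one: "\<one> <# C = C" if "C \<in> lcosets P" for C
    using cosetE[OF that] translate by auto
  have mult: "(g \<otimes> h) <# C = g <# (h <# C)"
    if "g \<in> carrier G" "h \<in> carrier G" "C \<in> lcosets P" for g h C
    using cosetE[OF that(3)] that translate by (auto simp: m_assoc)
  have "finite (lcosets P)"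
    using lcosets_subset_PowG[OF P] finite_carrier by (auto intro: finite_subset)
  then show ?thesis
    by (intro fin_gsetI) (auto simp: coset_gset_def closed one mult)
qed

text \<open>
  The coset \<open>gP\<close> is fixed by \<open>Q\<close> if and only if \<open>g\<close> conjugates \<open>Q\<close> into \<open>P\<close>, and this holds
  for all elements of the coset or for none.
\<close>

lemma card_fixed_points_coset:
  assumes P: "subgroup P G" and Q: "subgroup Q G"
  shows "card (fixed_points Q (coset_gset G P)) * card P =
    card {g \<in> carrier G. inv g <# Q #> g \<subseteq> P}"
proof -
  interpret P: subgroup P G by fact
  interpret Q: subgroup Q G by fact
  let ?F = "fixed_points Q (coset_gset G P)"
  have fixed: "g <# P \<in> ?F \<longleftrightarrow> inv g <# Q #> g \<subseteq> P" if g: "g \<in> carrier G" for g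
  proof -
    have "q <# (g <# P) = g <# P \<longleftrightarrow> inv g \<otimes> q \<otimes> g \<in> P" if "q \<in> Q" for q
      using that g lcoset_eq_iff[OF P g, of "q \<otimes> g"]
      by (auto simp: lcos_m_assoc P.subset m_assoc)
    moreover have "g <# P \<in> lcosets P" using g by (auto simp: LCOSETS_def)
    moreover have "inv g <# Q #> g \<subseteq> P \<longleftrightarrow> (\<forall>q\<in>Q. inv g \<otimes> q \<otimes> g \<in> P)"
      by (auto simp: l_coset_def r_coset_def)
    ultimately show ?thesis
      by (auto simp: fixed_points_def coset_gset_def)
  qed
  have F: "?F \<subseteq> lcosets P" by (auto simp: fixed_points_def coset_gset_def)
  have "\<Union> ?F = {g \<in> carrier G. inv g <# Q #> g \<subseteq> P}"
  proof (intro Set.set_eqI iffI)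
    fix g assume "g \<in> \<Union> ?F"
    then obtain C where C: "C \<in> ?F" "g \<in> C" by blast
    then obtain a where a: "a \<in> carrier G" "C = a <# P" using F by (auto simp: LCOSETS_def)
    then have "C = g <# P" "g \<in> carrier G"
      using l_repr_independence[of g a P] C(2) P P.elemlcos_carrier is_group by auto
    then show "g \<in> {g \<in> carrier G. inv g <# Q #> g \<subseteq> P}" using C fixed by auto
  next
    fix g assume "g \<in> {g \<in> carrier G. inv g <# Q #> g \<subseteq> P}"
    then show "g \<in> \<Union> ?F" using fixed lcos_self[OF _ P] by blast
  qed
  moreover have "card (\<Union> ?F) = (\<Sum>C\<in>?F. card C)"
  proof (rule card_Union_disjoint)
    show "pairwise disjnt ?F"
      unfolding pairwise_def disjnt_def using F lcos_disjoint[OF P] by (meson subsetD)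
    show "\<And>C. C \<in> ?F \<Longrightarrow> finite C"
      using F lcosets_subset_PowG[OF P] finite_carrier by (meson PowD finite_subset subsetD)
  qed
  moreover have "card C = card P" if "C \<in> ?F" for C
    using that F l_card_cosets_equal[OF _ P.subset finite_carrier] by force
  ultimately show ?thesis by simp
qed

lemma burnside_mark_transitive:
  assumes "subgroup P G" "subgroup Q G"
  shows "burnside_mark Q (burnside_transitive G P) = int (card (fixed_points Q (coset_gset G P)))"
  unfolding burnside_transitive_def
  using assms by (simp add: burnside_mark_class fin_gset_coset fin_gset_empty virtual_mark_def
      fixed_points_empty)

end


section \<open>Fusion systems\<close>

context fusion_system
begin

sublocale finite_group S
  by unfold_locales (rule finite_S)

lemma inclusion_mor: "\<lbrakk>subgroup P S; subgroup Q S; P \<subseteq> Q\<rbrakk> \<Longrightarrow> (\<lambda>x\<in>P. x) \<in> F P Q"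
proof -
  assume *: "subgroup P S" "subgroup Q S" "P \<subseteq> Q"
  have "conj_map S P \<one> = (\<lambda>x\<in>P. x)"
    using subgroup.subset[OF *(1)] by (auto simp: conj_map_def intro!: restrict_ext)
  then show "(\<lambda>x\<in>P. x) \<in> F P Q"
    using mor_conj[OF *(1,2) one_closed] *(3) by auto
qed

context
  fixes P Q \<phi>
  assumes P: "subgroup P S" and Q: "subgroup Q S" and \<phi>: "\<phi> \<in> F P Q"
begin

lemma mor_ext: "\<phi> \<in> extensional P" and mor_inj: "inj_on \<phi> P"
  using mor_inj_hom[OF P Q \<phi>] by auto

lemma mor_hom: "\<phi> \<in> hom (S\<lparr>carrier := P\<rparr>) S"
  using mor_inj_hom[OF P Q \<phi>] subgroup.subset[OF Q] by (auto simp: hom_def)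

lemma mor_image_subset: "\<phi> ` P \<subseteq> Q"
  using mor_inj_hom[OF P Q \<phi>] by (auto simp: hom_def)

lemma mor_image_subgroup: "subgroup (\<phi> ` P) S"
  using subgroup_image_hom[OF subgroup_imp_group[OF P] mor_hom]
    group.subgroup_self[OF subgroup_imp_group[OF P]] by simp

lemma card_mor_image: "card (\<phi> ` P) = card P"
  by (rule card_image[OF mor_inj])

lemma mor_codomain:
  assumes R: "subgroup R S" "\<phi> ` P \<subseteq> R"
  shows "\<phi> \<in> F P R"
proof -
  have "compose P (\<lambda>x\<in>\<phi> ` P. x) \<phi> \<in> F P R"
    by (rule mor_compose[OF P mor_image_subgroup R(1) mor_image[OF P Q \<phi>]
          inclusion_mor[OF mor_image_subgroup R]])
  moreover have "compose P (\<lambda>x\<in>\<phi> ` P. x) \<phi> = \<phi>"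
    using mor_ext by (intro extensionalityI[of _ P]) (auto simp: compose_eq)
  ultimately show ?thesis by simp
qed

lemma mor_restrict:
  assumes R: "subgroup R S" "R \<subseteq> P"
  shows "restrict \<phi> R \<in> F R Q"
proof -
  have "compose R \<phi> (\<lambda>x\<in>R. x) \<in> F R Q"
    by (rule mor_compose[OF R(1) P Q inclusion_mor[OF R(1) P R(2)] \<phi>])
  moreover have "compose R \<phi> (\<lambda>x\<in>R. x) = restrict \<phi> R"
    by (auto simp: compose_def)
  ultimately show ?thesis by simp
qed

end

text \<open>
  A morphism is an isomorphism onto its image, so an \<open>F\<close>-conjugate is just an image of a morphism.
\<close>

lemma F_conj_iff:
  "F_conj S F P Q \<longleftrightarrow> subgroup P S \<and> subgroup Q S \<and> (\<exists>\<phi>\<in>F P (carrier S). \<phi> ` P = Q)"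
proof (cases "subgroup P S \<and> subgroup Q S")
  case True
  then have P: "subgroup P S" and Q: "subgroup Q S" by auto
  have "(\<exists>\<phi>\<in>F P Q. \<exists>\<psi>\<in>F Q P. compose P \<psi> \<phi> = (\<lambda>x\<in>P. x) \<and> compose Q \<phi> \<psi> = (\<lambda>x\<in>Q. x)) \<longleftrightarrow>
      (\<exists>\<phi>\<in>F P (carrier S). \<phi> ` P = Q)" (is "?l \<longleftrightarrow> ?r")
  proof
    assume ?l
    then obtain \<phi> \<psi> where *: "\<phi> \<in> F P Q" "\<psi> \<in> F Q P" "compose Q \<phi> \<psi> = (\<lambda>x\<in>Q. x)" by blast
    have "y \<in> \<phi> ` P" if "y \<in> Q" for y
    proof -
      have "\<phi> (\<psi> y) = y" using *(3) that by (metis compose_eq restrict_apply')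
      moreover have "\<psi> y \<in> P" using mor_image_subset[OF Q P *(2)] that by blast
      ultimately show ?thesis by (metis imageI)
    qed
    then have "\<phi> ` P = Q" using mor_image_subset[OF P Q *(1)] by blast
    then show ?r
      using mor_codomain[OF P Q *(1) subgroup_self] subgroup.subset[OF Q] by blast
  next
    assume ?r
    then obtain \<phi> where \<phi>: "\<phi> \<in> F P (carrier S)" and im: "\<phi> ` P = Q" by blast
    let ?\<psi> = "restrict (inv_into P \<phi>) Q"
    have "\<phi> \<in> F P Q" "?\<psi> \<in> F Q P"
      using mor_image[OF P subgroup_self \<phi>] mor_inverse[OF P subgroup_self \<phi>] im by simp_all
    moreover have "compose P ?\<psi> \<phi> = (\<lambda>x\<in>P. x)"
      using mor_inj[OF P subgroup_self \<phi>] im by (auto simp: compose_def intro!: restrict_ext)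
    moreover have "compose Q \<phi> ?\<psi> = (\<lambda>x\<in>Q. x)"
      using im by (auto simp: compose_def f_inv_into_f intro!: restrict_ext)
    ultimately show ?l by blast
  qed
  then show ?thesis using P Q by (simp add: F_conj_def)
qed (auto simp: F_conj_def)

lemma F_conj_subgroup: "F_conj S F P Q \<Longrightarrow> subgroup P S" "F_conj S F P Q \<Longrightarrow> subgroup Q S"
  by (auto simp: F_conj_def)

lemma F_conj_refl: "subgroup P S \<Longrightarrow> F_conj S F P P"
proof -
  assume P: "subgroup P S"
  have "(\<lambda>x\<in>P. x) \<in> F P (carrier S)"
    by (rule inclusion_mor[OF P subgroup_self subgroup.subset[OF P]])
  moreover have "(\<lambda>x\<in>P. x) ` P = P" by simp
  ultimately show ?thesis using P unfolding F_conj_iff by blast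
qed

lemma F_conj_sym: "F_conj S F P Q \<Longrightarrow> F_conj S F Q P"
  by (auto simp: F_conj_def)

lemma F_conj_mor_image: "\<lbrakk>subgroup P S; subgroup Q S; \<phi> \<in> F P Q\<rbrakk> \<Longrightarrow> F_conj S F P (\<phi> ` P)"
proof -
  assume *: "subgroup P S" "subgroup Q S" "\<phi> \<in> F P Q"
  have "\<phi> ` P \<subseteq> carrier S"
    using mor_image_subset[OF *] subgroup.subset[OF *(2)] by blast
  then show ?thesis
    unfolding F_conj_iff
    using * mor_codomain[OF * subgroup_self] mor_image_subgroup[OF *] by blast
qed

lemma F_conj_trans:
  assumes "F_conj S F P Q" "F_conj S F Q R"
  shows "F_conj S F P R"
proof -
  have P: "subgroup P S" and Q: "subgroup Q S" and R: "subgroup R S"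
    using assms by (auto simp: F_conj_def)
  obtain \<phi> where \<phi>: "\<phi> \<in> F P (carrier S)" "\<phi> ` P = Q" using assms(1) by (auto simp: F_conj_iff)
  obtain \<psi> where \<psi>: "\<psi> \<in> F Q (carrier S)" "\<psi> ` Q = R" using assms(2) by (auto simp: F_conj_iff)
  have "compose P \<psi> \<phi> \<in> F P (carrier S)"
    using mor_compose[OF P Q subgroup_self _ \<psi>(1)] mor_image[OF P subgroup_self \<phi>(1)] \<phi>(2) by simp
  moreover have "compose P \<psi> \<phi> ` P = R"
    using \<phi>(2) \<psi>(2) by (auto simp: compose_eq image_iff)
  ultimately show ?thesis using P R by (auto simp: F_conj_iff)
qed

lemma F_conj_card: "F_conj S F P Q \<Longrightarrow> card Q = card P"
  using card_mor_image[OF _ subgroup_self] by (auto simp: F_conj_iff)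

lemma in_F_class: "Q \<in> F_class S F P \<longleftrightarrow> F_conj S F P Q"
  by (simp add: F_class_def)

lemma F_class_eq_iff:
  "subgroup P S \<Longrightarrow> F_class S F P = F_class S F Q \<longleftrightarrow> F_conj S F P Q"
  unfolding F_class_def
proof (intro iffI)
  assume P: "subgroup P S" and "{Q. F_conj S F P Q} = {P. F_conj S F Q P}"
  then have "F_conj S F Q P" using F_conj_refl[OF P] by blast
  then show "F_conj S F P Q" by (rule F_conj_sym)
next
  assume PQ: "F_conj S F P Q"
  show "{Q. F_conj S F P Q} = {P. F_conj S F Q P}"
    using F_conj_trans[OF PQ] F_conj_trans[OF F_conj_sym[OF PQ]] by blast
qed

lemma finite_F_class: "finite (F_class S F P)"
  by (rule finite_subset[OF _ finite_subgroups[of "\<lambda>_. True"]]) (auto simp: F_class_def F_conj_def)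

lemma conjugate_eq_image: "g <# Q #> inv g = conj_map S Q g ` Q"
  by (auto simp: l_coset_def r_coset_def conj_map_def)

lemma F_conj_conjugate:
  assumes "subgroup Q S" "g \<in> carrier S"
  shows "F_conj S F Q (g <# Q #> inv g)"
proof -
  have "conj_map S Q g ` Q \<subseteq> carrier S"
    using assms subgroup.subset[OF assms(1)] by (auto simp: conj_map_def)
  then have "conj_map S Q g \<in> F Q (carrier S)"
    by (rule mor_conj[OF assms(1) subgroup_self assms(2)])
  then show ?thesis
    unfolding conjugate_eq_image using F_conj_mor_image[OF assms(1) subgroup_self] by blast
qed


subsection \<open>Counting morphisms\<close>

text \<open>
  The cardinality of this set is the quantity \<open>n(Q,P)\<close> through which both the marks of \<open>\<beta>_P\<close> and the
  numbers of morphisms are expressed.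
\<close>

definition conjugates_below :: "'a set \<Rightarrow> 'a set \<Rightarrow> 'a set set" where
  "conjugates_below Q P = {Q' \<in> F_class S F Q. Q' \<subseteq> P}"

lemma finite_conjugates_below: "finite (conjugates_below Q P)"
  using finite_F_class by (simp add: conjugates_below_def)

lemma conjugates_below_carrier: "conjugates_below Q (carrier S) = F_class S F Q"
proof -
  have "Q' \<subseteq> carrier S" if "F_conj S F Q Q'" for Q'
    using subgroup.subset[OF F_conj_subgroup(2)[OF that]] .
  then show ?thesis unfolding conjugates_below_def F_class_def by blast
qed

lemma conjugates_below_self:
  assumes "subgroup Q S"
  shows "conjugates_below Q Q = {Q}"
proof -
  have "Q' = Q" if "F_conj S F Q Q'" "Q' \<subseteq> Q" for Q'
    using that finite_subgroup[OF assms] F_conj_card by (metis card_subset_eq)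
  then show ?thesis
    using F_conj_refl[OF assms] by (auto simp: conjugates_below_def in_F_class)
qed

lemma conjugates_below_card_le:
  assumes "conjugates_below Q P \<noteq> {}" "subgroup P S"
  shows "card Q \<le> card P"
proof -
  obtain Q' where "F_conj S F Q Q'" "Q' \<subseteq> P"
    using assms(1) by (auto simp: conjugates_below_def in_F_class)
  then show ?thesis
    using finite_subgroup[OF assms(2)] F_conj_card card_mono by metis
qed

lemma finite_mor:
  assumes "subgroup P S" "subgroup Q S"
  shows "finite (F P Q)"
proof (rule finite_subset)
  show "F P Q \<subseteq> P \<rightarrow>\<^sub>E Q"
    using mor_ext[OF assms] mor_image_subset[OF assms] by (auto simp: PiE_def)
  show "finite (P \<rightarrow>\<^sub>E Q)"
    using assms finite_subgroup by (intro finite_PiE) auto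
qed

text \<open>
  A morphism \<open>Q \<rightarrow> P\<close> is a conjugate \<open>Q'\<close> of \<open>Q\<close> in \<open>P\<close> together with an isomorphism \<open>Q \<rightarrow> Q'\<close>, and
  \<open>Aut_F(Q)\<close> acts simply transitively on these isomorphisms.
\<close>

lemma card_mor:
  assumes Q: "subgroup Q S" and P: "subgroup P S"
  shows "card (F Q P) = card (F Q Q) * card (conjugates_below Q P)"
proof -
  let ?M = "\<lambda>Q'. {\<phi> \<in> F Q P. \<phi> ` Q = Q'}"
  have "F Q P = (\<Union>Q'\<in>conjugates_below Q P. ?M Q')"
    using F_conj_mor_image[OF Q P] mor_image_subset[OF Q P]
    by (auto simp: conjugates_below_def in_F_class)
  moreover have "card (\<Union>Q'\<in>conjugates_below Q P. ?M Q') = (\<Sum>Q'\<in>conjugates_below Q P. card (?M Q'))"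
    by (rule card_UN_disjoint) (use finite_conjugates_below finite_mor[OF Q P] in auto)
  moreover have "card (?M Q') = card (F Q Q)" if "Q' \<in> conjugates_below Q P" for Q'
  proof -
    have Q': "subgroup Q' S" "Q' \<subseteq> P" and "F_conj S F Q Q'"
      using that by (auto simp: conjugates_below_def in_F_class F_conj_def)
    then obtain \<alpha> where \<alpha>0: "\<alpha> \<in> F Q (carrier S)" and im: "\<alpha> ` Q = Q'" by (auto simp: F_conj_iff)
    have \<alpha>: "\<alpha> \<in> F Q P" using mor_codomain[OF Q subgroup_self \<alpha>0 P] im Q'(2) by blast
    note inj = mor_inj[OF Q P \<alpha>]
    have "bij_betw (\<lambda>\<theta>. compose Q \<alpha> \<theta>) (F Q Q) (?M Q')"
    proof (rule bij_betw_imageI)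
      show "inj_on (\<lambda>\<theta>. compose Q \<alpha> \<theta>) (F Q Q)"
      proof (rule inj_onI)
        fix \<theta> \<eta> assume *: "\<theta> \<in> F Q Q" "\<eta> \<in> F Q Q" "compose Q \<alpha> \<theta> = compose Q \<alpha> \<eta>"
        show "\<theta> = \<eta>"
        proof (rule extensionalityI[OF mor_ext[OF Q Q *(1)] mor_ext[OF Q Q *(2)]])
          fix x assume x: "x \<in> Q"
          then have "\<alpha> (\<theta> x) = \<alpha> (\<eta> x)" using *(3) by (metis compose_eq)
          moreover have "\<theta> x \<in> Q" "\<eta> x \<in> Q"
            using x mor_image_subset[OF Q Q *(1)] mor_image_subset[OF Q Q *(2)] by auto
          ultimately show "\<theta> x = \<eta> x" by (rule inj_onD[OF inj])
        qed
      qed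
      show "(\<lambda>\<theta>. compose Q \<alpha> \<theta>) ` F Q Q = ?M Q'"
      proof (intro equalityI subsetI)
        fix \<phi> assume "\<phi> \<in> (\<lambda>\<theta>. compose Q \<alpha> \<theta>) ` F Q Q"
        then obtain \<theta> where \<theta>: "\<theta> \<in> F Q Q" "\<phi> = compose Q \<alpha> \<theta>" by blast
        have "\<theta> ` Q = Q"
          using endo_inj_surj[OF finite_subgroup[OF Q] mor_image_subset[OF Q Q \<theta>(1)]
              mor_inj[OF Q Q \<theta>(1)]] .
        moreover have "\<phi> ` Q = \<alpha> ` \<theta> ` Q"
          unfolding \<theta>(2) image_image by (intro image_cong refl) (simp add: compose_eq)
        ultimately have "\<phi> ` Q = Q'" using im by simp
        then show "\<phi> \<in> ?M Q'" using \<theta> mor_compose[OF Q Q P \<theta>(1) \<alpha>] by simp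
      next
        fix \<phi> assume "\<phi> \<in> ?M Q'"
        then have \<phi>: "\<phi> \<in> F Q P" "\<phi> ` Q = Q'" by auto
        let ?inv = "restrict (inv_into Q \<alpha>) Q'"
        have "?inv \<in> F Q' Q" using mor_inverse[OF Q P \<alpha>] im by simp
        then have "compose Q ?inv \<phi> \<in> F Q Q"
          using mor_compose[OF Q Q'(1) Q _ \<open>?inv \<in> F Q' Q\<close>] mor_image[OF Q P \<phi>(1)] \<phi>(2) by simp
        moreover have "compose Q \<alpha> (compose Q ?inv \<phi>) = \<phi>"
        proof (rule extensionalityI[OF compose_extensional mor_ext[OF Q P \<phi>(1)]])
          fix x assume x: "x \<in> Q"
          then have "\<phi> x \<in> \<alpha> ` Q" using \<phi>(2) im by blast
          then show "compose Q \<alpha> (compose Q ?inv \<phi>) x = \<phi> x"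
            using x im by (simp add: compose_eq f_inv_into_f)
        qed
        ultimately show "\<phi> \<in> (\<lambda>\<theta>. compose Q \<alpha> \<theta>) ` F Q Q" by (metis imageI)
      qed
    qed
    then show ?thesis by (rule bij_betw_same_card[symmetric])
  qed
  ultimately show ?thesis by simp
qed

lemma card_mor_pos: "subgroup Q S \<Longrightarrow> card (F Q Q) > 0"
  using inclusion_mor[of Q Q] finite_mor[of Q Q] by (auto simp: card_gt_0_iff)

lemma conjugation_action:
  "group_action S (F_class S F Q) (\<lambda>g. \<lambda>H\<in>F_class S F Q. g <# H #> inv g)"
proof (rule group_actionI)
  have sub: "subgroup H S" if "H \<in> F_class S F Q" for H
    using that by (simp add: in_F_class F_conj_def)
  have closed: "g <# H #> inv g \<in> F_class S F Q" if "g \<in> carrier S" "H \<in> F_class S F Q" for g H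
    using that(2) F_conj_conjugate[OF sub[OF that(2)] that(1)] F_conj_trans
    unfolding in_F_class by blast
  fix g H assume gH: "g \<in> carrier S" "H \<in> F_class S F Q"
  show "(\<lambda>H\<in>F_class S F Q. g <# H #> inv g) H \<in> F_class S F Q"
    by (simp only: restrict_apply' gH(2) closed[OF gH])
  fix h assume h: "h \<in> carrier S"
  note H = sub[OF gH(2)]
  have "(g \<otimes> h) <# H #> inv (g \<otimes> h) = g <# (h <# H #> inv h) #> inv g"
    using group_action.composition_rule[OF action_by_conjugation_on_subgroups_set _ gH(1) h, of H]
      subgroup_conjugation_is_surj2[OF h H]
    by (simp only: restrict_apply' mem_Collect_eq H)
  then show "(\<lambda>H\<in>F_class S F Q. (g \<otimes> h) <# H #> inv (g \<otimes> h)) H =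
      (\<lambda>H\<in>F_class S F Q. g <# H #> inv g) ((\<lambda>H\<in>F_class S F Q. h <# H #> inv h) H)"
    by (simp only: restrict_apply' gH(2) closed[OF h gH(2)])
next
  fix H assume "H \<in> F_class S F Q"
  then have "H \<subseteq> carrier S" by (auto simp: in_F_class F_conj_def dest: subgroup.subset)
  then show "(\<lambda>H\<in>F_class S F Q. \<one> <# H #> inv \<one>) H = H"
    using \<open>H \<in> F_class S F Q\<close> by (simp add: lcos_mult_one coset_mult_one)
qed auto

text \<open>
  The left side counts pairs \<open>(Q',g)\<close> such that \<open>g\<close> conjugates \<open>Q'\<close> into \<open>P\<close>. For fixed \<open>g\<close>,
  conjugation by \<open>g\<close> permutes the class of \<open>Q\<close>, so the number of \<open>Q'\<close> does not depend on \<open>g\<close>.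
\<close>

lemma sum_transitive_marks:
  assumes P: "subgroup P S" and Q: "subgroup Q S"
  shows "(\<Sum>Q'\<in>F_class S F Q. burnside_mark Q' (burnside_transitive S P)) * int (card P) =
    int (card (carrier S) * card (conjugates_below Q P))"
proof -
  let ?C = "F_class S F Q"
  have sub: "subgroup Q' S" if "Q' \<in> ?C" for Q' using that by (simp add: in_F_class F_conj_def)
  have "(\<Sum>Q'\<in>?C. burnside_mark Q' (burnside_transitive S P)) * int (card P) =
      (\<Sum>Q'\<in>?C. int (card {g \<in> carrier S. inv g <# Q' #> g \<subseteq> P}))"
    unfolding sum_distrib_right
    by (intro sum.cong refl)
      (simp add: burnside_mark_transitive P sub card_fixed_points_coset[symmetric])
  also have "\<dots> = int (\<Sum>Q'\<in>?C. card {g \<in> carrier S. inv g <# Q' #> g \<subseteq> P})" by simp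
  also have "(\<Sum>Q'\<in>?C. card {g \<in> carrier S. inv g <# Q' #> g \<subseteq> P}) =
      (\<Sum>Q'\<in>?C. \<Sum>g\<in>carrier S. if inv g <# Q' #> g \<subseteq> P then 1 else 0)"
    using finite_carrier by (simp add: sum.If_cases Int_def)
  also have "\<dots> = (\<Sum>g\<in>carrier S. \<Sum>Q'\<in>?C. if inv g <# Q' #> g \<subseteq> P then 1 else 0)"
    by (rule sum.swap)
  also have "\<dots> = (\<Sum>g\<in>carrier S. card (conjugates_below Q P))"
  proof (rule sum.cong[OF refl])
    fix g assume g: "g \<in> carrier S"
    let ?c = "\<lambda>H\<in>?C. inv g <# H #> g"
    have bij: "bij_betw ?c ?C ?C"
      using group_action.bij_prop0[OF conjugation_action, of "inv g" Q] g by (simp add: Bij_def)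
    have "(\<Sum>Q'\<in>?C. if inv g <# Q' #> g \<subseteq> P then 1 else 0) =
        (\<Sum>Q'\<in>?C. if ?c Q' \<subseteq> P then 1 else (0::nat))"
      by (intro sum.cong) auto
    also have "\<dots> = (\<Sum>Q'\<in>?C. if Q' \<subseteq> P then 1 else 0)"
      by (rule sum.reindex_bij_betw[OF bij])
    also have "\<dots> = card (conjugates_below Q P)"
      using finite_F_class by (simp add: sum.If_cases Int_def conjugates_below_def)
    finally show "(\<Sum>Q'\<in>?C. if inv g <# Q' #> g \<subseteq> P then 1 else 0) = card (conjugates_below Q P)" .
  qed
  finally show ?thesis by simp
qed


section \<open>The Burnside ring of a fusion system\<close>

abbreviation "subgroups \<equiv> {Q. subgroup Q S}"

sublocale A: embedded_localization "burnside_ring S" subgroups burnside_mark p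
  by (rule burnside_localization[OF prime_p])

text \<open>
  The restrictions along \<open>\<phi>\<close> and along the inclusion of \<open>P\<close> agree if and only if their marks agree,
  that is, if the marks at \<open>Q\<close> and at \<open>\<phi>(Q)\<close> are equal for all \<open>Q\<close> in \<open>P\<close>. As \<open>\<phi>\<close> restricts to a
  morphism on \<open>Q\<close>, it suffices to know this for conjugate subgroups.
\<close>

lemma F_stable_iff:
  assumes x: "x \<in> carrier (p_localization p (burnside_ring S))"
  shows "F_stable p S F x \<longleftrightarrow> (\<forall>P Q. F_conj S F P Q \<longrightarrow> loc_mark P x = loc_mark Q x)"
proof -
  have same: "loc_map p (burnside_ring (S\<lparr>carrier := P\<rparr>)) (burnside_res (S\<lparr>carrier := P\<rparr>) \<phi>) x =
      loc_map p (burnside_ring (S\<lparr>carrier := P\<rparr>)) (burnside_res (S\<lparr>carrier := P\<rparr>) (\<lambda>x\<in>P. x)) x \<longleftrightarrow>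
      (\<forall>Q. subgroup Q S \<and> Q \<subseteq> P \<longrightarrow> loc_mark (\<phi> ` Q) x = loc_mark Q x)" (is "?l = ?r \<longleftrightarrow> _")
    if P: "subgroup P S" and \<phi>: "\<phi> \<in> F P (carrier S)" for P \<phi>
  proof -
    let ?H = "S\<lparr>carrier := P\<rparr>"
    have H: "finite_group ?H"
      using subgroup_imp_group[OF P] finite_subgroup[OF P]
      by (simp add: finite_group_def finite_group_axioms_def)
    have subs: "subgroup Q ?H \<longleftrightarrow> subgroup Q S \<and> Q \<subseteq> P" for Q
    proof
      assume "subgroup Q ?H"
      then show "subgroup Q S \<and> Q \<subseteq> P"
        using incl_subgroup[OF P] subgroup.subset[of Q ?H] by simp
    next
      assume "subgroup Q S \<and> Q \<subseteq> P"
      then show "subgroup Q ?H" using subgroup_incl[OF _ P] by blast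
    qed
    interpret LH: embedded_localization "burnside_ring ?H" "{Q. subgroup Q ?H}" burnside_mark p
      by (rule finite_group.burnside_localization[OF H prime_p])
    have \<iota>: "(\<lambda>x\<in>P. x) \<in> F P (carrier S)"
      using inclusion_mor[OF P subgroup_self] subgroup.subset[OF P] by blast
    note l = loc_map_burnside_res[OF prime_p H mor_hom[OF P subgroup_self \<phi>] x]
    note r = loc_map_burnside_res[OF prime_p H mor_hom[OF P subgroup_self \<iota>] x]
    have "?l = ?r \<longleftrightarrow> (\<forall>Q. subgroup Q ?H \<longrightarrow> loc_mark Q ?l = loc_mark Q ?r)"
      using LH.loc_eqI[OF l(1) r(1)] by (auto simp: loc_mark_eq_loc_value)
    also have "\<dots> \<longleftrightarrow> (\<forall>Q. subgroup Q ?H \<longrightarrow> loc_mark (\<phi> ` Q) x = loc_mark ((\<lambda>x\<in>P. x) ` Q) x)"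
      by (simp add: l(2) r(2))
    also have "\<dots> \<longleftrightarrow> (\<forall>Q. subgroup Q S \<and> Q \<subseteq> P \<longrightarrow> loc_mark (\<phi> ` Q) x = loc_mark Q x)"
    proof -
      have "(\<lambda>x\<in>P. x) ` Q = Q" if "Q \<subseteq> P" for Q using that by (auto simp: subset_eq image_iff)
      then show ?thesis by (simp add: subs)
    qed
    finally show ?thesis .
  qed
  show ?thesis
  proof
    assume stable: "F_stable p S F x"
    show "\<forall>P Q. F_conj S F P Q \<longrightarrow> loc_mark P x = loc_mark Q x"
    proof (intro allI impI)
      fix P Q assume "F_conj S F P Q"
      then obtain \<phi> where "subgroup P S" "\<phi> \<in> F P (carrier S)" "\<phi> ` P = Q"
        by (auto simp: F_conj_iff)
      then show "loc_mark P x = loc_mark Q x"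
        using stable same[of P \<phi>] unfolding F_stable_def by (metis subset_refl)
    qed
  next
    assume const: "\<forall>P Q. F_conj S F P Q \<longrightarrow> loc_mark P x = loc_mark Q x"
    have "loc_mark (\<phi> ` Q) x = loc_mark Q x"
      if "subgroup P S" "\<phi> \<in> F P (carrier S)" "subgroup Q S" "Q \<subseteq> P" for P \<phi> Q
    proof -
      have "restrict \<phi> Q \<in> F Q (carrier S)"
        by (rule mor_restrict[OF that(1) subgroup_self that(2,3,4)])
      then have "F_conj S F Q (restrict \<phi> Q ` Q)"
        by (rule F_conj_mor_image[OF that(3) subgroup_self])
      then show ?thesis using const by (metis image_restrict_eq)
    qed
    then show "F_stable p S F x"
      unfolding F_stable_def using same by blast
  qed
qed

abbreviation "R \<equiv> fusion_burnside_ring p S F"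

lemma fusion_carrier_iff:
  "x \<in> carrier R \<longleftrightarrow> x \<in> carrier A.L \<and> (\<forall>P Q. F_conj S F P Q \<longrightarrow> loc_mark P x = loc_mark Q x)"
  using F_stable_iff by (auto simp: fusion_burnside_ring_def)

lemma fusion_ring_simps:
  "x \<oplus>\<^bsub>R\<^esub> y = x \<oplus>\<^bsub>A.L\<^esub> y" "x \<otimes>\<^bsub>R\<^esub> y = x \<otimes>\<^bsub>A.L\<^esub> y" "\<zero>\<^bsub>R\<^esub> = \<zero>\<^bsub>A.L\<^esub>" "\<one>\<^bsub>R\<^esub> = \<one>\<^bsub>A.L\<^esub>"
  "r \<odot>\<^bsub>R\<^esub> x = r \<odot>\<^bsub>A.L\<^esub> x"
  by (simp_all add: fusion_burnside_ring_def)

interpretation AL: function_embedding A.L subgroups loc_mark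
  unfolding loc_mark_eq_loc_value[abs_def] using A.localization_embedding .

lemma fusion_smult_closed:
  "\<lbrakk>r \<in> p_integral p; x \<in> carrier R\<rbrakk> \<Longrightarrow> r \<odot>\<^bsub>R\<^esub> x \<in> carrier R"
  and loc_mark_smult:
  "\<lbrakk>r \<in> p_integral p; x \<in> carrier R; subgroup Q S\<rbrakk> \<Longrightarrow> loc_mark Q (r \<odot>\<^bsub>R\<^esub> x) = r * loc_mark Q x"
  using A.loc_smult_closed[of r x] A.val_smult[of r x] F_conj_subgroup
  by (simp_all add: fusion_carrier_iff fusion_ring_simps loc_mark_eq_loc_value)

lemma fusion_embedding: "function_embedding R subgroups loc_mark"
proof
  fix x y assume "x \<in> carrier R" "y \<in> carrier R"
  then show "x \<oplus>\<^bsub>R\<^esub> y \<in> carrier R" "x \<otimes>\<^bsub>R\<^esub> y \<in> carrier R"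
    "\<And>Q. Q \<in> subgroups \<Longrightarrow> loc_mark Q (x \<oplus>\<^bsub>R\<^esub> y) = loc_mark Q x + loc_mark Q y"
    "\<And>Q. Q \<in> subgroups \<Longrightarrow> loc_mark Q (x \<otimes>\<^bsub>R\<^esub> y) = loc_mark Q x * loc_mark Q y"
    by (auto simp: fusion_carrier_iff fusion_ring_simps AL.add_closed AL.mult_closed AL.v_add
        AL.v_mult F_conj_subgroup)
  assume "\<And>Q. Q \<in> subgroups \<Longrightarrow> loc_mark Q x = loc_mark Q y"
  then show "x = y"
    using \<open>x \<in> carrier R\<close> \<open>y \<in> carrier R\<close>
    by (intro AL.v_eqI) (simp_all add: fusion_carrier_iff)
next
  fix x assume x: "x \<in> carrier R"
  have "-1 \<in> p_integral p" using p_integral_of_int[OF prime_p, of "-1"] by simp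
  then show "\<exists>y\<in>carrier R. \<forall>Q\<in>subgroups. loc_mark Q y = - loc_mark Q x"
    using x by (intro bexI[of _ "(-1) \<odot>\<^bsub>R\<^esub> x"]) (auto simp: loc_mark_smult fusion_smult_closed)
next
  show "\<zero>\<^bsub>R\<^esub> \<in> carrier R" "\<And>Q. Q \<in> subgroups \<Longrightarrow> loc_mark Q \<zero>\<^bsub>R\<^esub> = 0"
    by (auto simp: fusion_carrier_iff fusion_ring_simps AL.zero_in AL.v_zero F_conj_subgroup)
qed

sublocale R: function_embedding R subgroups loc_mark
  by (rule fusion_embedding)

lemma fusion_one: "\<one>\<^bsub>R\<^esub> \<in> carrier R" "subgroup Q S \<Longrightarrow> loc_mark Q \<one>\<^bsub>R\<^esub> = 1"
proof -
  have one: "\<one>\<^bsub>A.L\<^esub> \<in> carrier A.L" "\<And>Q. subgroup Q S \<Longrightarrow> loc_mark Q \<one>\<^bsub>A.L\<^esub> = 1"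
    using A.loc_one burnside_one_closed burnside_mark_one by (auto simp: loc_mark_eq_loc_value)
  then show "\<one>\<^bsub>R\<^esub> \<in> carrier R" "subgroup Q S \<Longrightarrow> loc_mark Q \<one>\<^bsub>R\<^esub> = 1"
    using F_conj_subgroup by (auto simp: fusion_carrier_iff fusion_ring_simps)
qed

lemma fusion_cring: "cring R"
  by (rule R.embedded_cring) (auto simp: fusion_one)

lemma loc_mark_F_conj: "\<lbrakk>x \<in> carrier R; F_conj S F P Q\<rbrakk> \<Longrightarrow> loc_mark P x = loc_mark Q x"
  by (simp add: fusion_carrier_iff)

lemma loc_mark_divisible:
  assumes x: "x \<in> carrier R" and Q: "subgroup Q S"
    and zero: "\<And>H. \<lbrakk>subgroup H S; Q \<subset> H\<rbrakk> \<Longrightarrow> loc_mark H x = 0"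
  obtains c where "c \<in> p_integral p"
    "loc_mark Q x * of_nat (card Q) = of_nat (card (normalizer S Q)) * c"
proof -
  have "x \<in> carrier A.L" using x by (simp add: fusion_carrier_iff)
  then obtain a n where a: "a \<in> carrier (burnside_ring S)" and n: "\<not> int p dvd n"
    and x_eq: "x = loc_class p (burnside_ring S) a n"
    by (rule A.loc_carrierE)
  have n0: "n \<noteq> 0" using n by auto
  have val: "loc_mark H x = of_int (burnside_mark H a) / of_int n" if "subgroup H S" for H
    using that a n by (simp add: x_eq loc_mark_eq_loc_value A.val_loc_class)
  have "burnside_mark H a = 0" if "subgroup H S" "Q \<subset> H" for H
    using zero[OF that] val[OF that(1)] n0 by simp
  then obtain k where "burnside_mark Q a * int (card Q) = int (card (normalizer S Q)) * k"
    using normalizer_dvd_burnside_mark[OF a Q] by blast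
  then have "(of_int (burnside_mark Q a * int (card Q)) :: rat) =
      of_int (int (card (normalizer S Q)) * k)" by (rule arg_cong)
  then show ?thesis
    using that[OF p_integralI[OF n, of k]] val[OF Q] n0 by (simp add: field_simps)
qed

end


section \<open>Normalizers and classes in a fusion system\<close>

context fusion_system
begin

lemma normalizer_subgroup: "subgroup Q S \<Longrightarrow> subgroup (normalizer S Q) S"
  by (rule normalizer_imp_subgroup[OF subgroup.subset])

lemma subgroup_card_p_power:
  assumes "subgroup H S"
  obtains k where "card H = p ^ k"
proof -
  obtain n where "order S = p ^ n" using p_group by blast
  moreover have "card H dvd order S"
    using lagrange[OF assms] by (metis dvd_triv_right)
  ultimately show ?thesis
    using that divides_primepow_nat[OF prime_p, of "card H" n] by auto
qed

lemma subgroup_card_pos: "subgroup H S \<Longrightarrow> card H > 0"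
  using finite_subgroup[of H] subgroup.one_closed[of H S] by (auto simp: card_gt_0_iff)

lemma p_power_dvd: "p ^ j \<le> p ^ k \<Longrightarrow> p ^ j dvd p ^ k"
  using prime_gt_1_nat[OF prime_p] by (metis le_imp_power_dvd power_le_imp_le_exp)

lemma fully_normalized_ex:
  assumes "subgroup Q S"
  obtains Q' where "F_conj S F Q Q'" "fully_normalized S F Q'"
proof -
  let ?n = "\<lambda>Q. card (normalizer S Q)"
  have "F_class S F Q \<noteq> {}" using F_conj_refl[OF assms] by (auto simp: in_F_class)
  then have "Max (?n ` F_class S F Q) \<in> ?n ` F_class S F Q"
    using finite_F_class by (intro Max_in) auto
  then have "\<exists>Q'\<in>F_class S F Q. Max (?n ` F_class S F Q) = ?n Q'"
    by (simp only: image_iff)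
  then obtain Q' where Q': "Q' \<in> F_class S F Q" and n: "Max (?n ` F_class S F Q) = ?n Q'"
    by (rule bexE)
  have conj: "F_conj S F Q Q'" using Q' unfolding in_F_class .
  have same: "F_class S F Q = F_class S F Q'"
    using conj unfolding F_class_eq_iff[OF assms] .
  have "fully_normalized S F Q'"
    unfolding fully_normalized_def same[symmetric] n[symmetric]
    by (intro ballI Max_ge finite_imageI finite_F_class imageI)
  then show ?thesis using that conj by blast
qed

text \<open>
  The class of \<open>Q\<close> is a union of \<open>S\<close>-conjugacy classes, of sizes \<open>|S : N_S(Q')|\<close>. These are powers of
  \<open>p\<close>, and the least of them, which belongs to \<open>Q\<close>, divides all others.
\<close>

lemma card_dvd_class_normalizer:
  assumes Q: "subgroup Q S" and fn: "fully_normalized S F Q"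
  shows "card (carrier S) dvd card (F_class S F Q) * card (normalizer S Q)"
proof (rule dvd_card_if_dvd_orbits[OF conjugation_action finite_F_class])
  fix H assume H: "H \<in> F_class S F Q"
  then have sub: "subgroup H S" by (simp add: in_F_class F_conj_def)
  let ?\<phi> = "\<lambda>g. \<lambda>H\<in>F_class S F Q. g <# H #> inv g"
  have "stabilizer S ?\<phi> H = normalizer S H"
    using H subgroup.subset[OF sub]
    by (simp only: stabilizer_def normalizer_def restrict_apply' mem_Collect_eq)
  then have orbit: "card (orbit S ?\<phi> H) * card (normalizer S H) = card (carrier S)"
    using group_action.orbit_stabilizer_theorem[OF conjugation_action H] by (simp add: order_def)
  have "card (normalizer S H) dvd card (normalizer S Q)"
  proof -
    obtain j where j: "card (normalizer S H) = p ^ j"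
      using subgroup_card_p_power[OF normalizer_subgroup[OF sub]] .
    obtain k where k: "card (normalizer S Q) = p ^ k"
      using subgroup_card_p_power[OF normalizer_subgroup[OF Q]] .
    have "card (normalizer S H) \<le> card (normalizer S Q)"
      using fn H unfolding fully_normalized_def by blast
    then show ?thesis unfolding j k by (rule p_power_dvd)
  qed
  then show "card (carrier S) dvd card (orbit S ?\<phi> H) * card (normalizer S Q)"
    unfolding orbit[symmetric] by (rule mult_dvd_mono[OF dvd_refl])
qed

lemma centralizer_subset_normalizer:
  assumes "subgroup Q S"
  shows "centralizer S Q \<subseteq> normalizer S Q"
proof
  fix g assume g: "g \<in> centralizer S Q"
  have "g \<otimes> q \<otimes> inv g = q" if "q \<in> Q" for q
    using that g subgroup.mem_carrier[OF assms that]
    by (auto simp: centralizer_def m_assoc)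
  then have "g <# Q #> inv g = Q"
    by (auto simp: conjugate_eq_image conj_map_def)
  then show "g \<in> normalizer S Q"
    using g normalizer_iff[OF subgroup.subset[OF assms]] by (simp add: centralizer_def)
qed

text \<open>
  The fibres of the conjugation map \<open>N_S(Q) \<rightarrow> Aut_S(Q)\<close> are the cosets of \<open>C_S(Q)\<close>.
\<close>

lemma card_Aut_S:
  assumes Q: "subgroup Q S"
  shows "card (Aut_S S Q) * card (centralizer S Q) = card (normalizer S Q)"
proof -
  let ?N = "normalizer S Q" and ?C = "centralizer S Q"
  have N: "?N \<subseteq> carrier S" using subgroup.subset[OF normalizer_subgroup[OF Q]] .
  have same: "conj_map S Q g = conj_map S Q h \<longleftrightarrow> inv h \<otimes> g \<in> ?C"
    if gh: "g \<in> carrier S" "h \<in> carrier S" for g h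
  proof -
    have "g \<otimes> q \<otimes> inv g = h \<otimes> q \<otimes> inv h \<longleftrightarrow> inv h \<otimes> g \<otimes> q = q \<otimes> (inv h \<otimes> g)"
      if "q \<in> Q" for q
    proof -
      have q: "q \<in> carrier S" using that subgroup.mem_carrier[OF Q] by blast
      have "g \<otimes> q \<otimes> inv g = h \<otimes> q \<otimes> inv h \<longleftrightarrow> g \<otimes> q = h \<otimes> q \<otimes> inv h \<otimes> g"
        using gh q by (simp add: inv_solve_right')
      also have "\<dots> \<longleftrightarrow> inv h \<otimes> (g \<otimes> q) = q \<otimes> inv h \<otimes> g"
        using gh q by (metis inv_closed inv_solve_left m_assoc m_closed)
      finally show ?thesis using gh q by (simp add: m_assoc)
    qed
    moreover have "conj_map S Q g = conj_map S Q h \<longleftrightarrow>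
        (\<forall>q\<in>Q. g \<otimes> q \<otimes> inv g = h \<otimes> q \<otimes> inv h)"
      unfolding conj_map_def by (metis (no_types, lifting) restrict_apply' restrict_ext)
    ultimately show ?thesis using gh by (simp add: centralizer_def)
  qed
  have fibre: "card {g \<in> ?N. conj_map S Q g = \<phi>} = card ?C" if \<phi>: "\<phi> \<in> Aut_S S Q" for \<phi>
  proof -
    obtain h where h: "h \<in> ?N" "\<phi> = conj_map S Q h" using \<phi> by (auto simp: Aut_S_def)
    have hc: "h \<in> carrier S" using h(1) N by blast
    have "bij_betw (\<lambda>c. h \<otimes> c) ?C {g \<in> ?N. conj_map S Q g = \<phi>}"
    proof (rule bij_betw_byWitness[where f' = "\<lambda>g. inv h \<otimes> g"])
      show "\<forall>c\<in>?C. inv h \<otimes> (h \<otimes> c) = c"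
        using hc by (simp add: centralizer_def m_assoc[symmetric])
      show "\<forall>g\<in>{g \<in> ?N. conj_map S Q g = \<phi>}. h \<otimes> (inv h \<otimes> g) = g"
        using hc N by (auto simp: m_assoc[symmetric])
      show "(\<lambda>g. inv h \<otimes> g) ` {g \<in> ?N. conj_map S Q g = \<phi>} \<subseteq> ?C"
        using same hc N by (auto simp: h(2))
      show "(\<lambda>c. h \<otimes> c) ` ?C \<subseteq> {g \<in> ?N. conj_map S Q g = \<phi>}"
      proof clarify
        fix c assume c: "c \<in> ?C"
        then have cc: "c \<in> carrier S" by (simp add: centralizer_def)
        have "h \<otimes> c \<in> ?N"
          using h(1) c centralizer_subset_normalizer[OF Q] subgroup.m_closed[OF normalizer_subgroup[OF Q]]
          by blast
        moreover have "inv h \<otimes> (h \<otimes> c) = c" using hc cc by (simp add: m_assoc[symmetric])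
        ultimately show "h \<otimes> c \<in> ?N \<and> conj_map S Q (h \<otimes> c) = \<phi>"
          using same[of "h \<otimes> c" h] hc cc c by (simp add: h(2))
      qed
    qed
    then show ?thesis by (rule bij_betw_same_card[symmetric])
  qed
  have finN: "finite ?N" using N finite_carrier finite_subset by blast
  have "card ?N = card (\<Union>\<phi>\<in>Aut_S S Q. {g \<in> ?N. conj_map S Q g = \<phi>})"
    by (rule arg_cong[of _ _ card]) (auto simp: Aut_S_def)
  also have "\<dots> = (\<Sum>\<phi>\<in>Aut_S S Q. card {g \<in> ?N. conj_map S Q g = \<phi>})"
    using finN by (intro card_UN_disjoint) (auto simp: Aut_S_def)
  also have "\<dots> = card (Aut_S S Q) * card ?C" using fibre by simp
  finally show ?thesis by simp
qed

lemma centric_subgroup: "F_centric S F P \<Longrightarrow> subgroup P S"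
  by (simp add: F_centric_def)

text \<open>
  A conjugate of \<open>P\<close> contains a conjugate of \<open>Q\<close>, and passing to a larger group makes the centralizer
  smaller.
\<close>

lemma centric_overgroup:
  assumes Q: "F_centric S F Q" and P: "subgroup P S" and below: "conjugates_below Q P \<noteq> {}"
  shows "F_centric S F P"
proof -
  obtain Q' where Q': "F_conj S F Q Q'" "Q' \<subseteq> P"
    using below by (auto simp: conjugates_below_def in_F_class)
  have "centralizer S P' \<subseteq> P'" if P': "F_conj S F P P'" for P'
  proof -
    obtain \<phi> where \<phi>: "\<phi> \<in> F P (carrier S)" "\<phi> ` P = P'"
      using P' by (auto simp: F_conj_iff)
    have sub: "subgroup Q' S" using F_conj_subgroup(2)[OF Q'(1)] .
    have "restrict \<phi> Q' \<in> F Q' (carrier S)"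
      by (rule mor_restrict[OF P subgroup_self \<phi>(1) sub Q'(2)])
    then have "F_conj S F Q' (restrict \<phi> Q' ` Q')"
      by (rule F_conj_mor_image[OF sub subgroup_self])
    then have "F_conj S F Q (\<phi> ` Q')"
      using F_conj_trans[OF Q'(1)] by simp
    then have "centralizer S (\<phi> ` Q') \<subseteq> \<phi> ` Q'"
      using Q by (simp add: F_centric_def in_F_class)
    moreover have "\<phi> ` Q' \<subseteq> P'" using Q'(2) \<phi>(2) by blast
    moreover from this have "centralizer S P' \<subseteq> centralizer S (\<phi> ` Q')"
      unfolding centralizer_def by blast
    ultimately show ?thesis by blast
  qed
  then show ?thesis using P by (simp add: F_centric_def in_F_class)
qed

lemma centric_F_conj: "\<lbrakk>F_centric S F P; F_conj S F P Q\<rbrakk> \<Longrightarrow> F_centric S F Q"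
  using centric_overgroup[of P Q] F_conj_subgroup(2)[of P Q]
  unfolding conjugates_below_def F_class_def by blast

lemma centric_carrier: "F_centric S F (carrier S)"
proof -
  have "Q = carrier S" if "F_conj S F (carrier S) Q" for Q
    using F_conj_card[OF that] subgroup.subset[OF F_conj_subgroup(2)[OF that]] finite_carrier
    by (metis card_subset_eq)
  then show ?thesis
    using subgroup_self unfolding F_centric_def F_class_def centralizer_def by blast
qed

end


section \<open>The basis of stable elements\<close>

locale fusion_basis = fusion_system S p F
  for S :: "('a, 'm) monoid_scheme" (structure) and p F +
  fixes \<beta> :: "'a set \<Rightarrow> ('a burnside \<times> int) set"
  assumes beta: "subgroup P S \<Longrightarrow> is_beta p S F P (\<beta> P)"
begin

lemma beta_closed: "subgroup P S \<Longrightarrow> \<beta> P \<in> carrier R"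
  using beta by (simp add: is_beta_def)

lemma loc_mark_beta:
  assumes P: "subgroup P S" and Q: "subgroup Q S"
  shows "loc_mark Q (\<beta> P) = of_nat (card (carrier S) * card (conjugates_below Q P)) /
    of_nat (card P * card (F_class S F Q))"
proof -
  let ?s = "\<Sum>Q'\<in>F_class S F Q. burnside_mark Q' (burnside_transitive S P)"
  have "(of_int (?s * int (card P)) :: rat) = of_int (int (card (carrier S) * card (conjugates_below Q P)))"
    using sum_transitive_marks[OF P Q] by (rule arg_cong)
  then have "of_int ?s = (of_nat (card (carrier S) * card (conjugates_below Q P)) / of_nat (card P) :: rat)"
    using subgroup_card_pos[OF P] by (simp add: field_simps)
  moreover have "loc_mark Q (\<beta> P) = 1 / of_nat (card (F_class S F Q)) * of_int ?s"
    using beta[OF P] Q by (simp add: is_beta_def)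
  ultimately show ?thesis by simp
qed

lemma card_class_pos: "subgroup Q S \<Longrightarrow> card (F_class S F Q) > 0"
  using F_conj_refl finite_F_class by (metis card_gt_0_iff empty_iff in_F_class)

lemma loc_mark_beta_self:
  assumes "subgroup Q S"
  shows "loc_mark Q (\<beta> Q) = of_nat (card (carrier S)) / of_nat (card Q * card (F_class S F Q))"
  by (simp add: loc_mark_beta[OF assms assms] conjugates_below_self[OF assms])

lemma loc_mark_beta_eq_0_iff:
  assumes "subgroup P S" "subgroup Q S"
  shows "loc_mark Q (\<beta> P) = 0 \<longleftrightarrow> conjugates_below Q P = {}"
  using assms subgroup_card_pos[OF assms(1)] subgroup_card_pos[OF subgroup_self] card_class_pos[of Q]
    finite_conjugates_below[of Q P]
  by (auto simp: loc_mark_beta)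

text \<open>
  The mark of \<open>\<beta>_Q\<close> at \<open>Q\<close> is \<open>|S| / (|Q| |[Q]|) = |N_S(Q) : Q| / m\<close>, and \<open>\<beta>_Q\<close> has no marks above \<open>Q\<close>.
  So this mark is a \<open>p\<close>-integral multiple of \<open>|N_S(Q) : Q|\<close>, which makes \<open>1 / m\<close> a \<open>p\<close>-integral number.
\<close>

lemma card_class:
  assumes Q: "subgroup Q S" and fn: "fully_normalized S F Q"
  obtains m where "card (F_class S F Q) * card (normalizer S Q) = card (carrier S) * m"
    "\<not> p dvd m"
proof -
  obtain m where m: "card (F_class S F Q) * card (normalizer S Q) = card (carrier S) * m"
    using card_dvd_class_normalizer[OF Q fn] by blast
  have "loc_mark H (\<beta> Q) = 0" if H: "subgroup H S" "Q \<subset> H" for H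
  proof -
    have "card Q < card H" using H finite_subgroup by (intro psubset_card_mono) auto
    then have "conjugates_below H Q = {}" using conjugates_below_card_le[OF _ Q, of H] by force
    then show ?thesis using loc_mark_beta_eq_0_iff[OF Q H(1)] by blast
  qed
  then obtain c where c: "c \<in> p_integral p"
    "loc_mark Q (\<beta> Q) * of_nat (card Q) = of_nat (card (normalizer S Q)) * c"
    using loc_mark_divisible[OF beta_closed[OF Q] Q] by blast
  have pos: "card Q > 0" "card (F_class S F Q) > 0" "card (carrier S) > 0"
    using subgroup_card_pos Q subgroup_self card_class_pos by auto
  \<comment> \<open>comparing both expressions for the mark at \<open>Q\<close> leaves \<open>m c = 1\<close>\<close>
  have "of_nat (card (carrier S)) =
      (of_nat (card (F_class S F Q) * card (normalizer S Q)) * c :: rat)"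
    using c(2) pos by (simp add: loc_mark_beta_self[OF Q] field_simps)
  then have "of_nat (card (carrier S)) = of_nat (card (carrier S)) * (of_nat m * c)"
    unfolding m by simp
  then have "of_nat m * c = 1" using pos by simp
  then have *: "of_int (int m) * c = 1" by simp
  have "\<not> p dvd m"
  proof
    assume "p dvd m"
    obtain a n where an: "c = of_int a / of_int n" "\<not> int p dvd n"
      using c(1) by (rule p_integralE)
    then have "n \<noteq> 0" by auto
    then have "(of_int (int m * a) :: rat) = of_int n" using * an(1) by (simp add: field_simps)
    then have "int m * a = n" by (simp only: of_int_eq_iff)
    then show False using \<open>p dvd m\<close> an(2) by (metis dvd_mult2 int_dvd_int_iff)
  qed
  then show ?thesis using that m by blast
qed

text \<open>
  This is triangular elimination. Let \<open>Q\<close> be a fully normalized subgroup of largest order in \<open>D\<close>. The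
  marks of \<open>x\<close> vanish above \<open>Q\<close>, so the mark at \<open>Q\<close> is a \<open>p\<close>-integral multiple of \<open>|N_S(Q) : Q|\<close>, and
  hence one of the mark \<open>|N_S(Q) : Q| / m\<close> of \<open>\<beta>_Q\<close>. Subtracting this multiple of \<open>\<beta>_Q\<close> removes the class
  of \<open>Q\<close> from the support. The new marks that this creates lie at subgroups subconjugate to \<open>Q\<close>, which
  is why \<open>D\<close> is downward closed.

  The conclusion is stated for a set \<open>H\<close> with the closure properties of a submodule, so that it serves
  both for submodules and for induction over the stable elements.
\<close>

theorem stable_in_span:
  assumes H_zero: "\<zero>\<^bsub>R\<^esub> \<in> H"
    and H_add: "\<And>x y. \<lbrakk>x \<in> H; y \<in> H\<rbrakk> \<Longrightarrow> x \<oplus>\<^bsub>R\<^esub> y \<in> H"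
    and H_smult: "\<And>r x. \<lbrakk>r \<in> p_integral p; x \<in> H\<rbrakk> \<Longrightarrow> r \<odot>\<^bsub>R\<^esub> x \<in> H"
    and D: "D \<subseteq> subgroups"
    and D_down: "\<And>P Q. \<lbrakk>P \<in> D; subgroup Q S; conjugates_below Q P \<noteq> {}\<rbrakk> \<Longrightarrow> Q \<in> D"
    and H_beta: "\<And>P. P \<in> D \<Longrightarrow> \<beta> P \<in> H"
    and x: "x \<in> carrier R"
    and supp: "\<And>Q. \<lbrakk>subgroup Q S; Q \<notin> D\<rbrakk> \<Longrightarrow> loc_mark Q x = 0"
  shows "x \<in> H"
  using D D_down H_beta x supp
proof (induction "card D" arbitrary: D x rule: less_induct)
  case less
  note D = less.prems(1) and D_down = less.prems(2) and H_beta = less.prems(3)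
    and x = less.prems(4) and supp = less.prems(5)
  have finD: "finite D" using finite_subset[OF D finite_subgroups[of "\<lambda>_. True", simplified]] .
  show ?case
  proof (cases "D = {}")
    case True
    then have "x = \<zero>\<^bsub>R\<^esub>"
      using supp x R.zero_in by (intro R.v_eqI) (auto simp: R.v_zero)
    then show ?thesis using H_zero by simp
  next
    case False
    then have "Max (card ` D) \<in> card ` D" using finD by (intro Max_in) auto
    then obtain Q0 where Q0: "Q0 \<in> D" "card Q0 = Max (card ` D)" by auto
    obtain Q where conj: "F_conj S F Q0 Q" and fn: "fully_normalized S F Q"
      using fully_normalized_ex Q0(1) D by blast
    have Q: "subgroup Q S" using F_conj_subgroup(2)[OF conj] .
    have QD: "Q \<in> D"
      using D_down[OF Q0(1) Q] F_conj_sym[OF conj] unfolding conjugates_below_def F_class_def by blast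
    have max: "card P \<le> card Q" if "P \<in> D" for P
      using that finD Q0(2) F_conj_card[OF conj] by simp
    have "loc_mark P x = 0" if P: "subgroup P S" "Q \<subset> P" for P
    proof -
      have "card Q < card P" using P finite_subgroup by (intro psubset_card_mono) auto
      then have "P \<notin> D" using max by force
      then show ?thesis using supp P(1) by blast
    qed
    then obtain c where c: "c \<in> p_integral p"
      "loc_mark Q x * of_nat (card Q) = of_nat (card (normalizer S Q)) * c"
      using loc_mark_divisible[OF x Q] by blast
    obtain m where m: "card (F_class S F Q) * card (normalizer S Q) = card (carrier S) * m"
      using card_class[OF Q fn] by blast
    \<comment> \<open>the mark at \<open>Q\<close> is \<open>c |N_S(Q) : Q|\<close> for \<open>x\<close> and \<open>|N_S(Q) : Q| / m\<close> for \<open>\<beta>_Q\<close>\<close>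
    define r where "r = c * of_nat m"
    have "of_nat m \<in> p_integral p" using p_integral_of_int[OF prime_p, of "int m"] by simp
    then have r: "r \<in> p_integral p" "- r \<in> p_integral p"
      unfolding r_def using c(1) p_integral_mult[OF prime_p] p_integral_uminus[OF prime_p] by auto
    have eq: "loc_mark Q x = r * loc_mark Q (\<beta> Q)"
    proof -
      have pos: "card Q > 0" "card (F_class S F Q) > 0"
        using subgroup_card_pos Q card_class_pos by auto
      have mq: "(of_nat (card (F_class S F Q)) * of_nat (card (normalizer S Q)) :: rat) =
          of_nat (card (carrier S)) * of_nat m"
        using m by (metis of_nat_mult)
      have "loc_mark Q x * of_nat (card Q) * of_nat (card (F_class S F Q)) =
          of_nat (card (F_class S F Q)) * of_nat (card (normalizer S Q)) * c"
        using c(2) by simp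
      also have "\<dots> = r * of_nat (card (carrier S))" unfolding mq by (simp add: r_def)
      finally show ?thesis
        using pos by (simp add: loc_mark_beta_self[OF Q] field_simps)
    qed
    let ?b = "\<beta> Q"
    have b: "?b \<in> carrier R" using beta_closed[OF Q] .
    define y where "y = x \<oplus>\<^bsub>R\<^esub> (- r) \<odot>\<^bsub>R\<^esub> ?b"
    have y: "y \<in> carrier R"
      unfolding y_def by (rule R.add_closed[OF x fusion_smult_closed[OF r(2) b]])
    have mark_y: "loc_mark P y = loc_mark P x - r * loc_mark P ?b" if "subgroup P S" for P
      using that x b r fusion_smult_closed[OF r(2) b] by (simp add: y_def R.v_add loc_mark_smult)
    let ?D = "D - F_class S F Q"
    have "y \<in> H"
    proof (rule less.hyps)
      have "Q \<in> F_class S F Q" using F_conj_refl[OF Q] by (simp add: in_F_class)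
      then show "card ?D < card D"
        using QD finD by (intro psubset_card_mono) auto
      show "?D \<subseteq> subgroups" using D by blast
      show "\<beta> P \<in> H" if "P \<in> ?D" for P using that H_beta by blast
      show "y \<in> carrier R" by (rule y)
    next
      \<comment> \<open>by maximality of \<open>Q\<close>, a member of \<open>D\<close> containing a conjugate of \<open>Q\<close> is that conjugate\<close>
      fix P K assume P: "P \<in> ?D" and K: "subgroup K S" "conjugates_below K P \<noteq> {}"
      have "K \<notin> F_class S F Q"
      proof
        assume "K \<in> F_class S F Q"
        then have QK: "F_conj S F Q K" by (simp add: in_F_class)
        obtain K' where K': "F_conj S F K K'" "K' \<subseteq> P"
          using K(2) by (auto simp: conjugates_below_def in_F_class)
        have QK': "F_conj S F Q K'" by (rule F_conj_trans[OF QK K'(1)])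
        have "card P \<le> card K'" using max P F_conj_card[OF QK'] by auto
        then have "K' = P"
          using K'(2) P D finite_subgroup card_seteq by blast
        then show False using QK' P by (simp add: in_F_class)
      qed
      then show "K \<in> ?D" using D_down[OF _ K] P by blast
    next
      fix P assume P: "subgroup P S" "P \<notin> ?D"
      show "loc_mark P y = 0"
      proof (cases "P \<in> F_class S F Q")
        case True
        then have "loc_mark P y = loc_mark Q y"
          using loc_mark_F_conj[OF y] by (simp add: in_F_class)
        then show ?thesis using mark_y[OF Q] eq by simp
      next
        case False
        then have "P \<notin> D" using P(2) by blast
        moreover from this have "conjugates_below P Q = {}" using D_down[OF QD P(1)] by blast
        ultimately show ?thesis
          using mark_y[OF P(1)] supp[OF P(1)] loc_mark_beta_eq_0_iff[OF Q P(1)] by simp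
      qed
    qed
    moreover have "x = y \<oplus>\<^bsub>R\<^esub> r \<odot>\<^bsub>R\<^esub> ?b"
      using x y b r fusion_smult_closed
      by (intro R.v_eqI) (auto simp: R.v_add loc_mark_smult mark_y intro!: R.add_closed)
    ultimately show ?thesis
      using H_add H_smult[OF r(1) H_beta[OF QD]] by simp
  qed
qed

text \<open>
  One inclusion holds because a subgroup that contains a conjugate of a centric one is centric; for
  the other, an element without centric marks is supported on the downward closed set of non-centric
  subgroups.
\<close>

lemma noncentric_submodule_eq:
  "noncentric_submodule p S F \<beta> =
    {x \<in> carrier R. \<forall>Q. F_centric S F Q \<longrightarrow> loc_mark Q x = 0}" (is "_ = ?K")
proof (rule equalityI)
  have "submodule ?K (Zloc p) R"
  proof (intro submodule.intro subgroup.intro submodule_axioms.intro)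
    show "?K \<subseteq> carrier (add_monoid R)" by auto
    show "x \<otimes>\<^bsub>add_monoid R\<^esub> y \<in> ?K" if "x \<in> ?K" "y \<in> ?K" for x y
      using that by (simp add: R.add_closed R.v_add centric_subgroup)
    show "\<one>\<^bsub>add_monoid R\<^esub> \<in> ?K" by (simp add: R.zero_in R.v_zero centric_subgroup)
    show "inv\<^bsub>add_monoid R\<^esub> x \<in> ?K" if "x \<in> ?K" for x
      using that by (simp add: R.v_neg centric_subgroup a_inv_def[symmetric])
    show "r \<odot>\<^bsub>R\<^esub> x \<in> ?K" if "r \<in> carrier (Zloc p)" "x \<in> ?K" for r x
      using that by (simp add: Zloc_carrier[OF prime_p] fusion_smult_closed loc_mark_smult centric_subgroup)
  qed
  moreover have "\<beta> P \<in> ?K" if P: "subgroup P S" "\<not> F_centric S F P" for P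
  proof -
    have "loc_mark Q (\<beta> P) = 0" if Q: "F_centric S F Q" for Q
      using centric_overgroup[OF Q P(1)] P loc_mark_beta_eq_0_iff[OF P(1) centric_subgroup[OF Q]]
      by blast
    then show ?thesis using beta_closed[OF P(1)] by blast
  qed
  ultimately show "noncentric_submodule p S F \<beta> \<subseteq> ?K"
    unfolding noncentric_submodule_def Zloc_span_def by blast
next
  show "?K \<subseteq> noncentric_submodule p S F \<beta>"
    unfolding noncentric_submodule_def Zloc_span_def
  proof (intro subsetI InterI)
    fix x H
    assume x: "x \<in> ?K"
      and "H \<in> {H. submodule H (Zloc p) R \<and> {\<beta> P |P. subgroup P S \<and> \<not> F_centric S F P} \<subseteq> H}"
    then have H: "submodule H (Zloc p) R"
      and H_beta: "\<And>P. \<lbrakk>subgroup P S; \<not> F_centric S F P\<rbrakk> \<Longrightarrow> \<beta> P \<in> H" by auto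
    interpret H: submodule H "Zloc p" R by (rule H)
    show "x \<in> H"
    proof (rule stable_in_span[where D = "{P. subgroup P S \<and> \<not> F_centric S F P}"])
      show "\<zero>\<^bsub>R\<^esub> \<in> H" "\<And>x y. \<lbrakk>x \<in> H; y \<in> H\<rbrakk> \<Longrightarrow> x \<oplus>\<^bsub>R\<^esub> y \<in> H"
        using H.one_closed H.m_closed by simp_all
      show "\<And>r x. \<lbrakk>r \<in> p_integral p; x \<in> H\<rbrakk> \<Longrightarrow> r \<odot>\<^bsub>R\<^esub> x \<in> H"
        using H.smult_closed by (simp add: Zloc_carrier[OF prime_p])
      show "x \<in> carrier R" using x by simp
      show "\<And>P. P \<in> {P. subgroup P S \<and> \<not> F_centric S F P} \<Longrightarrow> \<beta> P \<in> H"
        using H_beta by simp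
      show "loc_mark Q x = 0" if "subgroup Q S" "Q \<notin> {P. subgroup P S \<and> \<not> F_centric S F P}" for Q
        using that x by simp
      show "Q \<in> {P. subgroup P S \<and> \<not> F_centric S F P}"
        if "P \<in> {P. subgroup P S \<and> \<not> F_centric S F P}" "subgroup Q S" "conjugates_below Q P \<noteq> {}"
        for P Q
        using that centric_overgroup by blast
    qed auto
  qed
qed

end


section \<open>Inverting an element of a subring of finite index\<close>

lemma (in function_embedding) powers_ex:
  assumes "b \<in> carrier R"
  shows "\<exists>r\<in>carrier R. \<forall>i\<in>I. v i r = v i b ^ Suc k"
proof (induction k)
  case 0
  show ?case using assms by auto
next
  case (Suc k)
  then obtain r where "r \<in> carrier R" "\<forall>i\<in>I. v i r = v i b ^ Suc k" by blast
  then show ?case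
    using assms by (intro bexI[of _ "r \<otimes> b"]) (auto simp: v_mult mult_closed)
qed

text \<open>
  By the pigeonhole principle two of the multiples \<open>0, f, \<dots>, K f\<close> lie in the same of the \<open>K\<close> cosets,
  so some \<open>d f\<close> with \<open>1 \<le> d \<le> K\<close> lies in the image. The factorial of \<open>K\<close> is a multiple of every such \<open>d\<close>.
\<close>

lemma finite_cokernel_multiple:
  fixes A :: "('b, 'm) ring_scheme" and \<Phi> :: "'b \<Rightarrow> 'i \<Rightarrow> int"
  assumes emb: "function_embedding A I (\<lambda>i a. \<Phi> a i)"
    and fin: "finite (a_rcosets\<^bsub>int_product_ring I\<^esub> (\<Phi> ` carrier A))"
  obtains n :: nat where "n > 0" "\<And>f. \<exists>a\<in>carrier A. \<forall>i\<in>I. \<Phi> a i = int n * f i"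
proof -
  interpret E: function_embedding A I "\<lambda>i a. \<Phi> a i" by (rule emb)
  let ?P = "int_product_ring I"
  let ?H = "\<Phi> ` carrier A"
  let ?K = "card (a_rcosets\<^bsub>?P\<^esub> ?H)"
  have multiple: "\<exists>a\<in>carrier A. \<forall>i\<in>I. \<Phi> a i = int (fact ?K) * f i" for f
  proof -
    define g where "g j = (\<lambda>i\<in>I. int j * f i)" for j
    let ?c = "\<lambda>j. ?H +>\<^bsub>?P\<^esub> g j"
    have "?c ` {0..?K} \<subseteq> a_rcosets\<^bsub>?P\<^esub> ?H"
    proof -
      have "g j \<in> carrier ?P" for j by (simp add: int_product_ring_def g_def)
      then show ?thesis unfolding A_RCOSETS_def RCOSETS_def a_r_coset_def by auto
    qed
    then have "card (?c ` {0..?K}) < card {0..?K}"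
      using card_mono[OF fin, of "?c ` {0..?K}"] by simp
    then have "\<not> inj_on ?c {0..?K}" using card_image by fastforce
    then obtain j1 j2 where "j1 \<in> {0..?K}" "j2 \<in> {0..?K}" "j1 \<noteq> j2" "?c j1 = ?c j2"
      by (auto simp: inj_on_def)
    then obtain j j' where j: "j < j'" "j' \<le> ?K" and same: "?c j' = ?c j"
      by (metis atLeastAtMost_iff linorder_neqE_nat)
    have coset: "h \<in> ?c k \<longleftrightarrow> (\<exists>a\<in>carrier A. h = (\<lambda>i\<in>I. \<Phi> a i + g k i))" for h k
      by (auto simp: a_r_coset_def r_coset_def int_product_ring_def)
    have "g j' = (\<lambda>i\<in>I. \<Phi> \<zero>\<^bsub>A\<^esub> i + g j' i)"
      by (auto simp: g_def E.v_zero)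
    then have "g j' \<in> ?c j" using E.zero_in coset same by blast
    then obtain a where a: "a \<in> carrier A" "g j' = (\<lambda>i\<in>I. \<Phi> a i + g j i)" using coset by blast
    have diff: "\<Phi> a i = int (j' - j) * f i" if "i \<in> I" for i
      using fun_cong[OF a(2), of i] that j(1) by (simp add: g_def of_nat_diff algebra_simps)
    have "j' - j dvd fact ?K"
      using j by (intro dvd_fact) auto
    then obtain k where k: "fact ?K = (j' - j) * k" by blast
    show ?thesis
    proof (rule bexI[of _ "[k] \<cdot>\<^bsub>A\<^esub> a"])
      show "[k] \<cdot>\<^bsub>A\<^esub> a \<in> carrier A" using a(1) by simp
      show "\<forall>i\<in>I. \<Phi> ([k] \<cdot>\<^bsub>A\<^esub> a) i = int (fact ?K) * f i"
        using a(1) diff by (simp add: E.v_nat_multiple k)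
    qed
  qed
  show ?thesis by (rule that[of "fact ?K"]) (use multiple in simp_all)
qed

text \<open>
  Let \<open>u\<close> be the vector of values of \<open>b\<close>, and let \<open>q\<close> be the \<open>p\<close>-part of \<open>n\<close>. By Euler's theorem some
  power \<open>u\<^sup>e\<close> with \<open>e \<ge> 2\<close> is congruent to \<open>1\<close> modulo \<open>q\<close>, say \<open>u\<^sup>e = 1 + q t\<close>. Then
  \<open>1/u = u\<^sup>e / u - q t/u\<close>. Here \<open>u\<^sup>e / u\<close> is the value of a power of \<open>b\<close> with exponent
  \<open>e - 1 \<ge> 1\<close>, and \<open>q t/u\<close> is a value because the ring contains \<open>n\<close> times every integral vector and
  the part of \<open>n\<close> prime to \<open>p\<close> can be inverted.
\<close>

lemma (in embedded_localization) val_inverse_ex: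
  assumes I: "finite I" and b: "b \<in> carrier B" and unit: "\<And>i. i \<in> I \<Longrightarrow> \<not> int p dvd \<mu> i b"
    and n: "n > 0" "\<And>f. \<exists>a\<in>carrier B. \<forall>i\<in>I. \<mu> i a = int n * f i"
  obtains w where "w \<in> carrier L" "\<And>i. i \<in> I \<Longrightarrow> val i w = 1 / of_int (\<mu> i b)"
proof -
  interpret L: function_embedding L I val by (rule localization_embedding)
  have "\<not> is_unit p" using prime_gt_1_nat[OF prime_p] by simp
  then obtain n' where n': "n = p ^ multiplicity p n * n'" "\<not> p dvd n'"
    using multiplicity_decompose'[of n p] n(1) by auto
  let ?q = "p ^ multiplicity p n"
  \<comment> \<open>an even exponent: Euler's theorem is applied to \<open>|u|\<close>, and signs disappear in squares\<close>
  let ?e = "2 * totient ?q"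
  have q: "?q > 0" using prime_gt_0_nat[OF prime_p] by simp
  have euler: "int ?q dvd \<mu> i b ^ ?e - 1" if i: "i \<in> I" for i
  proof -
    have "coprime (int p) (\<mu> i b)"
      using unit[OF i] prime_p by (simp add: prime_imp_coprime)
    then have "coprime ((nat \<bar>\<mu> i b\<bar>)) ?q"
      by (simp add: coprime_commute coprime_nat_abs_right_iff flip: coprime_int_iff)
    then have "[nat \<bar>\<mu> i b\<bar> ^ totient ?q = 1] (mod ?q)" by (rule euler_theorem)
    then have "[int (nat \<bar>\<mu> i b\<bar> ^ totient ?q) ^ 2 = int 1 ^ 2] (mod int ?q)"
      by (intro cong_pow) (simp only: cong_int_iff)
    moreover have "int (nat \<bar>\<mu> i b\<bar> ^ totient ?q) ^ 2 = \<mu> i b ^ ?e"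
    proof -
      have "int (nat \<bar>\<mu> i b\<bar> ^ totient ?q) ^ 2 = (\<bar>\<mu> i b\<bar> ^ totient ?q) ^ 2" by simp
      also have "\<dots> = \<bar>\<mu> i b\<bar> ^ ?e" by (rule power_even_eq[symmetric])
      also have "\<dots> = \<mu> i b ^ ?e" by (rule power_even_abs) simp
      finally show ?thesis .
    qed
    ultimately have "[\<mu> i b ^ ?e = 1] (mod int ?q)" by simp
    then show ?thesis by (simp add: cong_iff_dvd_diff)
  qed
  define t where "t i = (\<mu> i b ^ ?e - 1) div int ?q" for i
  \<comment> \<open>\<open>1/u\<close> is \<open>g/U\<close> with \<open>g\<close> integral and a common denominator \<open>U\<close>, the product of the values\<close>
  define g where "g i = (\<Prod>j\<in>I - {i}. \<mu> j b)" for i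
  let ?U = "\<Prod>i\<in>I. \<mu> i b"
  have t: "\<mu> i b ^ ?e = int ?q * t i + 1" if "i \<in> I" for i
    using euler[OF that] by (simp add: t_def)
  have g: "\<mu> i b * g i = ?U" if "i \<in> I" for i
    using prod.remove[OF I that, of "\<lambda>j. \<mu> j b"] by (simp add: g_def)
  have U: "\<not> int p dvd ?U"
    using unit I prime_p by (simp add: prime_dvd_prod_iff)
  have n'U: "\<not> int p dvd int n' * ?U"
    using not_dvd_mult[OF prime_p _ U] n'(2) by simp
  obtain c where c: "c \<in> carrier B" "\<forall>i\<in>I. \<mu> i c = int n * (t i * g i)"
    using n(2)[of "\<lambda>i. t i * g i"] by blast
  have "totient ?q > 0" using q by simp
  then obtain j where "totient ?q = Suc j" using gr0_implies_Suc by blast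
  then obtain k where k: "?e = Suc (Suc k)" by simp
  obtain r where r: "r \<in> carrier B" "\<forall>i\<in>I. \<mu> i r = \<mu> i b ^ Suc k"
    using powers_ex[OF b] by blast
  let ?r = "loc_class p B r 1" and ?c = "loc_class p B c (int n' * ?U)"
  have closed: "?r \<in> carrier L" "?c \<in> carrier L"
    using r(1) c(1) p_not_dvd_1 n'U by (auto intro: loc_class_closed)
  show ?thesis
  proof (rule that[of "?r \<oplus>\<^bsub>L\<^esub> (\<ominus>\<^bsub>L\<^esub> ?c)"])
    show "?r \<oplus>\<^bsub>L\<^esub> (\<ominus>\<^bsub>L\<^esub> ?c) \<in> carrier L" using closed by simp
    fix i assume i: "i \<in> I"
    let ?u = "of_int (\<mu> i b) :: rat"
    have u0: "?u \<noteq> 0" using unit[OF i] by auto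
    have U0: "(of_int ?U :: rat) \<noteq> 0" using U by (metis dvd_0_right of_int_eq_0_iff)
    have n'0: "(of_nat n' :: rat) \<noteq> 0" using n'(2) by (metis dvd_0_right of_nat_eq_0_iff)
    have n_rat: "(of_nat n :: rat) = of_nat ?q * of_nat n'" using n'(1) by (metis of_nat_mult)
    have "val i ?c = of_int (int n * (t i * g i)) / of_int (int n' * ?U)"
      using val_loc_class[OF c(1) n'U i] c(2) i by simp
    also have "\<dots> = of_int (int ?q * t i) * (of_int (g i) / of_int ?U)"
      using n'0 by (simp add: n_rat)
    also have "of_int (g i) / of_int ?U = 1 / ?u"
    proof -
      have "?u * of_int (g i) = of_int ?U" using g[OF i] by (metis of_int_mult)
      then show ?thesis using u0 U0 by (simp add: field_simps)
    qed
    finally have "val i ?c = of_int (int ?q * t i) / ?u" by simp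
    moreover have "val i ?r = ?u ^ ?e / ?u"
      using r i p_not_dvd_1 u0 by (simp add: val_loc_class k)
    moreover have "?u ^ ?e = of_int (int ?q * t i) + 1"
      using t[OF i] by (metis of_int_1 of_int_add of_int_power)
    ultimately show "val i (?r \<oplus>\<^bsub>L\<^esub> (\<ominus>\<^bsub>L\<^esub> ?c)) = 1 / of_int (\<mu> i b)"
      using closed i by (simp add: L.v_add L.v_neg add_divide_distrib)
  qed
qed


section \<open>Comparison of the two Burnside rings\<close>

text \<open>
  Here \<open>\<mu> C\<close> is the coordinate at \<open>C\<close> of the mark homomorphism of the Diaz--Libman ring, and \<open>n\<close>
  annihilates its cokernel.
\<close>

locale centric_comparison = saturated_fusion_system S p F + fusion_basis S p F \<beta> +
  DL: embedded_localization A "centric_classes S F" \<mu> p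
  for S :: "('a, 'm) monoid_scheme" (structure) and p F \<beta>
    and A :: "('c, 'n) ring_scheme" and \<mu> :: "'a set set \<Rightarrow> 'c \<Rightarrow> int" +
  fixes \<xi> :: "'a set set \<Rightarrow> 'c" and n :: nat
  assumes xi_in: "C \<in> centric_classes S F \<Longrightarrow> \<xi> C \<in> carrier A"
    and xi_span: "a \<in> carrier A \<Longrightarrow>
      \<exists>c :: 'a set set \<Rightarrow> int. a = (\<Oplus>\<^bsub>A\<^esub>C\<in>centric_classes S F. [c C] \<cdot>\<^bsub>A\<^esub> \<xi> C)"
    and xi_mark: "\<lbrakk>F_centric S F P; F_centric S F Q\<rbrakk> \<Longrightarrow>
      (of_int (\<mu> (F_class S F Q) (\<xi> (F_class S F P))) :: rat) =
        of_nat (card (centralizer S Q \<inter> Q) * card (F Q P)) / of_nat (card P)"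
    and index: "n > 0" "\<exists>a\<in>carrier A. \<forall>C\<in>centric_classes S F. \<mu> C a = int n * f C"
begin

abbreviation "S_class \<equiv> F_class S F (carrier S)"

lemma class_centric: "F_centric S F P \<Longrightarrow> F_class S F P \<in> centric_classes S F"
  by (auto simp: centric_classes_def)

lemma finite_centric_classes: "finite (centric_classes S F)"
proof -
  have "centric_classes S F \<subseteq> F_class S F ` subgroups"
    using centric_subgroup by (auto simp: centric_classes_def)
  moreover have "finite subgroups" using finite_subgroups[of "\<lambda>_. True"] by simp
  ultimately show ?thesis by (meson finite_imageI finite_subset)
qed

text \<open>
  The mark of \<open>\<xi>_S\<close> at \<open>Q\<close> is \<open>|Z(Q)| |Aut_F(Q)| |[Q]| / |S|\<close>, and \<open>Q\<close> may be taken fully normalized.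
  By the Sylow axiom \<open>|Aut_F(Q)|\<close> is \<open>|Aut_S(Q)| = |N_S(Q)| / |C_S(Q)|\<close> up to a factor prime to \<open>p\<close>, and
  \<open>|[Q]|\<close> is \<open>|S : N_S(Q)|\<close> up to such a factor. As \<open>C_S(Q) = Z(Q)\<close>, everything but these factors cancels.
\<close>

lemma mark_top_unit:
  assumes Q: "F_centric S F Q"
  shows "\<not> int p dvd \<mu> (F_class S F Q) (\<xi> S_class)"
proof -
  obtain Q' where conj: "F_conj S F Q Q'" and fn: "fully_normalized S F Q'"
    using fully_normalized_ex[OF centric_subgroup[OF Q]] .
  have cen: "F_centric S F Q'" by (rule centric_F_conj[OF Q conj])
  have Q': "subgroup Q' S" by (rule centric_subgroup[OF cen])
  have "F_class S F Q = F_class S F Q'"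
    using conj F_class_eq_iff[OF centric_subgroup[OF Q]] by blast
  moreover have "\<not> int p dvd \<mu> (F_class S F Q') (\<xi> S_class)"
  proof -
    let ?u = "\<mu> (F_class S F Q') (\<xi> S_class)"
    let ?z = "card (centralizer S Q')" and ?a = "card (Aut_S S Q')"
    have "centralizer S Q' \<subseteq> Q'"
      using cen F_conj_refl[OF Q'] by (simp add: F_centric_def in_F_class)
    then have Z: "centralizer S Q' \<inter> Q' = centralizer S Q'" by blast
    have "sylow_subgroup p (Aut_S S Q') (Aut_F F Q')"
      using sylow_axiom[OF Q' fn] by blast
    then have "?a = p ^ multiplicity p (card (F Q' Q'))"
      by (simp add: sylow_subgroup_def order_def Aut_F_def)
    moreover have "\<not> is_unit p" using prime_gt_1_nat[OF prime_p] by simp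
    ultimately obtain m1 where m1: "card (F Q' Q') = ?a * m1" "\<not> p dvd m1"
      using multiplicity_decompose'[of "card (F Q' Q')" p] card_mor_pos[OF Q'] by auto
    obtain m2 where m2: "card (F_class S F Q') * card (normalizer S Q') = card (carrier S) * m2"
      "\<not> p dvd m2"
      using card_class[OF Q' fn] .
    have "?z * card (F Q' (carrier S)) = (?a * ?z) * card (F_class S F Q') * m1"
      by (simp add: card_mor[OF Q' subgroup_self] conjugates_below_carrier m1(1))
    also have "\<dots> = card (carrier S) * (m2 * m1)"
      using m2(1) card_Aut_S[OF Q'] by (simp add: mult.commute)
    finally have "(of_int ?u :: rat) = of_nat (card (carrier S) * (m2 * m1)) / of_nat (card (carrier S))"
      using xi_mark[OF centric_carrier cen] Z by simp
    also have "\<dots> = of_int (int (m2 * m1))"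
      using subgroup_card_pos[OF subgroup_self] by simp
    finally have "?u = int (m2 * m1)" by (simp only: of_int_eq_iff)
    moreover have "\<not> p dvd m2 * m1"
      using m1(2) m2(2) prime_p by (simp add: prime_dvd_mult_iff)
    ultimately show ?thesis by (simp only: int_dvd_int_iff not_False_eq_True)
  qed
  ultimately show ?thesis by simp
qed

lemma mark_top_nonzero: "F_centric S F Q \<Longrightarrow> \<mu> (F_class S F Q) (\<xi> S_class) \<noteq> 0"
  using mark_top_unit by force

text \<open>
  This identity is the reason for the formula \<open>\<beta>_P \<mapsto> \<xi>_P / \<xi>_S\<close>: in the product of
  \<open>|S| n(Q,P) / (|P| |[Q]|)\<close> and \<open>|Z(Q)| |Aut_F(Q)| |[Q]| / |S|\<close> both \<open>|S|\<close> and \<open>|[Q]|\<close> cancel.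
\<close>

lemma beta_mark_times_top:
  assumes P: "F_centric S F P" and Q: "F_centric S F Q"
  shows "loc_mark Q (\<beta> P) * of_int (\<mu> (F_class S F Q) (\<xi> S_class)) =
    of_int (\<mu> (F_class S F Q) (\<xi> (F_class S F P)))"
proof -
  note sub = centric_subgroup[OF P] centric_subgroup[OF Q]
  have cancel: "of_nat (s * k) / of_nat (q * c) * (of_nat (z * (a * c)) / of_nat s) =
      (of_nat (z * (a * k)) / of_nat q :: rat)" if "s > 0" "c > 0" for s k q c z a :: nat
    using that by simp
  show ?thesis
    unfolding loc_mark_beta[OF sub] xi_mark[OF centric_carrier Q] xi_mark[OF P Q]
      card_mor[OF sub(2,1)] card_mor[OF sub(2) subgroup_self] conjugates_below_carrier
    by (rule cancel[OF subgroup_card_pos[OF subgroup_self] card_class_pos[OF sub(2)]])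
qed

text \<open>
  This is the graph of the homomorphism from the stable elements to the localized Diaz--Libman ring.
  It is single-valued because the centric marks separate the elements of the latter.
\<close>

definition matches :: "('a burnside \<times> int) set \<Rightarrow> ('c \<times> int) set \<Rightarrow> bool" where
  "matches x y \<longleftrightarrow> (\<forall>Q. F_centric S F Q \<longrightarrow> DL.val (F_class S F Q) y = loc_mark Q x)"

interpretation L: function_embedding DL.L "centric_classes S F" DL.val
  by (rule DL.localization_embedding)

lemma DL_eqI:
  assumes "x \<in> carrier DL.L" "y \<in> carrier DL.L"
    and "\<And>Q. F_centric S F Q \<Longrightarrow> DL.val (F_class S F Q) x = DL.val (F_class S F Q) y"
  shows "x = y"
  using assms by (intro DL.loc_eqI) (auto simp: centric_classes_def)

abbreviation "X P \<equiv> loc_class p A (\<xi> (F_class S F P)) 1"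

lemma X_closed: "F_centric S F P \<Longrightarrow> X P \<in> carrier DL.L"
  using DL.p_not_dvd_1 by (intro DL.loc_class_closed xi_in class_centric)

lemma val_X:
  "\<lbrakk>F_centric S F P; F_centric S F Q\<rbrakk> \<Longrightarrow>
    DL.val (F_class S F Q) (X P) = of_int (\<mu> (F_class S F Q) (\<xi> (F_class S F P)))"
  using DL.p_not_dvd_1 by (simp add: DL.val_loc_class xi_in class_centric)

lemma top_inverse:
  obtains w where "w \<in> carrier DL.L"
    "\<And>Q. F_centric S F Q \<Longrightarrow> DL.val (F_class S F Q) w = 1 / of_int (\<mu> (F_class S F Q) (\<xi> S_class))"
proof -
  have unit: "\<not> int p dvd \<mu> C (\<xi> S_class)" if "C \<in> centric_classes S F" for C
    using that mark_top_unit by (auto simp: centric_classes_def)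
  obtain w where "w \<in> carrier DL.L"
    "\<And>C. C \<in> centric_classes S F \<Longrightarrow> DL.val C w = 1 / of_int (\<mu> C (\<xi> S_class))"
    using DL.val_inverse_ex[OF finite_centric_classes xi_in[OF class_centric[OF centric_carrier]]
        unit index] by metis
  then show ?thesis using that class_centric by simp
qed

lemma matches_beta:
  assumes w: "w \<in> carrier DL.L"
    "\<And>Q. F_centric S F Q \<Longrightarrow> DL.val (F_class S F Q) w = 1 / of_int (\<mu> (F_class S F Q) (\<xi> S_class))"
    and P: "F_centric S F P"
  shows "matches (\<beta> P) (X P \<otimes>\<^bsub>DL.L\<^esub> w)"
  unfolding matches_def
proof (intro allI impI)
  fix Q assume Q: "F_centric S F Q"
  have "DL.val (F_class S F Q) (X P \<otimes>\<^bsub>DL.L\<^esub> w) =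
      loc_mark Q (\<beta> P) * of_int (\<mu> (F_class S F Q) (\<xi> S_class)) / of_int (\<mu> (F_class S F Q) (\<xi> S_class))"
    using w Q P by (simp add: L.v_mult X_closed class_centric val_X beta_mark_times_top)
  then show "DL.val (F_class S F Q) (X P \<otimes>\<^bsub>DL.L\<^esub> w) = loc_mark Q (\<beta> P)"
    using mark_top_nonzero[OF Q] by simp
qed

text \<open>
  The stable elements with a counterpart form a submodule, so it suffices to treat the \<open>\<beta>_P\<close>.
\<close>

lemma matching_in_DL:
  assumes x: "x \<in> carrier R"
  shows "\<exists>y\<in>carrier DL.L. matches x y"
proof -
  obtain w where w: "w \<in> carrier DL.L"
    "\<And>Q. F_centric S F Q \<Longrightarrow> DL.val (F_class S F Q) w = 1 / of_int (\<mu> (F_class S F Q) (\<xi> S_class))"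
    using top_inverse by blast
  let ?H = "{x \<in> carrier R. \<exists>y\<in>carrier DL.L. matches x y}"
  have "x \<in> ?H"
  proof (rule stable_in_span[where D = subgroups])
    have "matches \<zero>\<^bsub>R\<^esub> \<zero>\<^bsub>DL.L\<^esub>"
      by (simp add: matches_def L.v_zero R.v_zero class_centric centric_subgroup)
    then show "\<zero>\<^bsub>R\<^esub> \<in> ?H" using L.zero_in R.zero_in by blast
  next
    fix x x' assume "x \<in> ?H" "x' \<in> ?H"
    then obtain y y' where *: "x \<in> carrier R" "x' \<in> carrier R" "y \<in> carrier DL.L" "y' \<in> carrier DL.L"
      "matches x y" "matches x' y'" by blast
    then have "matches (x \<oplus>\<^bsub>R\<^esub> x') (y \<oplus>\<^bsub>DL.L\<^esub> y')"
      by (simp add: matches_def L.v_add R.v_add class_centric centric_subgroup)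
    then show "x \<oplus>\<^bsub>R\<^esub> x' \<in> ?H" using * L.add_closed R.add_closed by blast
  next
    fix r x assume r: "r \<in> p_integral p" and "x \<in> ?H"
    then obtain y where *: "x \<in> carrier R" "y \<in> carrier DL.L" "matches x y" by blast
    then have "matches (r \<odot>\<^bsub>R\<^esub> x) (r \<odot>\<^bsub>DL.L\<^esub> y)"
      using r by (simp add: matches_def DL.val_smult loc_mark_smult class_centric centric_subgroup)
    then show "r \<odot>\<^bsub>R\<^esub> x \<in> ?H"
      using * DL.loc_smult_closed[OF r] fusion_smult_closed[OF r] by blast
  next
    fix P assume "P \<in> subgroups"
    then have P: "subgroup P S" by simp
    show "\<beta> P \<in> ?H"
    proof (cases "F_centric S F P")
      case True
      then show ?thesis
        using matches_beta[OF w True] L.mult_closed[OF X_closed[OF True] w(1)] beta_closed[OF P] by blast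
    next
      case False
      have "loc_mark Q (\<beta> P) = 0" if "F_centric S F Q" for Q
        using that False P centric_overgroup loc_mark_beta_eq_0_iff[OF P centric_subgroup[OF that]]
        by blast
      then have "matches (\<beta> P) \<zero>\<^bsub>DL.L\<^esub>"
        by (simp add: matches_def L.v_zero class_centric)
      then show ?thesis using L.zero_in beta_closed[OF P] by blast
    qed
  qed (use x in auto)
  then show ?thesis by blast
qed

text \<open>
  It is \<open>y \<xi>_S\<close> rather than \<open>y\<close> that is expanded in the basis of the \<open>\<xi>_P\<close>: the same combination of
  the \<open>\<beta>_P\<close> has centric marks equal to those of \<open>y \<xi>_S\<close> divided by those of \<open>\<xi>_S\<close>.
\<close>

lemma matching_in_fusion_ring:
  assumes y: "y \<in> carrier DL.L"
  shows "\<exists>x\<in>carrier R. matches x y"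
proof -
  let ?I = "centric_classes S F"
  have z: "y \<otimes>\<^bsub>DL.L\<^esub> X (carrier S) \<in> carrier DL.L"
    using L.mult_closed y X_closed[OF centric_carrier] by blast
  then obtain a d where a: "a \<in> carrier A" and d: "\<not> int p dvd d"
    and z_eq: "y \<otimes>\<^bsub>DL.L\<^esub> X (carrier S) = loc_class p A a d"
    by (rule DL.loc_carrierE)
  obtain c :: "'a set set \<Rightarrow> int" where c: "a = (\<Oplus>\<^bsub>A\<^esub>C\<in>?I. [c C] \<cdot>\<^bsub>A\<^esub> \<xi> C)"
    using xi_span[OF a] by blast
  define rep where "rep C = (SOME P. F_centric S F P \<and> F_class S F P = C)" for C
  have rep: "F_centric S F (rep C)" "F_class S F (rep C) = C" if "C \<in> ?I" for C
  proof -
    have "\<exists>P. F_centric S F P \<and> F_class S F P = C" using that by (auto simp: centric_classes_def)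
    then have "F_centric S F (rep C) \<and> F_class S F (rep C) = C"
      unfolding rep_def by (rule someI_ex)
    then show "F_centric S F (rep C)" "F_class S F (rep C) = C" by auto
  qed
  let ?s = "\<lambda>C. of_int (c C) / of_int d :: rat"
  let ?t = "\<lambda>C. ?s C \<odot>\<^bsub>R\<^esub> \<beta> (rep C)"
  have s: "?s C \<in> p_integral p" for C using p_integralI[OF d] .
  have t: "?t C \<in> carrier R" if "C \<in> ?I" for C
    using fusion_smult_closed[OF s beta_closed[OF centric_subgroup[OF rep(1)[OF that]]]] .
  let ?x = "\<Oplus>\<^bsub>R\<^esub>C\<in>?I. ?t C"
  have "matches ?x y"
    unfolding matches_def
  proof (intro allI impI)
    fix Q assume Q: "F_centric S F Q"
    let ?C = "F_class S F Q"
    let ?u = "of_int (\<mu> ?C (\<xi> S_class)) :: rat"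
    have "loc_mark Q ?x * ?u = (\<Sum>C\<in>?I. loc_mark Q (?t C)) * ?u"
      using R.v_finsum[OF finite_centric_classes t] centric_subgroup[OF Q] by simp
    also have "\<dots> = (\<Sum>C\<in>?I. ?s C * of_int (\<mu> ?C (\<xi> C)))"
      unfolding sum_distrib_right
    proof (intro sum.cong refl)
      fix C assume C: "C \<in> ?I"
      have "loc_mark Q (?t C) * ?u = ?s C * (loc_mark Q (\<beta> (rep C)) * ?u)"
        using loc_mark_smult[OF s beta_closed[OF centric_subgroup[OF rep(1)[OF C]]] centric_subgroup[OF Q]]
        by simp
      also have "loc_mark Q (\<beta> (rep C)) * ?u = of_int (\<mu> ?C (\<xi> C))"
        using beta_mark_times_top[OF rep(1)[OF C] Q] rep(2)[OF C] by simp
      finally show "loc_mark Q (?t C) * ?u = ?s C * of_int (\<mu> ?C (\<xi> C))" .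
    qed
    also have "\<dots> = of_int (\<Sum>C\<in>?I. c C * \<mu> ?C (\<xi> C)) / of_int d"
      by (simp add: sum_divide_distrib)
    also have "(\<Sum>C\<in>?I. c C * \<mu> ?C (\<xi> C)) = \<mu> ?C a"
    proof -
      have "\<mu> ?C a = (\<Sum>C\<in>?I. \<mu> ?C ([c C] \<cdot>\<^bsub>A\<^esub> \<xi> C))"
        unfolding c by (rule DL.v_finsum[OF finite_centric_classes _ class_centric[OF Q]])
          (simp add: xi_in)
      also have "\<dots> = (\<Sum>C\<in>?I. c C * \<mu> ?C (\<xi> C))"
        by (intro sum.cong refl) (simp add: DL.v_int_multiple xi_in class_centric[OF Q])
      finally show ?thesis by simp
    qed
    also have "of_int (\<mu> ?C a) / of_int d = DL.val ?C (y \<otimes>\<^bsub>DL.L\<^esub> X (carrier S))"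
      unfolding z_eq using DL.val_loc_class[OF a d class_centric[OF Q]] by simp
    also have "\<dots> = DL.val ?C y * ?u"
      using L.v_mult[OF y X_closed[OF centric_carrier] class_centric[OF Q]]
        val_X[OF centric_carrier Q] by simp
    finally show "DL.val ?C y = loc_mark Q ?x"
      using mark_top_nonzero[OF Q] by simp
  qed
  moreover have "?x \<in> carrier R" using t by (intro R.finsum_closed) auto
  ultimately show ?thesis by blast
qed

text \<open>
  The graph \<open>matches\<close> is a surjective ring homomorphism with kernel \<open>N\<close>. The identity of the localized
  Diaz--Libman ring is the element \<open>\<xi>_S w\<close>, where \<open>w\<close> has the inverse marks of \<open>\<xi>_S\<close>.
\<close>

theorem comparison:
  "ideal (noncentric_submodule p S F \<beta>) R \<and>
    (\<exists>e. cring (DL.L\<lparr>one := e\<rparr>) \<and> X (carrier S) \<in> Units (DL.L\<lparr>one := e\<rparr>) \<and>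
      (\<exists>h \<in> ring_iso (R Quot noncentric_submodule p S F \<beta>) (DL.L\<lparr>one := e\<rparr>).
        \<forall>P. F_centric S F P \<longrightarrow>
          h (noncentric_submodule p S F \<beta> +>\<^bsub>R\<^esub> \<beta> P) =
            X P \<otimes>\<^bsub>DL.L\<lparr>one := e\<rparr>\<^esub> inv\<^bsub>DL.L\<lparr>one := e\<rparr>\<^esub> X (carrier S)))"
proof -
  let ?N = "noncentric_submodule p S F \<beta>" and ?X = "X (carrier S)"
  obtain w where w: "w \<in> carrier DL.L"
    "\<And>Q. F_centric S F Q \<Longrightarrow> DL.val (F_class S F Q) w = 1 / of_int (\<mu> (F_class S F Q) (\<xi> S_class))"
    using top_inverse by blast
  have X: "?X \<in> carrier DL.L" by (rule X_closed[OF centric_carrier])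
  define e where "e = ?X \<otimes>\<^bsub>DL.L\<^esub> w"
  have e: "e \<in> carrier DL.L" unfolding e_def by (rule L.mult_closed[OF X w(1)])
  have val_e: "DL.val (F_class S F Q) e = 1" if "F_centric S F Q" for Q
    unfolding e_def
    using that X w mark_top_nonzero[OF that]
    by (simp add: L.v_mult class_centric val_X centric_carrier)
  let ?L = "DL.L\<lparr>one := e\<rparr>"
  have L_simps: "carrier ?L = carrier DL.L" "x \<otimes>\<^bsub>?L\<^esub> y = x \<otimes>\<^bsub>DL.L\<^esub> y"
    "x \<oplus>\<^bsub>?L\<^esub> y = x \<oplus>\<^bsub>DL.L\<^esub> y" "\<zero>\<^bsub>?L\<^esub> = \<zero>\<^bsub>DL.L\<^esub>" "\<one>\<^bsub>?L\<^esub> = e" for x y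
    by simp_all
  have emb: "function_embedding ?L (centric_classes S F) DL.val"
    using DL.localization_embedding unfolding function_embedding_def L_simps .
  have cring_L: "cring ?L"
  proof (rule function_embedding.embedded_cring[OF emb])
    show "\<one>\<^bsub>?L\<^esub> \<in> carrier ?L" using e by simp
    show "DL.val C \<one>\<^bsub>?L\<^esub> = 1" if "C \<in> centric_classes S F" for C
      using that val_e by (auto simp: centric_classes_def)
  qed
  interpret L': cring ?L by (rule cring_L)
  interpret RR: cring R by (rule fusion_cring)
  have inv: "inv\<^bsub>?L\<^esub> ?X = w"
    using X w(1) by (intro L'.comm_inv_char) (simp_all add: e_def)
  have unit: "?X \<in> Units ?L"
  proof -
    have "?X \<otimes>\<^bsub>?L\<^esub> w = \<one>\<^bsub>?L\<^esub>" by (simp add: e_def)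
    moreover have "w \<otimes>\<^bsub>?L\<^esub> ?X = ?X \<otimes>\<^bsub>?L\<^esub> w"
      by (rule L'.m_comm) (simp_all only: L_simps X w(1))
    ultimately show ?thesis
      unfolding Units_def L_simps(1)
      by (intro CollectI conjI bexI[OF _ w(1)] X) (simp_all only:)
  qed
  define h where "h x = (SOME y. y \<in> carrier DL.L \<and> matches x y)" for x
  have h: "h x \<in> carrier DL.L" "matches x (h x)" if "x \<in> carrier R" for x
  proof -
    have "\<exists>y. y \<in> carrier DL.L \<and> matches x y" using matching_in_DL[OF that] by blast
    then have "h x \<in> carrier DL.L \<and> matches x (h x)" unfolding h_def by (rule someI_ex)
    then show "h x \<in> carrier DL.L" "matches x (h x)" by auto
  qed
  have h_eq: "h x = y" if "x \<in> carrier R" "y \<in> carrier DL.L" "matches x y" for x y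
    using h[OF that(1)] that(2,3) by (intro DL_eqI) (auto simp: matches_def)
  have hom: "ring_hom_ring R ?L h"
  proof (rule ring_hom_ringI2[OF RR.ring_axioms L'.ring_axioms], rule ring_hom_memI)
    fix x y assume x: "x \<in> carrier R" and y: "y \<in> carrier R"
    show "h x \<in> carrier ?L" using h(1)[OF x] by simp
    have "matches (x \<otimes>\<^bsub>R\<^esub> y) (h x \<otimes>\<^bsub>DL.L\<^esub> h y)"
      using h[OF x] h[OF y] x y
      by (simp add: matches_def L.v_mult R.v_mult class_centric centric_subgroup)
    then show "h (x \<otimes>\<^bsub>R\<^esub> y) = h x \<otimes>\<^bsub>?L\<^esub> h y"
      using h_eq[OF R.mult_closed[OF x y] L.mult_closed[OF h(1)[OF x] h(1)[OF y]]] by simp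
    have "matches (x \<oplus>\<^bsub>R\<^esub> y) (h x \<oplus>\<^bsub>DL.L\<^esub> h y)"
      using h[OF x] h[OF y] x y
      by (simp add: matches_def L.v_add R.v_add class_centric centric_subgroup)
    then show "h (x \<oplus>\<^bsub>R\<^esub> y) = h x \<oplus>\<^bsub>?L\<^esub> h y"
      using h_eq[OF R.add_closed[OF x y] L.add_closed[OF h(1)[OF x] h(1)[OF y]]] by simp
  next
    have "matches \<one>\<^bsub>R\<^esub> e"
      by (simp add: matches_def val_e fusion_one centric_subgroup)
    then show "h \<one>\<^bsub>R\<^esub> = \<one>\<^bsub>?L\<^esub>" using h_eq[OF fusion_one(1) e] by simp
  qed
  have kernel: "a_kernel R ?L h = ?N"
  proof -
    have "h x = \<zero>\<^bsub>DL.L\<^esub> \<longleftrightarrow> (\<forall>Q. F_centric S F Q \<longrightarrow> loc_mark Q x = 0)" if x: "x \<in> carrier R" for x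
    proof
      assume "h x = \<zero>\<^bsub>DL.L\<^esub>"
      then show "\<forall>Q. F_centric S F Q \<longrightarrow> loc_mark Q x = 0"
        using h(2)[OF x] by (simp add: matches_def L.v_zero class_centric)
    next
      assume "\<forall>Q. F_centric S F Q \<longrightarrow> loc_mark Q x = 0"
      then show "h x = \<zero>\<^bsub>DL.L\<^esub>"
        using L.zero_in by (intro h_eq[OF x]) (simp_all add: matches_def L.v_zero class_centric)
    qed
    then show ?thesis unfolding a_kernel_def' noncentric_submodule_eq by auto
  qed
  have surj: "h ` carrier R = carrier ?L"
  proof (intro equalityI subsetI)
    fix y assume "y \<in> carrier ?L"
    then have y: "y \<in> carrier DL.L" by simp
    obtain x where x: "x \<in> carrier R" "matches x y" using matching_in_fusion_ring[OF y] by blast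
    then have "h x = y" using h_eq y by blast
    then show "y \<in> h ` carrier R" using x(1) by blast
  qed (use h(1) in auto)
  interpret h: ring_hom_ring R ?L h by (rule hom)
  have iso: "(\<lambda>C. the_elem (h ` C)) \<in> ring_iso (R Quot ?N) ?L"
    using h.FactRing_iso_set[OF surj] unfolding kernel .
  have value_beta: "the_elem (h ` (?N +>\<^bsub>R\<^esub> \<beta> P)) = X P \<otimes>\<^bsub>?L\<^esub> inv\<^bsub>?L\<^esub> ?X" if P: "F_centric S F P" for P
  proof -
    have b: "\<beta> P \<in> carrier R" by (rule beta_closed[OF centric_subgroup[OF P]])
    have "the_elem (h ` (?N +>\<^bsub>R\<^esub> \<beta> P)) = h (\<beta> P)"
      using h.the_elem_simp[OF b] unfolding kernel .
    also have "\<dots> = X P \<otimes>\<^bsub>DL.L\<^esub> w"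
      by (rule h_eq[OF b L.mult_closed[OF X_closed[OF P] w(1)] matches_beta[OF w P]])
    finally show ?thesis unfolding inv L_simps .
  qed
  show ?thesis
  proof (intro conjI exI[of _ e])
    show "ideal ?N R" using h.kernel_is_ideal unfolding kernel .
    show "\<exists>h \<in> ring_iso (R Quot ?N) ?L. \<forall>P. F_centric S F P \<longrightarrow>
        h (?N +>\<^bsub>R\<^esub> \<beta> P) = X P \<otimes>\<^bsub>?L\<^esub> inv\<^bsub>?L\<^esub> ?X"
    proof (rule bexI[OF _ iso], intro allI impI)
      fix P assume "F_centric S F P"
      then show "the_elem (h ` (?N +>\<^bsub>R\<^esub> \<beta> P)) = X P \<otimes>\<^bsub>?L\<^esub> inv\<^bsub>?L\<^esub> ?X"
        by (rule value_beta)
    qed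
  qed (rule cring_L unit)+
qed

end

theorem proposition4p13:
  fixes S :: "('a, 'm) monoid_scheme"
    and p :: nat
    and F :: "'a set \<Rightarrow> 'a set \<Rightarrow> ('a \<Rightarrow> 'a) set"
    and \<beta> :: "'a set \<Rightarrow> ('a burnside \<times> int) set"
    and A :: "('c, 'n) ring_scheme"
    and \<xi> :: "'a set set \<Rightarrow> 'c"
  assumes "saturated_fusion_system S p F"
    and "\<And>P. subgroup P S \<Longrightarrow> is_beta p S F P (\<beta> P)"
    and "diaz_libman_ring A S F \<xi>"
  shows "ideal (noncentric_submodule p S F \<beta>) (fusion_burnside_ring p S F) \<and>
    (\<exists>e. let
        R = fusion_burnside_ring p S F;
        N = noncentric_submodule p S F \<beta>;
        L = (p_localization p A)\<lparr>one := e\<rparr>;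
        X = (\<lambda>P. loc_class p A (\<xi> (F_class S F P)) 1)
      in
        cring L \<and>
        X (carrier S) \<in> Units L \<and>
        (\<exists>h \<in> ring_iso (R Quot N) L.
           \<forall>P. F_centric S F P \<longrightarrow> h (N +>\<^bsub>R\<^esub> \<beta> P) = X P \<otimes>\<^bsub>L\<^esub> inv\<^bsub>L\<^esub> X (carrier S)))"
proof -
  interpret S: saturated_fusion_system S p F by (rule assms(1))
  interpret D: diaz_libman_ring A S F \<xi> by (rule assms(3))
  let ?I = "centric_classes S F"
  obtain \<Phi> where mult: "\<Phi> \<in> hom A (int_product_ring ?I)"
    and add: "\<Phi> \<in> hom (add_monoid A) (add_monoid (int_product_ring ?I))"
    and inj: "inj_on \<Phi> (carrier A)"
    and fin: "finite (a_rcosets\<^bsub>int_product_ring ?I\<^esub> (\<Phi> ` carrier A))"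
    and mark: "\<And>P Q. \<lbrakk>F_centric S F P; F_centric S F Q\<rbrakk> \<Longrightarrow>
      (of_int (\<Phi> (\<xi> (F_class S F P)) (F_class S F Q)) :: rat) =
        of_nat (card (centralizer S Q \<inter> Q) * card (F Q P)) / of_nat (card P)"
    using D.mark_hom by blast
  have ext: "\<Phi> a \<in> extensional ?I" if "a \<in> carrier A" for a
    using hom_in_carrier[OF mult that] by (auto simp: int_product_ring_def PiE_def)
  have \<Phi>_add: "\<Phi> (a \<oplus>\<^bsub>A\<^esub> b) C = \<Phi> a C + \<Phi> b C"
    if "a \<in> carrier A" "b \<in> carrier A" "C \<in> ?I" for a b C
    using hom_mult[OF add, of a b] that by (simp add: int_product_ring_def)
  have \<Phi>_mult: "\<Phi> (a \<otimes>\<^bsub>A\<^esub> b) C = \<Phi> a C * \<Phi> b C"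
    if "a \<in> carrier A" "b \<in> carrier A" "C \<in> ?I" for a b C
    using hom_mult[OF mult, of a b] that by (simp add: int_product_ring_def)
  have \<Phi>_zero: "\<Phi> \<zero>\<^bsub>A\<^esub> C = 0" if "C \<in> ?I" for C
    using \<Phi>_add[of "\<zero>\<^bsub>A\<^esub>" "\<zero>\<^bsub>A\<^esub>" C] that by simp
  have emb: "function_embedding A ?I (\<lambda>C a. \<Phi> a C)"
  proof
    fix a assume a: "a \<in> carrier A"
    have "\<Phi> (\<ominus>\<^bsub>A\<^esub> a) C = - \<Phi> a C" if "C \<in> ?I" for C
      using \<Phi>_add[of "\<ominus>\<^bsub>A\<^esub> a" a C] \<Phi>_zero[OF that] a that by (simp add: D.l_neg)
    then show "\<exists>b\<in>carrier A. \<forall>C\<in>?I. \<Phi> b C = - \<Phi> a C"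
      using D.a_inv_closed[OF a] by blast
  next
    fix a b assume "a \<in> carrier A" "b \<in> carrier A" "\<And>C. C \<in> ?I \<Longrightarrow> \<Phi> a C = \<Phi> b C"
    then show "a = b"
      using inj ext by (metis extensionalityI inj_onD)
  qed (auto simp: \<Phi>_add \<Phi>_mult \<Phi>_zero D.rng_closed)
  obtain n :: nat where n: "n > 0" "\<And>f. \<exists>a\<in>carrier A. \<forall>C\<in>?I. \<Phi> a C = int n * f C"
    using finite_cokernel_multiple[OF emb fin] by blast
  interpret centric_comparison S p F \<beta> A "\<lambda>C a. \<Phi> a C" \<xi> n
  proof (intro centric_comparison.intro centric_comparison_axioms.intro fusion_basis.intro
      fusion_basis_axioms.intro embedded_localization.intro embedded_localization_axioms.intro)
    show "saturated_fusion_system S p F" by (rule assms(1))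
    show "fusion_system S p F" by (rule S.fusion_system_axioms)
    show "\<exists>c. a = (\<Oplus>\<^bsub>A\<^esub>C\<in>?I. [(c C :: int)] \<cdot>\<^bsub>A\<^esub> \<xi> C)" if "a \<in> carrier A" for a
      using D.xi_basis[OF that] by blast
  qed (use assms(2) emb S.prime_p D.xi_closed mark n in auto)
  show ?thesis
    using comparison unfolding Let_def .
qed

end
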